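(* Let $\pi:(X,T)\to(Y,T)$ be a factor map of minimal t.d.s. and $m\in\mathbb{N}$. Let the PI tower of $\pi$ be given by systems $X_\nu,Y_\nu$ ($0\le\nu\le\eta$), $Z_{\nu+1}$ ($\nu<\eta$), and maps $\pi_\nu,\sigma_{\nu+1},\rho_{\nu+1},\theta_\nu,\tilde\theta_\nu$, with $X_\eta=X_\infty$, $Y_\eta=Y_\infty$, $\pi_\eta=\pi_\infty$. Let $X=X^{m,1}\cup\cdots\cup X^{m,l_m}$ be the decomposition of $X$ into pairwise disjoint $T^m$-minimal sets, where $l_m=l_m(X,T)$ divides $m$ and $TX^{m,j}=X^{m,j+1\ (\mathrm{mod}\ l_m)}$. Then there are also decompositions into disjoint unions $$X_\nu=X_\nu^{m,1}\cup\cdots\cup X_\nu^{m,l_m}\ (\nu\ge0),\quad Y_\nu=Y_\nu^{m,1}\cup\cdots\cup Y_\nu^{m,l_m}\ (\nu\ge1),\quad Z_\nu=Z_\nu^{m,1}\cup\cdots\cup Z_\nu^{m,l_m}\ (\nu\ge1)$$ for all $\nu\le\eta$ (for $Z_\nu$: whenever $Z_\nu$ occurs in the tower), such that, writing $Y_0^{m,j}=\pi_0(X_0^{m,j})$: (1) $TH_\nu^{m,j}=H_\nu^{m,j+1\ (\mathrm{mod}\ l_m)}$ and the systems $(H_\nu^{m,j},T^m)$, $j=1,\dots,l_m$, are minimal, where $H$ is any of $X,Y,Z$ (with $\nu\ge 0$ for $X$ and $\nu\ge1$ for $Y,Z$); (2) $\pi_\nu(X_\nu^{m,j})=Y_\nu^{m,j}$,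 $\sigma_{\nu+1}(X_\nu^{m,j})=Z_{\nu+1}^{m,j}$, $\rho_{\nu+1}(Z_{\nu+1}^{m,j})=Y_\nu^{m,j}$ for $1\le j\le l_m$; (3) for each $1\le j\le l_m$, the PI tower of $\pi:(X^{m,j},T^m)\to(\pi(X^{m,j}),T^m)$ is given by the systems $X_\nu^{m,j}$ ($0\le\nu\le\eta$), $\pi_0(X_0^{m,j})$, $Y_\nu^{m,j}$ ($1\le\nu\le\eta$), $Z_{\nu+1}^{m,j}$ ($\nu<\eta$), all with the transformation $T^m$, and the restrictions of the maps $\pi_\nu,\sigma_{\nu+1},\rho_{\nu+1},\theta_\nu,\tilde\theta_\nu$.
   Context: A t.d.s. $(X,T)$ is a compact metric space $X$ with a homeomorphism $T$; a factor map is a continuous equivariant surjection. Minimal: every orbit is dense. It is known that for a minimal $(X,T)$ and $m\in\mathbb{N}$, $X$ is a disjoint union of $l_m(X,T)$ sets $X^{m,j}$ that are $T^m$-minimal, with $l_m\mid m$ and $TX^{m,j}=X^{m,j+1\ (\mathrm{mod}\ l_m)}$. For a factor map $\pi:X\to Y$ of minimal systems: $R_\pi=\{(x,x'):\pi(x)=\pi(x')\}$, $R_\pi^n=\{(x_1,\dots,x_n):\pi(x_1)=\cdots=\pi(x_n)\}$. $\pi$ is proximal if $\inf_n\rho(T^nx,T^nx')=0$ for all $(x,x')\in R_\pi$. $\pi$ is equicontinuous if for every $\epsilon>0$ there is $\delta>0$ such that $(x,x')\in R_\pi$, $\rho(x,x')<\delta$ imply $\rho(T^nx,T^nx')<\epsilon$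 for all $n\in\mathbb{Z}$. $\pi$ is weakly mixing if $(R_\pi,T\times T)$ is transitive. $\pi$ is RIC if, for a minimal left ideal $M$ of $\beta\mathbb{Z}$, an idempotent $u\in M$ and $y_0\in Y$ with $uy_0=y_0$, one has $\pi^{-1}(py_0)=p\circ u\pi^{-1}(y_0)$ for all $p\in M$, where $p\circ A=\lim_\lambda T^{m_\lambda}A$ in the Hausdorff topology on closed subsets for a net $m_\lambda\to p$ in $\beta\mathbb{Z}$; equivalently, $\pi$ is open and for every $n\ge1$ the minimal points are dense in $R_\pi^n$. $Q_\pi(X,T)$ is the set of $(x,y)$ for which there are $(x_i,y_i)\in R_\pi$, $n_i\in\mathbb{Z}$, $z\in X$ with $(x_i,y_i)\to(x,y)$ and $(T^{n_i}x_i,T^{n_i}y_i)\to(z,z)$; if $\pi$ is RIC it is a closed invariant equivalence relation and $X/Q_\pi(X,T)$ is the largest equicontinuous extension of $Y$ within $X$. A PI tower of a factor map $\pi:X\to Y$ of minimal systems consists of an ordinal $\eta$ and a commutative diagram of minimal systems $X_\nu,Y_\nu$ ($0\le\nu\le\eta$), $Z_{\nu+1}$ ($\nu<\eta$) and factor maps $\pi_\nu:X_\nu\to Y_\nu$, $\tilde\theta_0:X_0\to X$, $\theta_0:Y_0\to Y$, and for $\nu<\eta$: $\sigma_{\nu+1}:X_\nu\to Z_{\nu+1}$, $\rho_{\nu+1}:Z_{\nu+1}\to Y_\nu$, $\theta_{\nu+1}:Y_{\nu+1}\to Z_{\nu+1}$, $\tilde\theta_{\nu+1}:X_{\nu+1}\to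 X_\nu$, with $\pi\tilde\theta_0=\theta_0\pi_0$, $\rho_{\nu+1}\sigma_{\nu+1}=\pi_\nu$, $\sigma_{\nu+1}\tilde\theta_{\nu+1}=\theta_{\nu+1}\pi_{\nu+1}$, such that: every $\pi_\nu$ is RIC; all $\theta_\nu,\tilde\theta_\nu$ are proximal; $Z_{\nu+1}=X_\nu/Q_{\pi_\nu}(X_\nu,T)$ (so $\rho_{\nu+1}$ is equicontinuous, the largest such within $X_\nu$); for limit ordinals $\nu$ the $X_\nu,Y_\nu,\pi_\nu$ are inverse limits of the earlier ones; and $\pi_\infty:=\pi_\eta$ is RIC and weakly mixing. Such a tower always exists, by repeatedly lifting a factor map to a RIC one by proximal extensions (the Ellis–Glasner–Shapiro diagram) and passing to the largest equicontinuous extension. *)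

theory Defs
  imports "HOL-Analysis.Analysis"
begin

section \<open>Topological dynamical systems\<close>

record 'a tds =
  met :: "'a metric"
  act :: "'a \<Rightarrow> 'a"

abbreviation pts :: "'a tds \<Rightarrow> 'a set" where
  "pts S \<equiv> mspace (met S)"

abbreviation top_of :: "'a tds \<Rightarrow> 'a topology" where
  "top_of S \<equiv> mtopology_of (met S)"

text \<open>The phase space is understood to be nonempty. The transformation is a total HOL function;
  its values outside the phase space are irrelevant.\<close>

definition is_tds :: "'a tds \<Rightarrow> bool" where
  "is_tds S \<longleftrightarrow> pts S \<noteq> {} \<and> compact_space (top_of S) \<and>
     homeomorphic_map (top_of S) (top_of S) (act S)"

definition iter :: "'a tds \<Rightarrow> int \<Rightarrow> 'a \<Rightarrow> 'a" where
  "iter S n = (if 0 \<le> n then act S ^^ nat n else inv_into (pts S) (act S) ^^ nat (- n))"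

definition minimal_tds :: "'a tds \<Rightarrow> bool" where
  "minimal_tds S \<longleftrightarrow> is_tds S \<and>
     (\<forall>x\<in>pts S. top_of S closure_of (range (\<lambda>n. iter S n x)) = pts S)"

text \<open>The subsystem \<open>(A, T\<^sup>m)\<close> of \<open>(X, T\<^sup>m)\<close>. It being a t.d.s. includes that \<open>A\<close> is closed
  (being compact) and that \<open>T\<^sup>m A = A\<close>.\<close>

definition power_subsystem :: "'a tds \<Rightarrow> 'a set \<Rightarrow> nat \<Rightarrow> 'a tds" where
  "power_subsystem S A m = \<lparr>met = submetric (met S) A, act = act S ^^ m\<rparr>"

text \<open>Decomposition into \<open>l\<close> pairwise disjoint \<open>T\<^sup>m\<close>-minimal sets indexed by \<open>1, \<dots>, l\<close>; the
  cyclic successor of the index \<open>j\<close> is \<open>j mod l + 1\<close>.\<close>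

definition cyclic_decomposition :: "'a tds \<Rightarrow> nat \<Rightarrow> nat \<Rightarrow> (nat \<Rightarrow> 'a set) \<Rightarrow> bool" where
  "cyclic_decomposition S m l A \<longleftrightarrow>
     (\<Union>j\<in>{1..l}. A j) = pts S \<and>
     disjoint_family_on A {1..l} \<and>
     (\<forall>j\<in>{1..l}. minimal_tds (power_subsystem S (A j) m)) \<and>
     (\<forall>j\<in>{1..l}. act S ` A j = A (j mod l + 1))"

section \<open>Factor maps\<close>

definition factor_map :: "'a tds \<Rightarrow> 'b tds \<Rightarrow> ('a \<Rightarrow> 'b) \<Rightarrow> bool" where
  "factor_map S S' f \<longleftrightarrow> continuous_map (top_of S) (top_of S') f \<and>
     f ` pts S = pts S' \<and> (\<forall>x\<in>pts S. f (act S x) = act S' (f x))"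

definition fibre_rel :: "'a tds \<Rightarrow> ('a \<Rightarrow> 'b) \<Rightarrow> ('a \<times> 'a) set" where
  "fibre_rel S f = {(x, x'). x \<in> pts S \<and> x' \<in> pts S \<and> f x = f x'}"

definition proximal_map :: "'a tds \<Rightarrow> ('a \<Rightarrow> 'b) \<Rightarrow> bool" where
  "proximal_map S f \<longleftrightarrow>
     (\<forall>(x, x')\<in>fibre_rel S f. (INF n::int. mdist (met S) (iter S n x) (iter S n x')) = 0)"

definition transitive_action :: "'a topology \<Rightarrow> (int \<Rightarrow> 'a \<Rightarrow> 'a) \<Rightarrow> bool" where
  "transitive_action \<tau> f \<longleftrightarrow>
     (\<forall>U V. openin \<tau> U \<and> openin \<tau> V \<and> U \<noteq> {} \<and> V \<noteq> {} \<longrightarrow> (\<exists>n. f n ` U \<inter> V \<noteq> {}))"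

definition weakly_mixing_map :: "'a tds \<Rightarrow> ('a \<Rightarrow> 'b) \<Rightarrow> bool" where
  "weakly_mixing_map S f \<longleftrightarrow>
     transitive_action (subtopology (prod_topology (top_of S) (top_of S)) (fibre_rel S f))
       (\<lambda>n. map_prod (iter S n) (iter S n))"

text \<open>The relation \<open>Q\<^sub>\<pi>\<close>; since the spaces are metric, sequences suffice.\<close>

definition Q_rel :: "'a tds \<Rightarrow> ('a \<Rightarrow> 'b) \<Rightarrow> ('a \<times> 'a) set" where
  "Q_rel S f = {(x, y). \<exists>(xs :: nat \<Rightarrow> 'a) ys (n :: nat \<Rightarrow> int) z.
     (\<forall>i. (xs i, ys i) \<in> fibre_rel S f) \<and>
     limitin (top_of S) xs x sequentially \<and> limitin (top_of S) ys y sequentially \<and>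
     limitin (top_of S) (\<lambda>i. iter S (n i) (xs i)) z sequentially \<and>
     limitin (top_of S) (\<lambda>i. iter S (n i) (ys i)) z sequentially}"

section \<open>The semigroup of ultrafilters on the integers and RIC maps\<close>

definition betaZ :: "int filter set" where
  "betaZ = {p. p \<noteq> bot \<and> (\<forall>P. eventually P p \<or> eventually (\<lambda>n. \<not> P n) p)}"

text \<open>The operation is the one for which \<open>(p + q) x = p (q x)\<close>, so that left ideals act by
  minimal subsets.\<close>

definition beta_plus :: "int filter \<Rightarrow> int filter \<Rightarrow> int filter" where
  "beta_plus p q = Abs_filter (\<lambda>P. eventually (\<lambda>n. eventually (\<lambda>k. P (n + k)) q) p)"

lemma eventually_beta_plus:
  "eventually P (beta_plus p q) \<longleftrightarrow> eventually (\<lambda>n. eventually (\<lambda>k. P (n + k)) q) p"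
proof -
  have "is_filter (\<lambda>P. eventually (\<lambda>n. eventually (\<lambda>k. P (n + k)) q) p)"
  proof
    fix P Q :: "int \<Rightarrow> bool"
    assume "\<forall>\<^sub>F n in p. \<forall>\<^sub>F k in q. P (n + k)" "\<forall>\<^sub>F n in p. \<forall>\<^sub>F k in q. Q (n + k)"
    then show "\<forall>\<^sub>F n in p. \<forall>\<^sub>F k in q. P (n + k) \<and> Q (n + k)"
      by eventually_elim (rule eventually_conj)
  next
    fix P Q :: "int \<Rightarrow> bool"
    assume *: "\<forall>x. P x \<longrightarrow> Q x" and "\<forall>\<^sub>F n in p. \<forall>\<^sub>F k in q. P (n + k)"
    from this(2) show "\<forall>\<^sub>F n in p. \<forall>\<^sub>F k in q. Q (n + k)"
      by (rule eventually_mono) (use * in \<open>auto elim: eventually_mono\<close>)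
  qed simp
  then show ?thesis
    unfolding beta_plus_def by (rule eventually_Abs_filter)
qed

definition left_ideal :: "int filter set \<Rightarrow> bool" where
  "left_ideal M \<longleftrightarrow> M \<noteq> {} \<and> M \<subseteq> betaZ \<and> (\<forall>p\<in>betaZ. \<forall>q\<in>M. beta_plus p q \<in> M)"

definition minimal_left_ideal :: "int filter set \<Rightarrow> bool" where
  "minimal_left_ideal M \<longleftrightarrow> left_ideal M \<and> (\<forall>N. left_ideal N \<and> N \<subseteq> M \<longrightarrow> N = M)"

text \<open>\<open>p x = lim T\<^sup>n x\<close> as \<open>n \<rightarrow> p\<close>.\<close>

definition beta_act :: "'a tds \<Rightarrow> int filter \<Rightarrow> 'a \<Rightarrow> 'a" where
  "beta_act S p x = (THE y. limitin (top_of S) (\<lambda>n. iter S n x) y p)"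

text \<open>Convergence to the closed set \<open>B\<close> in the Hausdorff metric.\<close>

definition hausdorff_limit :: "'a metric \<Rightarrow> ('i \<Rightarrow> 'a set) \<Rightarrow> 'a set \<Rightarrow> 'i filter \<Rightarrow> bool" where
  "hausdorff_limit d F B p \<longleftrightarrow> closedin (mtopology_of d) B \<and>
     (\<forall>\<epsilon>>0. eventually (\<lambda>n. (\<forall>a\<in>F n. \<exists>b\<in>B. mdist d a b < \<epsilon>) \<and>
                             (\<forall>b\<in>B. \<exists>a\<in>F n. mdist d a b < \<epsilon>)) p)"

text \<open>The circle operation \<open>p \<circ> A\<close>. The limit along any net \<open>m\<^sub>\<lambda> \<rightarrow> p\<close> is the limit along the
  ultrafilter \<open>p\<close> itself; a set \<open>A\<close> that is not closed is identified with its closure.\<close>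

definition beta_circ :: "'a tds \<Rightarrow> int filter \<Rightarrow> 'a set \<Rightarrow> 'a set" where
  "beta_circ S p A =
     (THE B. hausdorff_limit (met S) (\<lambda>n. iter S n ` (top_of S closure_of A)) B p)"

definition RIC :: "'a tds \<Rightarrow> 'b tds \<Rightarrow> ('a \<Rightarrow> 'b) \<Rightarrow> bool" where
  "RIC S S' f \<longleftrightarrow> (\<exists>M u y0. minimal_left_ideal M \<and> u \<in> M \<and> beta_plus u u = u \<and>
     y0 \<in> pts S' \<and> beta_act S' u y0 = y0 \<and>
     (\<forall>p\<in>M. {x \<in> pts S. f x = beta_act S' p y0} =
              beta_circ S p (beta_act S u ` {x \<in> pts S. f x = y0})))"

section \<open>PI towers\<close>

text \<open>Ordinals up to \<open>\<eta>\<close> are represented by the elements up to \<open>\<eta>\<close> of an arbitrary well-ordered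
  type. The successor is used only for \<open>\<nu> < \<eta>\<close>, where it exists.\<close>

definition ozero :: "'i::wellorder" where
  "ozero = (LEAST \<nu>. True)"

definition osucc :: "'i::wellorder \<Rightarrow> 'i" where
  "osucc \<nu> = (LEAST \<mu>. \<nu> < \<mu>)"

definition olimit :: "'i::wellorder \<Rightarrow> bool" where
  "olimit \<nu> \<longleftrightarrow> \<nu> \<noteq> ozero \<and> (\<forall>\<mu><\<nu>. osucc \<mu> < \<nu>)"

text \<open>Components \<open>Z, \<sigma>, \<rho>\<close>, \<open>\<theta>\<close>, \<open>\<theta>~\<close> are meaningful only at successor indices; the maps
  \<open>\<theta>\<^sub>0\<close> and \<open>\<theta>~\<^sub>0\<close> have their own fields because their codomains are \<open>Y\<close> and \<open>X\<close>. The maps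
  \<open>conX \<nu> \<mu> : X\<^sub>\<nu> \<rightarrow> X\<^sub>\<mu>\<close> and \<open>conY \<nu> \<mu> : Y\<^sub>\<nu> \<rightarrow> Y\<^sub>\<mu>\<close> for \<open>\<mu> \<le> \<nu>\<close> are the connecting maps of the
  inverse systems underlying the limit stages.\<close>

record ('i, 'a, 'b, 'x, 'y, 'z) tower =
  towX :: "'i \<Rightarrow> 'x tds"
  towY :: "'i \<Rightarrow> 'y tds"
  towZ :: "'i \<Rightarrow> 'z tds"
  tow\<pi> :: "'i \<Rightarrow> 'x \<Rightarrow> 'y"
  tow\<sigma> :: "'i \<Rightarrow> 'x \<Rightarrow> 'z"
  tow\<rho> :: "'i \<Rightarrow> 'z \<Rightarrow> 'y"
  tow\<theta>0 :: "'y \<Rightarrow> 'b"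
  tow\<theta> :: "'i \<Rightarrow> 'y \<Rightarrow> 'z"
  tow\<theta>t0 :: "'x \<Rightarrow> 'a"
  tow\<theta>t :: "'i \<Rightarrow> 'x \<Rightarrow> 'x"
  conX :: "'i \<Rightarrow> 'i \<Rightarrow> 'x \<Rightarrow> 'x"
  conY :: "'i \<Rightarrow> 'i \<Rightarrow> 'y \<Rightarrow> 'y"

definition inverse_system :: "'i::wellorder \<Rightarrow> ('i \<Rightarrow> 'x tds) \<Rightarrow> ('i \<Rightarrow> 'i \<Rightarrow> 'x \<Rightarrow> 'x) \<Rightarrow> bool" where
  "inverse_system \<eta> S c \<longleftrightarrow>
     (\<forall>\<nu>\<le>\<eta>. \<forall>\<mu>\<le>\<nu>. factor_map (S \<nu>) (S \<mu>) (c \<nu> \<mu>)) \<and>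
     (\<forall>\<nu>\<le>\<eta>. \<forall>x\<in>pts (S \<nu>). c \<nu> \<nu> x = x) \<and>
     (\<forall>\<nu>\<le>\<eta>. \<forall>\<mu>\<le>\<nu>. \<forall>\<kappa>\<le>\<mu>. \<forall>x\<in>pts (S \<nu>). c \<mu> \<kappa> (c \<nu> \<mu> x) = c \<nu> \<kappa> x)"

text \<open>\<open>S \<nu>\<close> is the inverse limit of the \<open>S \<mu>\<close>, \<open>\<mu> < \<nu>\<close>: the canonical map identifies it with the
  space of threads in the product.\<close>

definition is_inverse_limit :: "'i::wellorder \<Rightarrow> ('i \<Rightarrow> 'x tds) \<Rightarrow> ('i \<Rightarrow> 'i \<Rightarrow> 'x \<Rightarrow> 'x) \<Rightarrow> bool" where
  "is_inverse_limit \<nu> S c \<longleftrightarrow>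
     homeomorphic_map (top_of (S \<nu>))
       (subtopology (product_topology (\<lambda>\<mu>. top_of (S \<mu>)) {..<\<nu>})
          {t \<in> (\<Pi>\<^sub>E \<mu>\<in>{..<\<nu>}. pts (S \<mu>)). \<forall>\<mu><\<nu>. \<forall>\<kappa>\<le>\<mu>. c \<mu> \<kappa> (t \<mu>) = t \<kappa>})
       (\<lambda>x. \<lambda>\<mu>\<in>{..<\<nu>}. c \<nu> \<mu> x)"

text \<open>\<open>Z\<^bsub>\<nu>+1\<^esub> = X\<^sub>\<nu> / Q\<close> is expressed by saying that the fibre relation of the factor map
  \<open>\<sigma>\<^bsub>\<nu>+1\<^esub>\<close> is \<open>Q\<close>: by compactness, \<open>Z\<^bsub>\<nu>+1\<^esub>\<close> then is the quotient system and \<open>\<sigma>\<^bsub>\<nu>+1\<^esub>\<close>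
  the quotient map. That the limit maps \<open>\<pi>\<^sub>\<nu>\<close> are inverse limits of the earlier ones is the
  compatibility of \<open>\<pi>\<close> with the connecting maps.\<close>

definition is_PI_tower ::
  "'i::wellorder \<Rightarrow> 'a tds \<Rightarrow> 'b tds \<Rightarrow> ('a \<Rightarrow> 'b) \<Rightarrow> ('i, 'a, 'b, 'x, 'y, 'z) tower \<Rightarrow> bool" where
  "is_PI_tower \<eta> X Y \<pi> P \<longleftrightarrow>
     minimal_tds X \<and> minimal_tds Y \<and> factor_map X Y \<pi> \<and>
     (\<forall>\<nu>\<le>\<eta>. minimal_tds (towX P \<nu>) \<and> minimal_tds (towY P \<nu>) \<and>
        factor_map (towX P \<nu>) (towY P \<nu>) (tow\<pi> P \<nu>) \<and>
        RIC (towX P \<nu>) (towY P \<nu>) (tow\<pi> P \<nu>)) \<and>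
     factor_map (towX P ozero) X (tow\<theta>t0 P) \<and> proximal_map (towX P ozero) (tow\<theta>t0 P) \<and>
     factor_map (towY P ozero) Y (tow\<theta>0 P) \<and> proximal_map (towY P ozero) (tow\<theta>0 P) \<and>
     (\<forall>x\<in>pts (towX P ozero). \<pi> (tow\<theta>t0 P x) = tow\<theta>0 P (tow\<pi> P ozero x)) \<and>
     (\<forall>\<nu><\<eta>. let \<nu>' = osucc \<nu> in
        minimal_tds (towZ P \<nu>') \<and>
        factor_map (towX P \<nu>) (towZ P \<nu>') (tow\<sigma> P \<nu>') \<and>
        fibre_rel (towX P \<nu>) (tow\<sigma> P \<nu>') = Q_rel (towX P \<nu>) (tow\<pi> P \<nu>) \<and>
        factor_map (towZ P \<nu>') (towY P \<nu>) (tow\<rho> P \<nu>') \<and>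
        factor_map (towY P \<nu>') (towZ P \<nu>') (tow\<theta> P \<nu>') \<and>
        proximal_map (towY P \<nu>') (tow\<theta> P \<nu>') \<and>
        factor_map (towX P \<nu>') (towX P \<nu>) (tow\<theta>t P \<nu>') \<and>
        proximal_map (towX P \<nu>') (tow\<theta>t P \<nu>') \<and>
        (\<forall>x\<in>pts (towX P \<nu>). tow\<rho> P \<nu>' (tow\<sigma> P \<nu>' x) = tow\<pi> P \<nu> x) \<and>
        (\<forall>x\<in>pts (towX P \<nu>'). tow\<sigma> P \<nu>' (tow\<theta>t P \<nu>' x) = tow\<theta> P \<nu>' (tow\<pi> P \<nu>' x)) \<and>
        (\<forall>x\<in>pts (towX P \<nu>'). conX P \<nu>' \<nu> x = tow\<theta>t P \<nu>' x) \<and>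
        (\<forall>y\<in>pts (towY P \<nu>'). conY P \<nu>' \<nu> y = tow\<rho> P \<nu>' (tow\<theta> P \<nu>' y))) \<and>
     inverse_system \<eta> (towX P) (conX P) \<and>
     inverse_system \<eta> (towY P) (conY P) \<and>
     (\<forall>\<nu>\<le>\<eta>. \<forall>\<mu>\<le>\<nu>. \<forall>x\<in>pts (towX P \<nu>). tow\<pi> P \<mu> (conX P \<nu> \<mu> x) = conY P \<nu> \<mu> (tow\<pi> P \<nu> x)) \<and>
     (\<forall>\<nu>\<le>\<eta>. olimit \<nu> \<longrightarrow>
        is_inverse_limit \<nu> (towX P) (conX P) \<and> is_inverse_limit \<nu> (towY P) (conY P)) \<and>
     weakly_mixing_map (towX P \<eta>) (tow\<pi> P \<eta>)"

text \<open>Restricting a map only changes its domain, hence the maps of the tower are kept.\<close>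

definition restrict_tower ::
  "nat \<Rightarrow> ('i \<Rightarrow> 'x set) \<Rightarrow> ('i \<Rightarrow> 'y set) \<Rightarrow> ('i \<Rightarrow> 'z set) \<Rightarrow>
   ('i, 'a, 'b, 'x, 'y, 'z) tower \<Rightarrow> ('i, 'a, 'b, 'x, 'y, 'z) tower" where
  "restrict_tower m A B C P = P\<lparr>
     towX := (\<lambda>\<nu>. power_subsystem (towX P \<nu>) (A \<nu>) m),
     towY := (\<lambda>\<nu>. power_subsystem (towY P \<nu>) (B \<nu>) m),
     towZ := (\<lambda>\<nu>. power_subsystem (towZ P \<nu>) (C \<nu>) m)\<rparr>"

end

theory Submission
  imports Defs
begin

text \<open>The pieces of \<open>X\<^sub>\<nu>\<close> are the preimages of those of \<open>X\<close>, and the pieces of \<open>Y\<^sub>\<nu>\<close> and \<open>Z\<^sub>\<nu>\<close> their images.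
  Proximal extensions and inverse limits create no new \<open>T\<^sup>m\<close>-minimal pieces, because over a
  \<open>T\<^sup>m\<close>-minimal piece any two closed \<open>T\<^sup>m\<close>-invariant sets meet. The images stay disjoint because the
  pieces are clopen and permuted by \<open>T\<close>, so that points related by \<open>Q\<close> are in the same piece; this separates
  the pieces of \<open>Z\<^sub>1\<close>, hence those of all \<open>Y\<^sub>\<nu>\<close> with \<open>\<nu> \<ge> 1\<close>, but not those of \<open>Y\<^sub>0\<close>.

  The clauses of a PI tower pass from \<open>T\<close> to \<open>T\<^sup>m\<close> on a piece since an integer is a multiple of \<open>m\<close> up
  to a bounded error. For RIC, an idempotent ultrafilter contains the multiples of \<open>m\<close>, so the
  minimal left ideal can be pulled back along \<open>n \<mapsto> m n\<close>. Weak mixing need not pass to powers in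
  general; here it does because an RIC map is weakly mixing as soon as the pairs that some iterate
  brings within \<open>\<epsilon>\<close> of each other are dense in the fibre relation, for each \<open>\<epsilon> > 0\<close>. That condition does
  pass to powers.\<close>

section \<open>Metric spaces and ultrafilters\<close>

text \<open>The pieces of \<open>Y\<^sub>0\<close> can overlap: over a one-point \<open>Y\<close>,
  all pieces of \<open>X\<^sub>0\<close> map to the same point. A partition into \<open>l\<close>
  clopen pieces permuted by T is a finite, hence equicontinuous, factor, and the quotient by Q is
  the first system of the lower row in which it must be visible. Hence disjointness on the
  \<open>Y\<close> side is always tested at the first successor level. The criterion for weak mixing
  is the statement that Q is the whole fibre relation, unwound: by compactness, Q consists of the
  pairs that for every epsilon are limits of pairs in the fibre relation with an epsilon-close
  iterate. RIC enters the proof of the criterion twice, through openness of the map and through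
  density of minimal pairs. Both are drawn from a single minimal left ideal, idempotent and base
  point, as in the definition of RIC, so that for a piece only the base point has to be moved, by an
  iterate, into the image of the piece.\<close>

lemma openin_mtopology_of:
  "openin (mtopology_of d) U \<longleftrightarrow>
     U \<subseteq> mspace d \<and> (\<forall>x\<in>U. \<exists>e>0. \<forall>y\<in>mspace d. mdist d x y < e \<longrightarrow> y \<in> U)"
proof -
  interpret Metric_space "mspace d" "mdist d" by (rule Metric_space_mspace_mdist)
  show ?thesis
    unfolding mtopology_of_def openin_mtopology subset_iff in_mball by blast
qed

lemma limitin_mtopology_of:
  "limitin (mtopology_of d) f l F \<longleftrightarrow>
     l \<in> mspace d \<and> (\<forall>e>0. \<forall>\<^sub>F x in F. f x \<in> mspace d \<and> mdist d (f x) l < e)"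
proof -
  interpret Metric_space "mspace d" "mdist d" by (rule Metric_space_mspace_mdist)
  show ?thesis
    unfolding mtopology_of_def limitin_metric by blast
qed

lemma limitin_mdist:
  assumes "limitin (mtopology_of d) f l F" "e > 0"
  shows "\<forall>\<^sub>F x in F. mdist d (f x) l < e"
proof -
  have "\<forall>\<^sub>F x in F. f x \<in> mspace d \<and> mdist d (f x) l < e"
    using assms unfolding limitin_mtopology_of by blast
  then show ?thesis by (rule eventually_mono) blast
qed

lemma Hausdorff_mtopology_of: "Hausdorff_space (mtopology_of d)"
proof -
  interpret Metric_space "mspace d" "mdist d" by (rule Metric_space_mspace_mdist)
  show ?thesis
    unfolding mtopology_of_def by (rule Hausdorff_space_mtopology)
qed

lemma mdist_triangle:
  "\<lbrakk>x \<in> mspace d; y \<in> mspace d; z \<in> mspace d\<rbrakk> \<Longrightarrow> mdist d x z \<le> mdist d x y + mdist d y z"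
proof -
  interpret Metric_space "mspace d" "mdist d" by (rule Metric_space_mspace_mdist)
  show "\<lbrakk>x \<in> mspace d; y \<in> mspace d; z \<in> mspace d\<rbrakk> \<Longrightarrow> ?thesis"
    by (rule triangle)
qed

lemma mdist_commute: "mdist d x y = mdist d y x"
proof -
  interpret Metric_space "mspace d" "mdist d" by (rule Metric_space_mspace_mdist)
  show ?thesis by (rule commute)
qed

lemma mdist_nonneg: "0 \<le> mdist d x y"
proof -
  interpret Metric_space "mspace d" "mdist d" by (rule Metric_space_mspace_mdist)
  show ?thesis by simp
qed

lemma mdist_refl: "x \<in> mspace d \<Longrightarrow> mdist d x x = 0"
proof -
  interpret Metric_space "mspace d" "mdist d" by (rule Metric_space_mspace_mdist)
  show "x \<in> mspace d \<Longrightarrow> ?thesis" by simp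
qed

lemma mdist_zero_iff: "\<lbrakk>x \<in> mspace d; y \<in> mspace d\<rbrakk> \<Longrightarrow> mdist d x y = 0 \<longleftrightarrow> x = y"
proof -
  interpret Metric_space "mspace d" "mdist d" by (rule Metric_space_mspace_mdist)
  show "\<lbrakk>x \<in> mspace d; y \<in> mspace d\<rbrakk> \<Longrightarrow> ?thesis" by simp
qed

lemma openin_ball_of:
  assumes "x \<in> mspace d"
  shows "openin (mtopology_of d) {y \<in> mspace d. mdist d x y < e}"
proof -
  interpret Metric_space "mspace d" "mdist d" by (rule Metric_space_mspace_mdist)
  have "{y \<in> mspace d. mdist d x y < e} = mball x e"
    using assms by auto
  then show ?thesis
    unfolding mtopology_of_def by simp
qed

lemma in_closure_of_mtopology_of:
  "x \<in> mtopology_of d closure_of S \<longleftrightarrow>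
     x \<in> mspace d \<and> (\<forall>e>0. \<exists>y\<in>S. y \<in> mspace d \<and> mdist d x y < e)"
proof -
  interpret Metric_space "mspace d" "mdist d" by (rule Metric_space_mspace_mdist)
  show ?thesis
    unfolding mtopology_of_def metric_closure_of by auto
qed

lemma continuous_map_mdist_bound:
  assumes "continuous_map (mtopology_of d) (mtopology_of d') f" "x \<in> mspace d" "e > 0"
  obtains \<delta> where "\<delta> > 0" "\<And>y. \<lbrakk>y \<in> mspace d; mdist d x y < \<delta>\<rbrakk> \<Longrightarrow> mdist d' (f x) (f y) < e"
proof -
  have fx: "f x \<in> mspace d'"
    using continuous_map_image_subset_topspace[OF assms(1)] assms(2) by auto
  have "openin (mtopology_of d) {y \<in> topspace (mtopology_of d). f y \<in> {z \<in> mspace d'. mdist d' (f x) z < e}}"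
    by (rule openin_continuous_map_preimage[OF assms(1) openin_ball_of[OF fx]])
  moreover have "x \<in> {y \<in> topspace (mtopology_of d). f y \<in> {z \<in> mspace d'. mdist d' (f x) z < e}}"
    using assms fx by (simp add: mdist_refl)
  ultimately obtain \<delta> where "\<delta> > 0"
    "\<forall>y\<in>mspace d. mdist d x y < \<delta> \<longrightarrow> y \<in> {y \<in> topspace (mtopology_of d). f y \<in> {z \<in> mspace d'. mdist d' (f x) z < e}}"
    unfolding openin_mtopology_of by blast
  then show ?thesis
    by (intro that[of \<delta>]) auto
qed

lemma continuous_map_unif_bound:
  assumes "compact_space (mtopology_of d)" "continuous_map (mtopology_of d) (mtopology_of d') f" "e > 0"
  obtains \<delta> where "\<delta> > 0"
    "\<And>x y. \<lbrakk>x \<in> mspace d; y \<in> mspace d; mdist d x y < \<delta>\<rbrakk> \<Longrightarrow> mdist d' (f x) (f y) < e"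
proof -
  have "uniformly_continuous_map d d' f"
    using continuous_imp_uniformly_continuous_map assms by blast
  then obtain \<delta> where "\<delta> > 0"
    "\<forall>x\<in>mspace d. \<forall>y\<in>mspace d. mdist d y x < \<delta> \<longrightarrow> mdist d' (f y) (f x) < e"
    using assms(3) unfolding uniformly_continuous_map_def by blast
  then show ?thesis
    using that by blast
qed

section \<open>Ultrafilters and limits along them\<close>

text \<open>The condition of \<open>betaZ\<close> for filters on an arbitrary type: limits are taken
  along ultrafilters on the naturals as well as on the integers.\<close>

definition ultrafilter :: "'a filter \<Rightarrow> bool" where
  "ultrafilter p \<longleftrightarrow> p \<noteq> bot \<and> (\<forall>P. eventually P p \<or> eventually (\<lambda>n. \<not> P n) p)"

lemma betaZ_iff: "p \<in> betaZ \<longleftrightarrow> ultrafilter p"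
  by (simp add: betaZ_def ultrafilter_def)

text \<open>Zorn's lemma for the proper filters below \<open>F\<close>, ordered by refinement. A
  nonempty chain is a base of its infimum, so the infimum is proper because each member is.\<close>

lemma ultrafilter_exists:
  fixes F :: "'a filter"
  assumes "F \<noteq> bot"
  obtains p where "p \<le> F" "ultrafilter p"
proof -
  let ?A = "{U. U \<le> F \<and> U \<noteq> bot}"
  let ?P = "\<lambda>a b :: 'a filter. b \<le> a"
  have "\<exists>m\<in>?A. \<forall>a\<in>?A. ?P m a \<longrightarrow> a = m"
  proof (rule predicate_Zorn)
    show "partial_order_on ?A (relation_of ?P ?A)"
      by (rule partial_order_on_relation_ofI) auto
    fix C assume C: "C \<in> Chains (relation_of ?P ?A)"
    show "\<exists>u\<in>?A. \<forall>a\<in>C. ?P a u"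
    proof (cases "C = {}")
      case True
      then show ?thesis using assms by auto
    next
      case False
      have CA: "C \<subseteq> ?A" and chain: "\<And>a b. \<lbrakk>a \<in> C; b \<in> C\<rbrakk> \<Longrightarrow> a \<le> b \<or> b \<le> a"
        using C unfolding Chains_def relation_of_def by blast+
      have "Inf C \<noteq> bot"
      proof
        assume "Inf C = bot"
        then have "eventually (\<lambda>_. False) (Inf C)" by simp
        then have "\<exists>b\<in>C. eventually (\<lambda>_. False) b"
          by (subst (asm) eventually_Inf_base) (use False chain in \<open>force+\<close>)
        then show False
          using CA by (auto simp: eventually_False)
      qed
      moreover have "Inf C \<le> F"
        proof -
        from False obtain c where "c \<in> C" by blast
        then show ?thesis
          using CA by (intro Inf_lower2[of c]) auto
      qed
      ultimately show ?thesis
        by (intro bexI[of _ "Inf C"]) (auto intro: Inf_lower)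
    qed
  qed
  then obtain p where p: "p \<le> F" "p \<noteq> bot" and max: "\<And>a. \<lbrakk>a \<le> F; a \<noteq> bot; a \<le> p\<rbrakk> \<Longrightarrow> a = p"
    by auto
  have "eventually P p \<or> eventually (\<lambda>n. \<not> P n) p" for P
  proof (rule disjCI)
    assume n: "\<not> eventually (\<lambda>n. \<not> P n) p"
    \<comment> \<open>Since the complement of \<open>P\<close> is not in \<open>p\<close>, adjoining
      \<open>P\<close> gives a proper refinement, which by extremality is \<open>p\<close>
      itself.\<close>
    let ?q = "inf p (principal {x. P x})"
    have "?q \<noteq> bot"
      using n unfolding trivial_limit_def eventually_inf_principal by simp
    then have "?q = p"
      using p by (intro max) (auto intro: le_infI1)
    moreover have "eventually P ?q"
      unfolding eventually_inf_principal by simp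
    ultimately show "eventually P p" by simp
  qed
  with p show ?thesis
    by (intro that) (auto simp: ultrafilter_def)
qed

lemma ultrafilter_not_bot [simp]: "ultrafilter p \<Longrightarrow> p \<noteq> bot"
  by (simp add: ultrafilter_def)

lemma ultrafilter_not_eventually:
  assumes "ultrafilter p"
  shows "eventually (\<lambda>n. \<not> P n) p \<longleftrightarrow> \<not> eventually P p"
proof
  assume not_P: "eventually (\<lambda>n. \<not> P n) p"
  show "\<not> eventually P p"
  proof
    assume "eventually P p"
    with not_P have "eventually (\<lambda>_. False) p"
      by eventually_elim blast
    with assms show False
      by (simp only: ultrafilter_def eventually_False)
  qed
next
  assume "\<not> eventually P p"
  with assms show "eventually (\<lambda>n. \<not> P n) p"
    unfolding ultrafilter_def by blast
qed

lemma ultrafilter_filtermap: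
  assumes "ultrafilter p"
  shows "ultrafilter (filtermap g p)"
  using assms unfolding ultrafilter_def eventually_filtermap filtermap_bot_iff by blast

lemma ultrafilter_finite_union:
  assumes "ultrafilter p" "finite I" "eventually (\<lambda>n. \<exists>i\<in>I. P i n) p"
  shows "\<exists>i\<in>I. eventually (P i) p"
proof (rule ccontr)
  assume "\<not> ?thesis"
  then have "\<forall>i\<in>I. eventually (\<lambda>n. \<not> P i n) p"
    unfolding ultrafilter_not_eventually[OF assms(1)] by blast
  then have "eventually (\<lambda>n. \<forall>i\<in>I. \<not> P i n) p"
    by (rule eventually_ball_finite[OF assms(2)])
  with assms(3) have "eventually (\<lambda>_. False) p"
    by eventually_elim blast
  then show False
    using ultrafilter_not_eventually[OF assms(1), of "\<lambda>_. False"] by simp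
qed

text \<open>If no point were a limit, each point would have a neighbourhood in which the values do
  not eventually lie. Finitely many of these cover the space, and the ultrafilter would have to
  choose one of them.\<close>

lemma compact_ultrafilter_limit:
  assumes "compact_space T" "ultrafilter p" "eventually (\<lambda>n. g n \<in> topspace T) p"
  obtains x where "limitin T g x p"
proof -
  have "\<exists>x. limitin T g x p"
  proof (rule ccontr)
    assume no: "\<nexists>x. limitin T g x p"
    have "\<exists>U. openin T U \<and> x \<in> U \<and> \<not> eventually (\<lambda>n. g n \<in> U) p" if "x \<in> topspace T" for x
      using no that unfolding limitin_def by blast
    then obtain U where U: "\<And>x. x \<in> topspace T \<Longrightarrow> openin T (U x) \<and> x \<in> U x \<and> \<not> eventually (\<lambda>n. g n \<in> U x) p"
      by metis
    have "topspace T \<subseteq> \<Union>(U ` topspace T)"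
      using U by blast
    moreover have "\<forall>V\<in>U ` topspace T. openin T V"
      using U by blast
    ultimately have "\<exists>\<F>. finite \<F> \<and> \<F> \<subseteq> U ` topspace T \<and> topspace T \<subseteq> \<Union>\<F>"
      using assms(1)[unfolded compact_space_alt, rule_format, of "U ` topspace T"] by simp
    then obtain \<F> where F: "finite \<F>" "\<F> \<subseteq> U ` topspace T" "topspace T \<subseteq> \<Union>\<F>"
      by blast
    have "\<exists>V\<in>\<F>. eventually (\<lambda>n. g n \<in> V) p"
      by (rule ultrafilter_finite_union[OF assms(2) F(1)])
        (rule eventually_mono[OF assms(3)], use F(3) in blast)
    then show False using F(2) U by blast
  qed
  then show ?thesis using that by blast
qed

lemma limitin_filtermap: "limitin T f x (filtermap g p) \<longleftrightarrow> limitin T (\<lambda>n. f (g n)) x p"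
  by (simp add: limitin_def eventually_filtermap)

text \<open>The limit of the \<open>F i\<close> along \<open>r\<close> in the space of ultrafilters.
  It expresses that minimal left ideals are closed without introducing a topology on
  \<open>betaZ\<close>.\<close>

definition ultralimit :: "'j filter \<Rightarrow> ('j \<Rightarrow> 'a filter) \<Rightarrow> 'a filter" where
  "ultralimit r F = Abs_filter (\<lambda>P. eventually (\<lambda>i. eventually P (F i)) r)"

lemma eventually_ultralimit:
  "eventually P (ultralimit r F) \<longleftrightarrow> eventually (\<lambda>i. eventually P (F i)) r"
proof -
  have "is_filter (\<lambda>P. eventually (\<lambda>i. eventually P (F i)) r)"
  proof
    fix P Q :: "'a \<Rightarrow> bool"
    assume "\<forall>\<^sub>F i in r. eventually P (F i)" "\<forall>\<^sub>F i in r. eventually Q (F i)"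
    then show "\<forall>\<^sub>F i in r. eventually (\<lambda>x. P x \<and> Q x) (F i)"
      by eventually_elim (rule eventually_conj)
  next
    fix P Q :: "'a \<Rightarrow> bool"
    assume *: "\<forall>x. P x \<longrightarrow> Q x" and "\<forall>\<^sub>F i in r. eventually P (F i)"
    from this(2) show "\<forall>\<^sub>F i in r. eventually Q (F i)"
      by (rule eventually_mono) (use * in \<open>auto elim: eventually_mono\<close>)
  qed simp
  then show ?thesis
    unfolding ultralimit_def by (rule eventually_Abs_filter)
qed

lemma ultrafilter_ultralimit:
  assumes "ultrafilter r" "\<And>i. ultrafilter (F i)"
  shows "ultrafilter (ultralimit r F)"
proof -
  have "ultralimit r F \<noteq> bot"
  proof
    assume "ultralimit r F = bot"
    then have "eventually (\<lambda>_. False) (ultralimit r F)" by simp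
    then have "eventually (\<lambda>_. False) r"
      unfolding eventually_ultralimit using assms(2) by (simp add: trivial_limit_def[symmetric])
    then show False
      using assms(1) by (simp add: eventually_False)
  qed
  moreover have "eventually P (ultralimit r F) \<or> eventually (\<lambda>n. \<not> P n) (ultralimit r F)" for P
    by (simp add: eventually_ultralimit ultrafilter_not_eventually assms)
  ultimately show ?thesis
    by (auto simp: ultrafilter_def)
qed

section \<open>Iterates, minimality and powers\<close>

lemma is_tdsD:
  assumes "is_tds S"
  shows "pts S \<noteq> {}" "compact_space (top_of S)"
    "continuous_map (top_of S) (top_of S) (act S)"
    "inj_on (act S) (pts S)" "act S ` pts S = pts S"
  using assms homeomorphic_imp_continuous_map homeomorphic_imp_injective_map
    homeomorphic_imp_surjective_map unfolding is_tds_def by fastforce+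

text \<open>\<open>iter\<close> uses \<open>inv_into\<close> at negative times; on the phase space
  this agrees with the continuous inverse that the homeomorphism provides.\<close>

lemma is_tds_inverse_continuous:
  assumes "is_tds S"
  shows "continuous_map (top_of S) (top_of S) (inv_into (pts S) (act S))"
proof -
  obtain g where g: "homeomorphic_maps (top_of S) (top_of S) (act S) g"
    using assms unfolding is_tds_def homeomorphic_map_maps by blast
  have "g y = inv_into (pts S) (act S) y" if "y \<in> pts S" for y
  proof -
    have "g y \<in> pts S" "act S (g y) = y"
      using g that unfolding homeomorphic_maps_def continuous_map_def by auto
    then show ?thesis
      using inv_into_f_f[OF is_tdsD(4)[OF assms], of "g y"] by simp
  qed
  with g show ?thesis
    unfolding homeomorphic_maps_def by (auto intro: continuous_map_eq)
qed

lemma continuous_map_funpow: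
  "continuous_map T T f \<Longrightarrow> continuous_map T T (f ^^ k)"
  by (induction k) (auto simp: id_def o_def continuous_map_compose[unfolded o_def])

lemma iter_continuous:
  assumes "is_tds S"
  shows "continuous_map (top_of S) (top_of S) (iter S n)"
  using is_tdsD(3)[OF assms] is_tds_inverse_continuous[OF assms]
  by (simp add: iter_def[abs_def] continuous_map_funpow)

lemma iter_in:
  assumes "is_tds S" "x \<in> pts S"
  shows "iter S n x \<in> pts S"
  using continuous_map_image_subset_topspace[OF iter_continuous[OF assms(1), of n]] assms(2) by auto

lemma iter_0 [simp]: "iter S 0 x = x"
  by (simp add: iter_def)

lemma iter_nat: "iter S (int k) = act S ^^ k"
  by (simp add: iter_def)

lemma iter_step:
  assumes "is_tds S" "x \<in> pts S"
  shows "iter S (n + 1) x = act S (iter S n x)"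
proof (cases "0 \<le> n")
  case True
  then have "nat (n + 1) = Suc (nat n)" by simp
  with True show ?thesis by (simp add: iter_def)
next
  case False
  define k where "k = nat (- n - 1)"
  have n: "n = - int (Suc k)" and n': "n + 1 = - int k"
    using False by (auto simp: k_def)
  have in_k: "iter S (- int k) x \<in> pts S"
    by (rule iter_in[OF assms])
  have "iter S n x = inv_into (pts S) (act S) (iter S (- int k) x)"
  proof -
    have "iter S n x = (inv_into (pts S) (act S) ^^ Suc k) x"
      unfolding n iter_def by (simp only: minus_minus nat_int) simp
    \<comment> \<open>At \<open>k = 0\<close> the definition of \<open>iter\<close> takes the branch
      for nonnegative times.\<close>
    moreover have "iter S (- int k) x = (inv_into (pts S) (act S) ^^ k) x"
      by (cases "k = 0") (auto simp: iter_def)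
    ultimately show ?thesis by simp
  qed
  then show ?thesis
    unfolding n' using in_k is_tdsD(5)[OF assms(1)] by (simp add: f_inv_into_f)
qed

text \<open>Injectivity of the transformation lets the recursion be run backwards, so one-step
  identities suffice to identify orbits at all integer times.\<close>

lemma iter_unique:
  fixes g :: "int \<Rightarrow> 'a"
  assumes "is_tds S" "x \<in> pts S" "g 0 = x" "\<And>n. g n \<in> pts S" "\<And>n. g (n + 1) = act S (g n)"
  shows "iter S n x = g n"
proof (induction n rule: int_induct[where k = 0])
  case base
  then show ?case using assms(3) by simp
next
  case (step1 i)
  then show ?case using assms by (simp add: iter_step)
next
  case (step2 i)
  have "act S (iter S (i - 1) x) = iter S i x"
    using iter_step[OF assms(1,2), of "i - 1"] by simp
  also have "\<dots> = act S (g (i - 1))"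
    using step2.IH assms(5)[of "i - 1"] by simp
  finally show ?case
    using inj_onD[OF is_tdsD(4)[OF assms(1)]] iter_in[OF assms(1,2)] assms(4) by blast
qed

lemma iter_iter:
  assumes "is_tds S" "x \<in> pts S"
  shows "iter S n (iter S k x) = iter S (n + k) x"
proof (rule iter_unique[OF assms(1)])
  show "iter S (n + 1 + k) x = act S (iter S (n + k) x)" for n
    using iter_step[OF assms, of "n + k"] by (simp add: algebra_simps)
qed (auto simp: iter_in assms)

lemma iter_inj:
  assumes "is_tds S" "x \<in> pts S" "y \<in> pts S" "iter S n x = iter S n y"
  shows "x = y"
proof -
  have "x = iter S (- n) (iter S n x)"
    by (simp add: iter_iter[OF assms(1,2)])
  also have "\<dots> = y"
    by (simp add: iter_iter[OF assms(1,3)] assms(4))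
  finally show ?thesis .
qed

lemma factor_mapD:
  assumes "factor_map S S' f"
  shows "continuous_map (top_of S) (top_of S') f" "f ` pts S = pts S'"
    "\<And>x. x \<in> pts S \<Longrightarrow> f (act S x) = act S' (f x)" "\<And>x. x \<in> pts S \<Longrightarrow> f x \<in> pts S'"
  using assms unfolding factor_map_def by auto

lemma factor_map_iter:
  assumes "is_tds S" "is_tds S'" "factor_map S S' f" "x \<in> pts S"
  shows "iter S' n (f x) = f (iter S n x)"
  by (rule iter_unique[OF assms(2)])
    (auto simp: factor_mapD[OF assms(3)] iter_in iter_step assms)

lemma minimal_tdsD: "minimal_tds S \<Longrightarrow> is_tds S"
  by (simp add: minimal_tds_def)

lemma minimal_visit:
  assumes "minimal_tds S" "openin (top_of S) B" "B \<noteq> {}" "x \<in> pts S"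
  obtains n where "iter S n x \<in> B"
proof -
  obtain b where b: "b \<in> B" using assms(3) by blast
  then have "b \<in> top_of S closure_of (range (\<lambda>n. iter S n x))"
    using assms openin_subset unfolding minimal_tds_def by force
  with b assms(2) show ?thesis
    using that unfolding in_closure_of by blast
qed

lemma minimal_closed_invariant:
  assumes "minimal_tds S" "closedin (top_of S) C" "C \<noteq> {}" "\<And>x n. x \<in> C \<Longrightarrow> iter S n x \<in> C"
  shows "C = pts S"
proof -
  obtain x where x: "x \<in> C" using assms(3) by blast
  have sub: "C \<subseteq> pts S" using closedin_subset[OF assms(2)] by simp
  have "range (\<lambda>n. iter S n x) \<subseteq> C" using assms(4) x by blast
  then have "top_of S closure_of (range (\<lambda>n. iter S n x)) \<subseteq> C"
    by (rule closure_of_minimal[OF _ assms(2)])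
  moreover have "top_of S closure_of (range (\<lambda>n. iter S n x)) = pts S"
    using assms(1) sub x unfolding minimal_tds_def by blast
  ultimately show ?thesis using sub by blast
qed

text \<open>The hypothesis is applied to orbit closures, which are invariant because iterates are
  continuous.\<close>

lemma minimal_tdsI:
  assumes "is_tds S"
    "\<And>C. \<lbrakk>closedin (top_of S) C; C \<noteq> {}; \<And>x n. x \<in> C \<Longrightarrow> iter S n x \<in> C\<rbrakk> \<Longrightarrow> C = pts S"
  shows "minimal_tds S"
  unfolding minimal_tds_def
proof (intro conjI ballI assms(1))
  fix x assume x: "x \<in> pts S"
  let ?O = "range (\<lambda>n. iter S n x)"
  have O: "?O \<subseteq> pts S" using iter_in[OF assms(1) x] by blast
  have "iter S n ` ?O \<subseteq> ?O" for n
    using iter_iter[OF assms(1) x] by auto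
  then have "iter S n ` (top_of S closure_of ?O) \<subseteq> top_of S closure_of ?O" for n
    using continuous_map_image_closure_subset[OF iter_continuous[OF assms(1)], of n ?O]
      closure_of_mono[of "iter S n ` ?O" ?O "top_of S"] by blast
  moreover have "top_of S closure_of ?O \<noteq> {}"
    using closure_of_subset[of ?O "top_of S"] O by auto
  ultimately show "top_of S closure_of ?O = pts S"
    by (intro assms(2)) auto
qed

lemma minimal_factor:
  assumes "minimal_tds S" "is_tds S'" "factor_map S S' f"
  shows "minimal_tds S'"
proof (rule minimal_tdsI[OF assms(2)])
  fix C assume C: "closedin (top_of S') C" "C \<noteq> {}" "\<And>x n. x \<in> C \<Longrightarrow> iter S' n x \<in> C"
  note S = minimal_tdsD[OF assms(1)]
  note f = factor_mapD[OF assms(3)]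
  have sub: "C \<subseteq> pts S'" using closedin_subset[OF C(1)] by simp
  let ?D = "{x \<in> topspace (top_of S). f x \<in> C}"
  have "?D = pts S"
  proof (rule minimal_closed_invariant[OF assms(1)])
    show "closedin (top_of S) ?D"
      by (rule closedin_continuous_map_preimage[OF f(1) C(1)])
    obtain c where "c \<in> C" using C(2) by blast
    moreover obtain x where "x \<in> pts S" "c = f x"
      using \<open>c \<in> C\<close> sub f(2) by blast
    ultimately show "?D \<noteq> {}" by auto
    fix x n assume "x \<in> ?D"
    then show "iter S n x \<in> ?D"
      using C(3)[of "f x" n] factor_map_iter[OF S assms(2,3)] iter_in[OF S] by auto
  qed
  then have "f ` pts S \<subseteq> C" by blast
  then show "C = pts S'" using sub f(2) by blast
qed

section \<open>The systems (A, T^m) on closed invariant sets\<close>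

text \<open>For subsets of the phase space this is equivalent to
  \<open>power_subsystem S A m\<close> being a t.d.s., see \<open>is_tds_power_subsystem\<close> and
  \<open>power_invariantI\<close>.\<close>

definition power_invariant :: "'a tds \<Rightarrow> nat \<Rightarrow> 'a set \<Rightarrow> bool" where
  "power_invariant S m A \<longleftrightarrow> closedin (top_of S) A \<and> A \<noteq> {} \<and> (act S ^^ m) ` A = A"

lemma power_invariant_subset: "power_invariant S m A \<Longrightarrow> A \<subseteq> pts S"
  using closedin_subset unfolding power_invariant_def by force

lemma power_subsystem_simps:
  "act (power_subsystem S A m) = act S ^^ m"
  "top_of (power_subsystem S A m) = subtopology (top_of S) A"
  by (simp_all add: power_subsystem_def mtopology_of_submetric)

lemma mdist_power_subsystem [simp]: "mdist (met (power_subsystem S A m)) = mdist (met S)"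
  by (simp add: power_subsystem_def)

lemma power_subsystem_pts: "A \<subseteq> pts S \<Longrightarrow> pts (power_subsystem S A m) = A"
  by (auto simp: power_subsystem_def)

lemma homeomorphic_act_funpow:
  assumes "is_tds S"
  shows "homeomorphic_map (top_of S) (top_of S) (act S ^^ m)"
proof (induction m)
  case (Suc m)
  with assms show ?case
    unfolding is_tds_def funpow.simps by (blast intro: homeomorphic_map_compose)
qed (simp add: homeomorphic_map_id[unfolded id_def])

lemma is_tds_power_subsystem:
  assumes "is_tds S" "power_invariant S m A"
  shows "is_tds (power_subsystem S A m)"
  unfolding is_tds_def
proof (intro conjI)
  have sub: "A \<subseteq> pts S" by (rule power_invariant_subset[OF assms(2)])
  show "pts (power_subsystem S A m) \<noteq> {}"
    using assms(2) by (simp add: power_subsystem_pts[OF sub] power_invariant_def)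
  show "compact_space (top_of (power_subsystem S A m))"
    unfolding power_subsystem_simps using assms is_tdsD(2)
    by (metis power_invariant_def compact_space_subtopology closedin_compact_space)
  have "(act S ^^ m) ` (topspace (top_of S) \<inter> A) = topspace (top_of S) \<inter> A"
    using sub assms(2) by (simp add: Int_absorb1 power_invariant_def)
  then show "homeomorphic_map (top_of (power_subsystem S A m)) (top_of (power_subsystem S A m))
      (act (power_subsystem S A m))"
    unfolding power_subsystem_simps
    by (rule homeomorphic_map_subtopologies[OF homeomorphic_act_funpow[OF assms(1)]])
qed

lemma power_invariantI:
  assumes "is_tds (power_subsystem S A m)" "A \<subseteq> pts S"
  shows "power_invariant S m A"
  unfolding power_invariant_def
proof (intro conjI)
  have "compactin (top_of S) A"
    using is_tdsD(2)[OF assms(1)] assms(2)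
    unfolding power_subsystem_simps compactin_subspace by simp
  then show "closedin (top_of S) A"
    by (rule compactin_imp_closedin[OF Hausdorff_mtopology_of])
  show "A \<noteq> {}" "(act S ^^ m) ` A = A"
    using is_tdsD(1,5)[OF assms(1)]
    unfolding power_subsystem_pts[OF assms(2)] power_subsystem_simps by auto
qed

text \<open>At negative times one side inverts T^m relative to \<open>A\<close> and the other
  inverts T relative to the whole space. The two are therefore compared through their common
  recursion, not by unfolding \<open>iter\<close>.\<close>

lemma iter_power_subsystem:
  assumes "is_tds S" "power_invariant S m A" "x \<in> A"
  shows "iter (power_subsystem S A m) n x = iter S (int m * n) x"
    and "iter S (int m * n) x \<in> A"
proof -
  let ?P = "power_subsystem S A m"
  have sub: "A \<subseteq> pts S" by (rule power_invariant_subset[OF assms(2)])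
  note pts = power_subsystem_pts[OF sub, of m]
  have P: "is_tds ?P" by (rule is_tds_power_subsystem[OF assms(1,2)])
  have xP: "x \<in> pts ?P" and x: "x \<in> pts S" using assms(3) sub pts by auto
  have emb: "iter S (int m * n) x = iter ?P n x" for n
  proof (induction n rule: int_induct[where k = 0])
    case base
    then show ?case by simp
  next
    case (step1 i)
    have "iter S (int m * (i + 1)) x = iter S (int m) (iter S (int m * i) x)"
      by (simp add: iter_iter[OF assms(1) x] algebra_simps)
    also have "\<dots> = iter ?P (i + 1) x"
      by (simp add: iter_nat step1.IH iter_step[OF P xP] power_subsystem_simps)
    finally show ?case .
  next
    case (step2 i)
    have "iter S (int m) (iter S (int m * (i - 1)) x) = iter S (int m * i) x"
      by (simp add: iter_iter[OF assms(1) x] algebra_simps)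
    also have "\<dots> = iter S (int m) (iter ?P (i - 1) x)"
      using iter_step[OF P xP, of "i - 1"] by (simp add: step2.IH iter_nat power_subsystem_simps)
    finally have "iter S (int m) (iter S (int m * (i - 1)) x) = iter S (int m) (iter ?P (i - 1) x)" .
    moreover have "iter ?P (i - 1) x \<in> pts S"
      using iter_in[OF P xP, of "i - 1"] sub unfolding pts by blast
    ultimately show ?case
      by (rule iter_inj[OF assms(1) iter_in[OF assms(1) x], rotated])
  qed
  show "iter ?P n x = iter S (int m * n) x" by (simp add: emb)
  show "iter S (int m * n) x \<in> A"
    using iter_in[OF P xP] by (simp add: emb pts)
qed

lemma power_invariant_image:
  assumes "is_tds S" "is_tds S'" "factor_map S S' f" "power_invariant S m A"
  shows "power_invariant S' m (f ` A)"
  unfolding power_invariant_def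
proof (intro conjI)
  note f = factor_mapD[OF assms(3)]
  have sub: "A \<subseteq> pts S" by (rule power_invariant_subset[OF assms(4)])
  have "compactin (top_of S) A"
    using assms(4) is_tdsD(2)[OF assms(1)] unfolding power_invariant_def
    by (blast intro: closedin_compact_space)
  then have "compactin (top_of S') (f ` A)"
    by (rule image_compactin[OF _ f(1)])
  then show "closedin (top_of S') (f ` A)"
    by (rule compactin_imp_closedin[OF Hausdorff_mtopology_of])
  show "f ` A \<noteq> {}" using assms(4) by (simp add: power_invariant_def)
  have "(act S' ^^ m) (f x) = f ((act S ^^ m) x)" if "x \<in> A" for x
    using factor_map_iter[OF assms(1-3), of x "int m"] that sub by (auto simp: iter_nat)
  then have "(act S' ^^ m) ` f ` A = f ` (act S ^^ m) ` A"
    by (force simp: image_image)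
  then show "(act S' ^^ m) ` f ` A = f ` A"
    using assms(4) by (simp add: power_invariant_def)
qed

lemma factor_map_power_subsystem:
  assumes "is_tds S" "is_tds S'" "factor_map S S' f" "power_invariant S m A" "f ` A = B"
  shows "factor_map (power_subsystem S A m) (power_subsystem S' B m) f"
  unfolding factor_map_def
proof (intro conjI ballI)
  note f = factor_mapD[OF assms(3)]
  have sub: "A \<subseteq> pts S" by (rule power_invariant_subset[OF assms(4)])
  have sub': "B \<subseteq> pts S'" using sub f assms(5) by auto
  show "f ` pts (power_subsystem S A m) = pts (power_subsystem S' B m)"
    by (simp add: power_subsystem_pts sub sub' assms(5))
  show "continuous_map (top_of (power_subsystem S A m)) (top_of (power_subsystem S' B m)) f"
    unfolding power_subsystem_simps using f(1) assms(5)
    by (auto simp: continuous_map_in_subtopology intro: continuous_map_from_subtopology)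
  fix x assume "x \<in> pts (power_subsystem S A m)"
  then show "f (act (power_subsystem S A m) x) = act (power_subsystem S' B m) (f x)"
    using factor_map_iter[OF assms(1-3), of x "int m"] sub
    by (auto simp: power_subsystem_pts power_subsystem_simps iter_nat)
qed

lemma minimal_power_image:
  assumes "is_tds S" "is_tds S'" "factor_map S S' f" "A \<subseteq> pts S"
    "minimal_tds (power_subsystem S A m)"
  shows "minimal_tds (power_subsystem S' (f ` A) m)"
proof -
  have A: "power_invariant S m A"
    by (rule power_invariantI[OF minimal_tdsD[OF assms(5)] assms(4)])
  show ?thesis
    by (rule minimal_factor[OF assms(5) is_tds_power_subsystem[OF assms(2)]
          factor_map_power_subsystem[OF assms(1-3) A refl]])
      (rule power_invariant_image[OF assms(1-3) A])
qed

section \<open>The action of ultrafilters and RIC maps\<close>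

text \<open>\<open>beta_act\<close> as a relation. Along an ultrafilter the limit is unique because
  the space is Hausdorff, and it exists by compactness.\<close>

abbreviation orbit_limit :: "'a tds \<Rightarrow> int filter \<Rightarrow> 'a \<Rightarrow> 'a \<Rightarrow> bool" where
  "orbit_limit S p x y \<equiv> limitin (top_of S) (\<lambda>n. iter S n x) y p"

lemma orbit_limit_unique:
  assumes "orbit_limit S p x y" "orbit_limit S p x z" "ultrafilter p"
  shows "y = z"
  by (rule limitin_Hausdorff_unique[OF assms(1,2) _ Hausdorff_mtopology_of]) (simp add: assms(3))

lemma beta_act_eq:
  assumes "orbit_limit S p x y" "ultrafilter p"
  shows "beta_act S p x = y"
  unfolding beta_act_def
  by (rule the_equality) (rule assms(1), rule orbit_limit_unique[OF _ assms])

lemma orbit_limit_exists: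
  assumes "is_tds S" "ultrafilter p" "x \<in> pts S"
  obtains y where "orbit_limit S p x y"
proof (rule compact_ultrafilter_limit[OF is_tdsD(2)[OF assms(1)] assms(2)])
  show "\<forall>\<^sub>F n in p. iter S n x \<in> topspace (top_of S)"
    using iter_in[OF assms(1,3)] by simp
qed (rule that)

text \<open>For each fixed \<open>n\<close>, continuity of the \<open>n\<close>-th iterate carries
  the limit along \<open>q\<close> through it; the order of the summands in \<open>beta_plus\<close>
  matches this.\<close>

lemma orbit_limit_beta_plus:
  assumes "is_tds S" "x \<in> pts S" "orbit_limit S q x y" "orbit_limit S p y z"
  shows "orbit_limit S (beta_plus p q) x z"
  unfolding limitin_def eventually_beta_plus
proof (intro conjI allI impI)
  show "z \<in> topspace (top_of S)" by (rule limitin_topspace[OF assms(4)])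
  fix U assume U: "openin (top_of S) U \<and> z \<in> U"
  then have "\<forall>\<^sub>F n in p. iter S n y \<in> U"
    using limitinD[OF assms(4)] by blast
  then show "\<forall>\<^sub>F n in p. \<forall>\<^sub>F k in q. iter S (n + k) x \<in> U"
  proof (rule eventually_mono)
    fix n assume n: "iter S n y \<in> U"
    have "limitin (top_of S) (iter S n \<circ> (\<lambda>k. iter S k x)) (iter S n y) q"
      by (rule continuous_map_limit[OF iter_continuous[OF assms(1)] assms(3)])
    then have "\<forall>\<^sub>F k in q. (iter S n \<circ> (\<lambda>k. iter S k x)) k \<in> U"
      by (rule limitinD) (use U n in auto)
    then show "\<forall>\<^sub>F k in q. iter S (n + k) x \<in> U"
      by (simp add: iter_iter[OF assms(1,2)])
  qed
qed

text \<open>Integer times commute with each other. This is what later allows base points to be moved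
  along their orbits.\<close>

lemma orbit_limit_iter:
  assumes "is_tds S" "x \<in> pts S" "orbit_limit S p x y"
  shows "orbit_limit S p (iter S i x) (iter S i y)"
proof -
  have "limitin (top_of S) (iter S i \<circ> (\<lambda>k. iter S k x)) (iter S i y) p"
    by (rule continuous_map_limit[OF iter_continuous[OF assms(1)] assms(3)])
  moreover have "(iter S i \<circ> (\<lambda>k. iter S k x)) = (\<lambda>k. iter S k (iter S i x))"
    by (simp add: fun_eq_iff iter_iter[OF assms(1,2)] add.commute)
  ultimately show ?thesis by simp
qed

lemma orbit_limit_factor:
  assumes "is_tds S" "is_tds S'" "factor_map S S' f" "x \<in> pts S" "orbit_limit S p x y"
  shows "orbit_limit S' p (f x) (f y)"
proof -
  have "limitin (top_of S') (f \<circ> (\<lambda>k. iter S k x)) (f y) p"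
    by (rule continuous_map_limit[OF factor_mapD(1)[OF assms(3)] assms(5)])
  then show ?thesis
    by (simp add: o_def factor_map_iter[OF assms(1-4)])
qed

lemma beta_plus_assoc: "beta_plus (beta_plus p q) r = beta_plus p (beta_plus q r)"
  by (simp add: filter_eq_iff eventually_beta_plus add.assoc)

text \<open>Reduces the ultrafilter property of sums to that of limits of ultrafilters.\<close>

lemma beta_plus_eq_ultralimit: "beta_plus p q = ultralimit p (\<lambda>n. filtermap ((+) n) q)"
  by (simp add: filter_eq_iff eventually_beta_plus eventually_ultralimit eventually_filtermap)

lemma beta_plus_betaZ: "\<lbrakk>p \<in> betaZ; q \<in> betaZ\<rbrakk> \<Longrightarrow> beta_plus p q \<in> betaZ"
  unfolding betaZ_iff beta_plus_eq_ultralimit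
  by (intro ultrafilter_ultralimit ultrafilter_filtermap)

lemma minimal_left_idealD:
  assumes "minimal_left_ideal M" "q \<in> M"
  shows "q \<in> betaZ" "p \<in> betaZ \<Longrightarrow> beta_plus p q \<in> M" "ultrafilter q"
proof -
  show q: "q \<in> betaZ" and "p \<in> betaZ \<Longrightarrow> beta_plus p q \<in> M"
    using assms unfolding minimal_left_ideal_def left_ideal_def by blast+
  show "ultrafilter q" using q by (simp only: betaZ_iff)
qed

text \<open>The right-hand side is itself a left ideal contained in \<open>M\<close>.\<close>

lemma minimal_left_ideal_generated:
  assumes "minimal_left_ideal M" "q \<in> M"
  shows "M = (\<lambda>s. beta_plus s q) ` betaZ"
proof -
  let ?N = "(\<lambda>s. beta_plus s q) ` betaZ"
  have q: "q \<in> betaZ" using minimal_left_idealD[OF assms] by blast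
  have "left_ideal ?N"
    unfolding left_ideal_def
  proof (intro conjI ballI)
    show "?N \<noteq> {}" using q by blast
    show "?N \<subseteq> betaZ" using q by (blast intro: beta_plus_betaZ)
    fix p r assume "p \<in> betaZ" "r \<in> ?N"
    then show "beta_plus p r \<in> ?N"
      by (auto simp: beta_plus_assoc[symmetric] intro: beta_plus_betaZ)
  qed
  moreover have "?N \<subseteq> M"
    using minimal_left_idealD[OF assms] by blast
  ultimately show ?thesis
    using assms(1) unfolding minimal_left_ideal_def by blast
qed

text \<open>\<open>M\<close> is closed: its elements have the form \<open>s + q\<close> for one
  fixed \<open>q\<close>, and addition of \<open>q\<close> on the right is continuous in
  \<open>s\<close>.\<close>

lemma minimal_left_ideal_ultralimit:
  assumes "minimal_left_ideal M" "ultrafilter r" "\<And>i. F i \<in> M"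
  shows "ultralimit r F \<in> M"
proof -
  obtain q where q: "q \<in> M"
    using assms(3) by blast
  have "\<exists>s\<in>betaZ. F i = beta_plus s q" for i
    using assms(3) minimal_left_ideal_generated[OF assms(1) q] by blast
  then obtain s where s: "\<And>i. s i \<in> betaZ" "\<And>i. F i = beta_plus (s i) q"
    by metis
  have "ultralimit r F = beta_plus (ultralimit r s) q"
    by (simp add: filter_eq_iff eventually_beta_plus eventually_ultralimit s(2))
  moreover have "ultralimit r s \<in> betaZ"
    using s(1) assms(2) unfolding betaZ_iff by (blast intro: ultrafilter_ultralimit)
  ultimately show ?thesis
    using minimal_left_idealD(2)[OF assms(1) q] by simp
qed

text \<open>An ultrafilter that sends \<open>x\<close> to \<open>y\<close> need not lie in
  \<open>M\<close>. So \<open>x\<close> is first moved by some \<open>q\<close> in \<open>M\<close>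
  to a point \<open>z\<close>; any ultrafilter \<open>r\<close> that sends \<open>z\<close> to
  \<open>y\<close> then gives \<open>r + q\<close>, which is in the left ideal.\<close>

lemma minimal_orbit_limit:
  assumes "minimal_tds S" "minimal_left_ideal M" "x \<in> pts S" "y \<in> pts S"
  obtains p where "p \<in> M" "orbit_limit S p x y"
proof -
  note S = minimal_tdsD[OF assms(1)]
  obtain q where q: "q \<in> M"
    using assms(2) unfolding minimal_left_ideal_def left_ideal_def by blast
  obtain z where z: "orbit_limit S q x z"
    using orbit_limit_exists[OF S minimal_left_idealD(3)[OF assms(2) q] assms(3)] .
  have zS: "z \<in> pts S" using limitin_topspace[OF z] by simp
  \<comment> \<open>The times at which the orbit of \<open>z\<close> is close to \<open>y\<close>;
    minimality makes this filter proper.\<close>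
  let ?F = "filtercomap (\<lambda>n. iter S n z) (nhdsin (top_of S) y)"
  have y: "y \<in> topspace (top_of S)" using assms(4) by simp
  have "?F \<noteq> bot"
    unfolding trivial_limit_def eventually_filtercomap
  proof
    assume "\<exists>Q. eventually Q (nhdsin (top_of S) y) \<and> (\<forall>x. Q (iter S x z) \<longrightarrow> False)"
    then obtain Q U where U: "openin (top_of S) U" "y \<in> U" "\<forall>w\<in>U. Q w" "\<forall>n. \<not> Q (iter S n z)"
      unfolding eventually_nhdsin using y by blast
    then show False
      using minimal_visit[OF assms(1) U(1) _ zS] by blast
  qed
  then obtain r where r: "r \<le> ?F" "ultrafilter r"
    by (rule ultrafilter_exists)
  have "orbit_limit S r z y"
    unfolding limitin_def
  proof (intro conjI allI impI y)
    fix U assume "openin (top_of S) U \<and> y \<in> U"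
    then have "eventually (\<lambda>w. w \<in> U) (nhdsin (top_of S) y)"
      unfolding eventually_nhdsin by blast
    then have "eventually (\<lambda>n. iter S n z \<in> U) ?F"
      by (rule eventually_filtercomapI)
    then show "eventually (\<lambda>n. iter S n z \<in> U) r"
      by (rule filter_leD[OF r(1)])
  qed
  then have "orbit_limit S (beta_plus r q) x y"
    by (rule orbit_limit_beta_plus[OF S assms(3) z])
  moreover have "beta_plus r q \<in> M"
    using minimal_left_idealD(2)[OF assms(2) q] r(2) betaZ_iff by blast
  ultimately show ?thesis using that by blast
qed

section \<open>Hausdorff limits along ultrafilters and the circle operation\<close>

text \<open>If either half of the approximation failed, a selection of bad points would converge
  along \<open>p\<close> by compactness; its limit lies in \<open>B\<close> and contradicts the
  choice of the selection.\<close>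

lemma hausdorff_limit_exists:
  fixes F :: "'i \<Rightarrow> 'a set"
  assumes "compact_space (mtopology_of d)" "ultrafilter p" "\<And>n. F n \<subseteq> mspace d"
  defines "B \<equiv> {x \<in> mspace d. \<forall>e>0. \<forall>\<^sub>F n in p. \<exists>a\<in>F n. mdist d a x < e}"
  shows "hausdorff_limit d F B p"
  unfolding hausdorff_limit_def
proof (intro conjI allI impI)
  have "mtopology_of d closure_of B \<subseteq> B"
  proof
    fix x assume "x \<in> mtopology_of d closure_of B"
    then have x: "x \<in> mspace d" and cl: "\<And>e. e > 0 \<Longrightarrow> \<exists>y\<in>B. mdist d x y < e"
      unfolding in_closure_of_mtopology_of by blast+
    have "\<forall>\<^sub>F n in p. \<exists>a\<in>F n. mdist d a x < e" if "e > 0" for e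
    proof -
      obtain y where y: "y \<in> B" "mdist d x y < e / 2"
        using cl[of "e / 2"] \<open>e > 0\<close> by auto
      then have "\<forall>\<^sub>F n in p. \<exists>a\<in>F n. mdist d a y < e / 2"
        using half_gt_zero[OF \<open>e > 0\<close>] unfolding B_def by blast
      then show ?thesis
      proof (rule eventually_mono)
        fix n assume "\<exists>a\<in>F n. mdist d a y < e / 2"
        then obtain a where a: "a \<in> F n" "mdist d a y < e / 2" by blast
        have "mdist d a x \<le> mdist d a y + mdist d y x"
          using a assms(3) y x unfolding B_def by (intro mdist_triangle) auto
        with a y show "\<exists>a\<in>F n. mdist d a x < e"
          by (intro bexI[of _ a]) (auto simp: mdist_commute[of d y x])
      qed
    qed
    with x show "x \<in> B" unfolding B_def by blast
  qed
  then show closed: "closedin (mtopology_of d) B"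
    by (subst closure_of_subset_eq[symmetric]) (auto simp: B_def)
  fix e :: real assume e: "e > 0"
  have 1: "\<forall>\<^sub>F n in p. \<forall>a\<in>F n. \<exists>b\<in>B. mdist d a b < e"
  proof (rule ccontr)
    assume "\<not> ?thesis"
    then have "\<forall>\<^sub>F n in p. \<exists>a. a \<in> F n \<and> (\<forall>b\<in>B. \<not> mdist d a b < e)"
      using ultrafilter_not_eventually[OF assms(2), of "\<lambda>n. \<forall>a\<in>F n. \<exists>b\<in>B. mdist d a b < e"]
      by (simp add: Bex_def Ball_def)
    then obtain g where g: "\<forall>\<^sub>F n in p. g n \<in> F n \<and> (\<forall>b\<in>B. \<not> mdist d (g n) b < e)"
      unfolding eventually_ex by blast
    then have "\<forall>\<^sub>F n in p. g n \<in> topspace (mtopology_of d)"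
      by (rule eventually_mono) (use assms(3) in auto)
    then obtain x where x: "limitin (mtopology_of d) g x p"
      by (rule compact_ultrafilter_limit[OF assms(1,2)])
    have "\<forall>\<^sub>F n in p. \<exists>a\<in>F n. mdist d a x < r" if "r > 0" for r
    proof -
      have "\<forall>\<^sub>F n in p. mdist d (g n) x < r"
        by (rule limitin_mdist[OF x \<open>r > 0\<close>])
      with g show ?thesis by eventually_elim blast
    qed
    then have xB: "x \<in> B"
      using x unfolding B_def limitin_mtopology_of by blast
    have "\<forall>\<^sub>F n in p. mdist d (g n) x < e"
      by (rule limitin_mdist[OF x e])
    with g have "\<forall>\<^sub>F n in p. False"
      by eventually_elim (use xB in blast)
    then show False
      using assms(2) by (simp add: trivial_limit_def[symmetric])
  qed
  have 2: "\<forall>\<^sub>F n in p. \<forall>b\<in>B. \<exists>a\<in>F n. mdist d a b < e"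
  proof (rule ccontr)
    assume "\<not> ?thesis"
    then have "\<forall>\<^sub>F n in p. \<exists>b. b \<in> B \<and> (\<forall>a\<in>F n. \<not> mdist d a b < e)"
      using ultrafilter_not_eventually[OF assms(2), of "\<lambda>n. \<forall>b\<in>B. \<exists>a\<in>F n. mdist d a b < e"]
      by (simp add: Bex_def Ball_def)
    then obtain g where g: "\<forall>\<^sub>F n in p. g n \<in> B \<and> (\<forall>a\<in>F n. \<not> mdist d a (g n) < e)"
      unfolding eventually_ex by blast
    then have "\<forall>\<^sub>F n in p. g n \<in> topspace (mtopology_of d)"
      by (rule eventually_mono) (auto simp: B_def)
    then obtain x where x: "limitin (mtopology_of d) g x p"
      by (rule compact_ultrafilter_limit[OF assms(1,2)])
    have gB: "\<forall>\<^sub>F n in p. g n \<in> B" using g by (rule eventually_mono) blast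
    have xB: "x \<in> B"
      by (rule limitin_closedin[OF x closed gB]) (simp add: assms(2))
    have "\<forall>\<^sub>F n in p. mdist d (g n) x < e / 2"
      by (rule limitin_mdist[OF x half_gt_zero[OF e]])
    moreover have "\<forall>\<^sub>F n in p. \<exists>a\<in>F n. mdist d a x < e / 2"
      using xB half_gt_zero[OF e] unfolding B_def by blast
    ultimately have "\<forall>\<^sub>F n in p. False"
      using g
    proof eventually_elim
      case (elim n)
      then obtain a where a: "a \<in> F n" "mdist d a x < e / 2" by blast
      have "mdist d a (g n) \<le> mdist d a x + mdist d x (g n)"
        using a assms(3) elim(3) xB unfolding B_def by (intro mdist_triangle) auto
      then have "mdist d a (g n) < e"
        using a elim(1) by (simp add: mdist_commute[of d x])
      with elim(3) a(1) show False by blast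
    qed
    then show False
      using assms(2) by (simp add: trivial_limit_def[symmetric])
  qed
  show "\<forall>\<^sub>F n in p. (\<forall>a\<in>F n. \<exists>b\<in>B. mdist d a b < e) \<and> (\<forall>b\<in>B. \<exists>a\<in>F n. mdist d a b < e)"
    using 1 2 by (rule eventually_conj)
qed

lemma hausdorff_limitD:
  assumes "hausdorff_limit d F B p"
  shows "closedin (mtopology_of d) B" "B \<subseteq> mspace d"
    "e > 0 \<Longrightarrow> \<forall>\<^sub>F n in p. \<forall>a\<in>F n. \<exists>b\<in>B. mdist d a b < e"
    "e > 0 \<Longrightarrow> \<forall>\<^sub>F n in p. \<forall>b\<in>B. \<exists>a\<in>F n. mdist d a b < e"
proof -
  show cl: "closedin (mtopology_of d) B"
    using assms unfolding hausdorff_limit_def by (rule conjunct1)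
  show "B \<subseteq> mspace d"
    using closedin_subset[OF cl] by simp
  assume "e > 0"
  then have ev: "\<forall>\<^sub>F n in p. (\<forall>a\<in>F n. \<exists>b\<in>B. mdist d a b < e) \<and> (\<forall>b\<in>B. \<exists>a\<in>F n. mdist d a b < e)"
    using assms unfolding hausdorff_limit_def by blast
  show "\<forall>\<^sub>F n in p. \<forall>a\<in>F n. \<exists>b\<in>B. mdist d a b < e"
    by (rule eventually_mono[OF ev]) (rule conjunct1)
  show "\<forall>\<^sub>F n in p. \<forall>b\<in>B. \<exists>a\<in>F n. mdist d a b < e"
    by (rule eventually_mono[OF ev]) (rule conjunct2)
qed

text \<open>Used in both directions, this gives the uniqueness behind the \<open>THE\<close> in
  \<open>beta_circ\<close>.\<close>

lemma hausdorff_limit_subset: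
  assumes "hausdorff_limit d F B p" "hausdorff_limit d F B' p" "ultrafilter p" "\<And>n. F n \<subseteq> mspace d"
  shows "B \<subseteq> B'"
proof
  fix x assume x: "x \<in> B"
  have sub: "B \<subseteq> mspace d" "B' \<subseteq> mspace d"
    using hausdorff_limitD(2) assms(1,2) by metis+
  have "x \<in> mtopology_of d closure_of B'"
    unfolding in_closure_of_mtopology_of
  proof (intro conjI allI impI)
    show "x \<in> mspace d" using x sub by blast
    fix e :: real assume "e > 0"
    then have "e / 2 > 0" by simp
    from hausdorff_limitD(4)[OF assms(1) this] hausdorff_limitD(3)[OF assms(2) this]
    have "\<forall>\<^sub>F n in p. \<exists>a\<in>F n. mdist d a x < e / 2 \<and> (\<exists>b\<in>B'. mdist d a b < e / 2)"
      by eventually_elim (use x in blast)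
    then have "\<exists>n. \<exists>a\<in>F n. mdist d a x < e / 2 \<and> (\<exists>b\<in>B'. mdist d a b < e / 2)"
      by (rule eventually_happens'[OF ultrafilter_not_bot[OF assms(3)]])
    then obtain n a b where ab: "a \<in> F n" "mdist d a x < e / 2" "b \<in> B'" "mdist d a b < e / 2"
      by blast
    have "mdist d x b \<le> mdist d x a + mdist d a b"
      using ab assms(4) x sub by (intro mdist_triangle) auto
    with ab sub show "\<exists>y\<in>B'. y \<in> mspace d \<and> mdist d x y < e"
      by (intro bexI[of _ b]) (auto simp: mdist_commute[of d x a])
  qed
  then show "x \<in> B'"
    using hausdorff_limitD(1)[OF assms(2)] by (simp add: closure_of_closedin)
qed

text \<open>For a fixed time \<open>n\<close>, continuity of the iterate allows a point of the
  closure of \<open>A\<close> to be replaced by a nearby point of \<open>A\<close>, so the closure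
  taken in \<open>beta_circ\<close> disappears.\<close>

lemma beta_circ_eq:
  assumes "is_tds S" "ultrafilter p" "A \<subseteq> pts S"
  shows "beta_circ S p A =
    {x \<in> pts S. \<forall>e>0. \<forall>\<^sub>F n in p. \<exists>a\<in>A. mdist (met S) (iter S n a) x < e}" (is "_ = ?B")
proof -
  let ?F = "\<lambda>n. iter S n ` (top_of S closure_of A)"
  have cl: "top_of S closure_of A \<subseteq> pts S"
    using closure_of_subset_topspace[of "top_of S" A] by simp
  have F: "?F n \<subseteq> pts S" for n
    using cl iter_in[OF assms(1)] by blast
  have approx: "(\<exists>a\<in>?F n. mdist (met S) a x < e) \<longleftrightarrow> (\<exists>a\<in>A. mdist (met S) (iter S n a) x < e)"
    if x: "x \<in> pts S" for x e n
  proof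
    assume "\<exists>a\<in>?F n. mdist (met S) a x < e"
    then obtain a where a: "a \<in> top_of S closure_of A" "mdist (met S) (iter S n a) x < e" by blast
    let ?U = "{y \<in> topspace (top_of S). iter S n y \<in> {z \<in> pts S. mdist (met S) x z < e}}"
    have "openin (top_of S) ?U"
      by (rule openin_continuous_map_preimage[OF iter_continuous[OF assms(1)] openin_ball_of[OF x]])
    moreover have "a \<in> ?U"
      using a cl iter_in[OF assms(1)] by (auto simp: mdist_commute[of _ x])
    ultimately obtain b where "b \<in> A" "b \<in> ?U"
      using a(1)[unfolded in_closure_of, THEN conjunct2, rule_format, of ?U] by fast
    then show "\<exists>a\<in>A. mdist (met S) (iter S n a) x < e"
      by (auto simp: mdist_commute[of _ x])
  next
    have "A \<subseteq> top_of S closure_of A"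
      using assms(3) by (simp add: closure_of_subset)
    then show "\<exists>a\<in>A. mdist (met S) (iter S n a) x < e \<Longrightarrow> \<exists>a\<in>?F n. mdist (met S) a x < e"
      by blast
  qed
  have "?B = {x \<in> pts S. \<forall>e>0. \<forall>\<^sub>F n in p. \<exists>a\<in>?F n. mdist (met S) a x < e}"
    using approx by (auto cong: conj_cong)
  then have lim: "hausdorff_limit (met S) ?F ?B p"
    using hausdorff_limit_exists[OF is_tdsD(2)[OF assms(1)] assms(2) F] by simp
  show ?thesis
    unfolding beta_circ_def
  proof (rule the_equality)
    show "hausdorff_limit (met S) ?F ?B p" by (rule lim)
    fix B assume B: "hausdorff_limit (met S) ?F B p"
    show "B = ?B"
      by (rule equalityI) (rule hausdorff_limit_subset[OF B lim assms(2) F],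
        rule hausdorff_limit_subset[OF lim B assms(2) F])
  qed
qed

text \<open>The inclusion of the circle product in the fibre always holds, so that only the approximation
  of points of the fibre is required.\<close>

definition RIC_at :: "'a tds \<Rightarrow> 'b tds \<Rightarrow> ('a \<Rightarrow> 'b) \<Rightarrow> int filter set \<Rightarrow> int filter \<Rightarrow> 'b \<Rightarrow> bool" where
  "RIC_at S S' f M u y0 \<longleftrightarrow> minimal_left_ideal M \<and> u \<in> M \<and> beta_plus u u = u \<and>
     y0 \<in> pts S' \<and> orbit_limit S' u y0 y0 \<and>
     (\<forall>p\<in>M. \<forall>x\<in>pts S. orbit_limit S' p y0 (f x) \<longrightarrow> (\<forall>e>0. \<forall>\<^sub>F n in p.
        \<exists>a\<in>{a \<in> pts S. f a = y0 \<and> orbit_limit S u a a}. mdist (met S) (iter S n a) x < e))"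

text \<open>An idempotent \<open>u\<close> that fixes \<open>y0\<close> maps the fibre over
  \<open>y0\<close> onto the \<open>u\<close>-fixed points of that fibre, since
  \<open>u (u x) = u x\<close>. This removes \<open>beta_act\<close> from the condition.\<close>

lemma RIC_iff:
  assumes S: "is_tds S" and S': "is_tds S'" and f: "factor_map S S' f"
  shows "RIC S S' f \<longleftrightarrow> (\<exists>M u y0. RIC_at S S' f M u y0)"
proof -
  note ff = factor_mapD[OF f]
  have "(beta_act S' u y0 = y0 \<and> (\<forall>p\<in>M. {x \<in> pts S. f x = beta_act S' p y0} =
              beta_circ S p (beta_act S u ` {x \<in> pts S. f x = y0}))) \<longleftrightarrow>
        (orbit_limit S' u y0 y0 \<and> (\<forall>p\<in>M. \<forall>x\<in>pts S. orbit_limit S' p y0 (f x) \<longrightarrow> (\<forall>e>0. \<forall>\<^sub>F n in p.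
        \<exists>a\<in>{a \<in> pts S. f a = y0 \<and> orbit_limit S u a a}. mdist (met S) (iter S n a) x < e)))"
    (is "?L \<longleftrightarrow> ?R")
    if M: "minimal_left_ideal M" and u: "u \<in> M" "beta_plus u u = u" and y0: "y0 \<in> pts S'" for M u y0
  proof -
    have uu: "ultrafilter u" using minimal_left_idealD(3)[OF M u(1)] .
    have act: "beta_act S' p y0 = y \<longleftrightarrow> orbit_limit S' p y0 y" if "p \<in> M" for p y
      using orbit_limit_exists[OF S' minimal_left_idealD(3)[OF M that] y0]
        beta_act_eq[OF _ minimal_left_idealD(3)[OF M that]] by metis
    define A where "A = {a \<in> pts S. f a = y0 \<and> orbit_limit S u a a}"
    have A_sub: "A \<subseteq> pts S" by (auto simp: A_def)
    have img: "beta_act S u ` {x \<in> pts S. f x = y0} = A" if y0u: "orbit_limit S' u y0 y0"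
    proof
      show "A \<subseteq> beta_act S u ` {x \<in> pts S. f x = y0}"
        using beta_act_eq[OF _ uu] by (force simp: A_def)
      show "beta_act S u ` {x \<in> pts S. f x = y0} \<subseteq> A"
      proof clarify
        fix x assume x: "x \<in> pts S" "y0 = f x"
        obtain a where a: "orbit_limit S u x a"
          using orbit_limit_exists[OF S uu x(1)] .
        obtain b where b: "orbit_limit S u a b"
          using orbit_limit_exists[OF S uu] limitin_topspace[OF a] by auto
        have "orbit_limit S u x b"
          using orbit_limit_beta_plus[OF S x(1) a b] u(2) by simp
        then have "b = a" using orbit_limit_unique[OF _ a uu] by blast
        moreover have "f a = y0"
        proof (rule orbit_limit_unique[OF _ y0u uu])
          show "orbit_limit S' u y0 (f a)"
            using orbit_limit_factor[OF S S' f x(1) a] unfolding x(2) .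
        qed
        ultimately show "beta_act S u x \<in> A"
          using a b limitin_topspace[OF a] beta_act_eq[OF a uu] by (simp add: A_def)
      qed
    qed
    \<comment> \<open>If iterates of points of \<open>A\<close> approach \<open>x\<close> along
      \<open>p\<close>, then by continuity of \<open>f\<close> the iterates of \<open>y0\<close>
      approach \<open>f x\<close>.\<close>
    have circ_sub: "beta_circ S p A \<subseteq> {x \<in> pts S. f x = beta_act S' p y0}" if p: "p \<in> M" for p
    proof
      fix x assume "x \<in> beta_circ S p A"
      then have x: "x \<in> pts S"
        and ap: "\<And>e. e > 0 \<Longrightarrow> \<forall>\<^sub>F n in p. \<exists>a\<in>A. mdist (met S) (iter S n a) x < e"
        unfolding beta_circ_eq[OF S minimal_left_idealD(3)[OF M p] A_sub] by auto
      have "orbit_limit S' p y0 (f x)"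
        unfolding limitin_mtopology_of
      proof (intro conjI allI impI)
        show "f x \<in> pts S'" using ff(4) x .
        fix e :: real assume "e > 0"
        then obtain r where r: "r > 0" "\<And>y. \<lbrakk>y \<in> pts S; mdist (met S) x y < r\<rbrakk> \<Longrightarrow> mdist (met S') (f x) (f y) < e"
          using continuous_map_mdist_bound[OF ff(1) x] by blast
        show "\<forall>\<^sub>F n in p. iter S' n y0 \<in> pts S' \<and> mdist (met S') (iter S' n y0) (f x) < e"
        proof (rule eventually_mono[OF ap[OF r(1)]])
          fix n assume "\<exists>a\<in>A. mdist (met S) (iter S n a) x < r"
          then obtain a where a: "a \<in> A" "mdist (met S) x (iter S n a) < r"
            by (auto simp: mdist_commute[of _ x])
          then have "mdist (met S') (f x) (f (iter S n a)) < e"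
            using r(2) iter_in[OF S] A_sub by blast
          moreover have "f (iter S n a) = iter S' n y0"
            using factor_map_iter[OF S S' f, of a n] a(1) by (simp add: A_def)
          ultimately show "iter S' n y0 \<in> pts S' \<and> mdist (met S') (iter S' n y0) (f x) < e"
            using iter_in[OF S' y0] by (simp add: mdist_commute[of _ _ "f x"])
        qed
      qed
      then show "x \<in> {x \<in> pts S. f x = beta_act S' p y0}"
        using x act[OF p, of "f x"] by simp
    qed
    have "?L \<longleftrightarrow> orbit_limit S' u y0 y0 \<and> (\<forall>p\<in>M. {x \<in> pts S. f x = beta_act S' p y0} = beta_circ S p A)"
      using act[OF u(1), of y0] img by (simp cong: conj_cong)
    also have "\<dots> \<longleftrightarrow> orbit_limit S' u y0 y0 \<and> (\<forall>p\<in>M. {x \<in> pts S. f x = beta_act S' p y0} \<subseteq> beta_circ S p A)"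
      using circ_sub by blast
    also have "\<dots> \<longleftrightarrow> orbit_limit S' u y0 y0 \<and> (\<forall>p\<in>M. \<forall>x\<in>pts S. orbit_limit S' p y0 (f x) \<longrightarrow> x \<in> beta_circ S p A)"
      unfolding act[symmetric] subset_iff mem_Collect_eq by (metis act)
    also have "\<dots> \<longleftrightarrow> ?R"
      unfolding A_def[symmetric]
      using beta_circ_eq[OF S minimal_left_idealD(3)[OF M] A_sub] by simp
    finally show ?thesis .
  qed
  note equiv = this
  show ?thesis
    unfolding RIC_def RIC_at_def
    by (rule ex_cong1, rule ex_cong1, rule ex_cong1, rule conj_cong[OF refl], rule conj_cong[OF refl],
        rule conj_cong[OF refl], rule conj_cong[OF refl], rule equiv)
qed

section \<open>Openness and dense minimal pairs for RIC maps\<close>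

text \<open>Limits along such an \<open>r\<close> replace subsequences: several sequences converge
  along the same \<open>r\<close>, and errors \<open>1 / (k + 1)\<close> become small along
  it.\<close>

lemma free_ultrafilter_nat:
  obtains r :: "nat filter" where "ultrafilter r" "r \<le> sequentially"
  using ultrafilter_exists[of sequentially] by (metis trivial_limit_sequentially)

lemma eventually_inverse_Suc_less:
  assumes "(e::real) > 0"
  shows "\<forall>\<^sub>F k in sequentially. 1 / (real k + 1) < e"
  using order_tendstoD(2)[OF LIMSEQ_inverse_real_of_nat assms]
  by (simp add: inverse_eq_divide add.commute)

lemma ultrafilter_limit_mdist_le:
  assumes "ultrafilter p" "limitin (mtopology_of d) g x p" "\<forall>\<^sub>F k in p. mdist d a (g k) \<le> e" "a \<in> mspace d"
  shows "mdist d a x \<le> e"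
proof (rule field_le_epsilon)
  fix e' :: real assume "e' > 0"
  then have near: "\<forall>\<^sub>F k in p. g k \<in> mspace d \<and> mdist d (g k) x < e'" and "x \<in> mspace d"
    using assms(2) unfolding limitin_mtopology_of by blast+
  from near assms(3) have "\<forall>\<^sub>F k in p. g k \<in> mspace d \<and> mdist d (g k) x < e' \<and> mdist d a (g k) \<le> e"
    by eventually_elim blast
  then obtain k where k: "g k \<in> mspace d" "mdist d (g k) x < e'" "mdist d a (g k) \<le> e"
    using eventually_happens'[OF ultrafilter_not_bot[OF assms(1)]] by blast
  have "mdist d a x \<le> mdist d a (g k) + mdist d (g k) x"
    using k assms(4) \<open>x \<in> mspace d\<close> by (intro mdist_triangle)
  with k show "mdist d a x \<le> e + e'" by simp
qed

lemma limitin_of_mdist: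
  assumes "l \<in> mspace d" "\<And>k. g k \<in> mspace d" "\<And>e. e > 0 \<Longrightarrow> \<forall>\<^sub>F k in p. mdist d (g k) l < e"
  shows "limitin (mtopology_of d) g l p"
  unfolding limitin_mtopology_of using assms by simp

lemma RIC_at_approx:
  assumes "RIC_at S S' f M u y0" "p \<in> M" "x \<in> pts S" "orbit_limit S' p y0 (f x)" "e > 0"
  shows "\<forall>\<^sub>F n in p. \<exists>a\<in>{a \<in> pts S. f a = y0 \<and> orbit_limit S u a a}. mdist (met S) (iter S n a) x < e"
  using assms unfolding RIC_at_def by blast

text \<open>Suppose that points \<open>y k\<close> tend to \<open>f x\<close> but have no preimages
  near \<open>x\<close>. Write \<open>y k\<close> as \<open>p k\<close> applied to \<open>y0\<close>
  with \<open>p k\<close> in \<open>M\<close>. The limit of the \<open>p k\<close> is in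
  \<open>M\<close> and sends \<open>y0\<close> to \<open>f x\<close>, so RIC approximates
  \<open>x\<close> by iterates of the fibre over \<open>y0\<close>. This approximation already holds
  along some \<open>p k\<close>, where a limit of the approximating points is a preimage of
  \<open>y k\<close>.\<close>

lemma RIC_at_imp_open:
  assumes S: "is_tds S" and S': "minimal_tds S'" and f: "factor_map S S' f"
    and RIC: "RIC_at S S' f M u y0" and x: "x \<in> pts S" and e: "e > 0"
  obtains \<delta> where "\<delta> > 0"
    "\<And>y. \<lbrakk>y \<in> pts S'; mdist (met S') (f x) y < \<delta>\<rbrakk> \<Longrightarrow> \<exists>x'\<in>pts S. f x' = y \<and> mdist (met S) x x' < e"
proof (rule ccontr)
  assume no: "\<not> thesis"
  have "\<exists>y\<in>pts S'. mdist (met S') (f x) y < 1 / (real k + 1) \<and>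
      \<not> (\<exists>x'\<in>pts S. f x' = y \<and> mdist (met S) x x' < e)" for k :: nat
  proof (rule ccontr)
    assume "\<not> ?thesis"
    with that[of "1 / (real k + 1)"] no show False by fastforce
  qed
  then obtain y where y: "\<And>k. y k \<in> pts S'" "\<And>k. mdist (met S') (f x) (y k) < 1 / (real k + 1)"
    "\<And>k x'. \<lbrakk>x' \<in> pts S; f x' = y k\<rbrakk> \<Longrightarrow> \<not> mdist (met S) x x' < e"
    by metis
  note tS' = minimal_tdsD[OF S']
  note ff = factor_mapD[OF f]
  have M: "minimal_left_ideal M" and y0: "y0 \<in> pts S'"
    using RIC by (auto simp: RIC_at_def)
  have "\<exists>p\<in>M. orbit_limit S' p y0 (y k)" for k
    using minimal_orbit_limit[OF S' M y0 y(1)] by metis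
  then obtain p where p: "\<And>k. p k \<in> M" "\<And>k. orbit_limit S' (p k) y0 (y k)" by metis
  obtain r :: "nat filter" where r: "ultrafilter r" "r \<le> sequentially"
    by (rule free_ultrafilter_nat)
  have y_lim: "limitin (top_of S') y (f x) r"
  proof (rule limitin_of_mdist)
    fix e :: real assume "e > 0"
    then have "\<forall>\<^sub>F k in r. 1 / (real k + 1) < e"
      using filter_leD[OF r(2) eventually_inverse_Suc_less] by blast
    then show "\<forall>\<^sub>F k in r. mdist (met S') (y k) (f x) < e"
    proof (rule eventually_mono)
      fix k :: nat assume "1 / (real k + 1) < e"
      with y(2)[of k] show "mdist (met S') (y k) (f x) < e"
        by (simp add: mdist_commute[of _ "y k"])
    qed
  qed (use ff(4) x y(1) in auto)
  have pM: "ultralimit r p \<in> M"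
    by (rule minimal_left_ideal_ultralimit[OF M r(1) p(1)])
  have "orbit_limit S' (ultralimit r p) y0 (f x)"
    unfolding limitin_def eventually_ultralimit
  proof (intro conjI allI impI)
    show "f x \<in> topspace (top_of S')" using ff(4) x by simp
    fix U assume U: "openin (top_of S') U \<and> f x \<in> U"
    then have "\<forall>\<^sub>F k in r. y k \<in> U"
      using limitinD[OF y_lim] by blast
    then show "\<forall>\<^sub>F k in r. \<forall>\<^sub>F n in p k. iter S' n y0 \<in> U"
      by (rule eventually_mono) (rule limitinD[OF p(2)], use U in auto)
  qed
  then have "\<forall>\<^sub>F n in ultralimit r p. \<exists>a\<in>{a \<in> pts S. f a = y0 \<and> orbit_limit S u a a}.
      mdist (met S) (iter S n a) x < e / 2"
    by (rule RIC_at_approx[OF RIC pM x _ half_gt_zero[OF e]])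
  then have "\<exists>k. \<forall>\<^sub>F n in p k. \<exists>a\<in>{a \<in> pts S. f a = y0 \<and> orbit_limit S u a a}.
      mdist (met S) (iter S n a) x < e / 2"
    unfolding eventually_ultralimit by (rule eventually_happens'[OF ultrafilter_not_bot[OF r(1)]])
  then obtain k where "\<forall>\<^sub>F n in p k. \<exists>a\<in>{a \<in> pts S. f a = y0 \<and> orbit_limit S u a a}.
      mdist (met S) (iter S n a) x < e / 2"
    by blast
  then have "\<forall>\<^sub>F n in p k. \<exists>a. a \<in> pts S \<and> f a = y0 \<and> mdist (met S) (iter S n a) x < e / 2"
    by (rule eventually_mono) blast
  then obtain a where a: "\<forall>\<^sub>F n in p k. a n \<in> pts S \<and> f (a n) = y0 \<and> mdist (met S) (iter S n (a n)) x < e / 2"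
    unfolding eventually_ex by blast
  have pk: "ultrafilter (p k)" by (rule minimal_left_idealD(3)[OF M p(1)])
  have "\<forall>\<^sub>F n in p k. iter S n (a n) \<in> topspace (top_of S)"
    using a by (rule eventually_mono) (simp add: iter_in[OF S])
  then obtain x' where x': "limitin (top_of S) (\<lambda>n. iter S n (a n)) x' (p k)"
    by (rule compact_ultrafilter_limit[OF is_tdsD(2)[OF S] pk])
  \<comment> \<open>The approximation was taken with \<open>e / 2\<close> because strict
    inequalities become weak in the limit.\<close>
  have "mdist (met S) x x' \<le> e / 2"
  proof (rule ultrafilter_limit_mdist_le[OF pk x' _ x])
    show "\<forall>\<^sub>F n in p k. mdist (met S) x (iter S n (a n)) \<le> e / 2"
      using a by (rule eventually_mono) (simp add: mdist_commute[of _ x])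
  qed
  moreover have "f x' = y k"
  proof (rule limitin_Hausdorff_unique[OF _ p(2)[of k] _ Hausdorff_mtopology_of])
    have "limitin (top_of S') (f \<circ> (\<lambda>n. iter S n (a n))) (f x') (p k)"
      by (rule continuous_map_limit[OF ff(1) x'])
    moreover have "\<forall>\<^sub>F n in p k. (f \<circ> (\<lambda>n. iter S n (a n))) n = iter S' n y0"
      using a by (rule eventually_mono) (auto simp: factor_map_iter[OF S tS' f, symmetric])
    ultimately show "limitin (top_of S') (\<lambda>n. iter S' n y0) (f x') (p k)"
      by (rule limitin_transform_eventually[rotated])
  qed (simp add: pk)
  moreover have "x' \<in> pts S" using limitin_topspace[OF x'] by simp
  ultimately show False using y(3)[of x' k] e by simp
qed

definition pair_orbit_closure :: "'a tds \<Rightarrow> 'a \<Rightarrow> 'a \<Rightarrow> ('a \<times> 'a) set" where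
  "pair_orbit_closure S a b = {(c, d). c \<in> pts S \<and> d \<in> pts S \<and>
     (\<forall>e>0. \<exists>n. mdist (met S) (iter S n a) c < e \<and> mdist (met S) (iter S n b) d < e)}"

text \<open>A pair of \<open>u\<close>-fixed points is a minimal point of the product: a pair in its
  orbit closure is its image under some \<open>q + u\<close> in \<open>M\<close>, and
  \<open>u = s + (q + u)\<close> for some \<open>s\<close>, which therefore leads back. RIC supplies
  such pairs near \<open>(x, x')\<close>, since both coordinates are approximated along the same
  \<open>p\<close>, hence at a common time.\<close>

lemma RIC_at_minimal_pairs_dense:
  assumes S: "is_tds S" and S': "minimal_tds S'" and f: "factor_map S S' f"
    and RIC: "RIC_at S S' f M u y0" and x: "(x, x') \<in> fibre_rel S f" and e: "e > 0"
  obtains a a' where "(a, a') \<in> fibre_rel S f" "mdist (met S) x a < e" "mdist (met S) x' a' < e"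
    "\<And>c c' e. \<lbrakk>(c, c') \<in> pair_orbit_closure S a a'; e > 0\<rbrakk> \<Longrightarrow>
       \<exists>n. mdist (met S) a (iter S n c) < e \<and> mdist (met S) a' (iter S n c') < e"
proof -
  note tS' = minimal_tdsD[OF S']
  note ff = factor_mapD[OF f]
  have M: "minimal_left_ideal M" and y0: "y0 \<in> pts S'" and u: "u \<in> M"
    using RIC by (auto simp: RIC_at_def)
  have uu: "ultrafilter u" by (rule minimal_left_idealD(3)[OF M u])
  have x: "x \<in> pts S" "x' \<in> pts S" "f x = f x'" using x by (auto simp: fibre_rel_def)
  obtain p where p: "p \<in> M" "orbit_limit S' p y0 (f x)"
    using minimal_orbit_limit[OF S' M y0 ff(4)[OF x(1)]] .
  have "\<forall>\<^sub>F n in p. \<exists>a\<in>{a \<in> pts S. f a = y0 \<and> orbit_limit S u a a}. mdist (met S) (iter S n a) x < e"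
    by (rule RIC_at_approx[OF RIC p(1) x(1) p(2) e])
  moreover have "\<forall>\<^sub>F n in p. \<exists>a\<in>{a \<in> pts S. f a = y0 \<and> orbit_limit S u a a}. mdist (met S) (iter S n a) x' < e"
    by (rule RIC_at_approx[OF RIC p(1) x(2) p(2)[unfolded x(3)] e])
  ultimately have "\<forall>\<^sub>F n in p. \<exists>b b'. b \<in> pts S \<and> b' \<in> pts S \<and> f b = f b' \<and> orbit_limit S u b b \<and>
      orbit_limit S u b' b' \<and> mdist (met S) (iter S n b) x < e \<and> mdist (met S) (iter S n b') x' < e"
  proof eventually_elim
    case (elim n)
    from elim(1) obtain b where "b \<in> pts S" "f b = y0" "orbit_limit S u b b" "mdist (met S) (iter S n b) x < e"
      by auto
    moreover from elim(2) obtain b' where "b' \<in> pts S" "f b' = y0" "orbit_limit S u b' b'"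
      "mdist (met S) (iter S n b') x' < e"
      by auto
    ultimately show ?case
      by (intro exI[of _ b] exI[of _ b']) simp
  qed
  then have "\<exists>n b b'. b \<in> pts S \<and> b' \<in> pts S \<and> f b = f b' \<and> orbit_limit S u b b \<and>
      orbit_limit S u b' b' \<and> mdist (met S) (iter S n b) x < e \<and> mdist (met S) (iter S n b') x' < e"
    by (rule eventually_happens'[OF ultrafilter_not_bot[OF minimal_left_idealD(3)[OF M p(1)]]])
  then obtain n b b' where b: "b \<in> pts S" "b' \<in> pts S" "f b = f b'" "orbit_limit S u b b"
      "orbit_limit S u b' b'" "mdist (met S) (iter S n b) x < e" "mdist (met S) (iter S n b') x' < e"
    by blast
  define a a' where "a = iter S n b" and "a' = iter S n b'"
  have a: "a \<in> pts S" "a' \<in> pts S" "orbit_limit S u a a" "orbit_limit S u a' a'"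
    using b by (auto simp: a_def a'_def iter_in[OF S] orbit_limit_iter[OF S])
  show ?thesis
  proof (rule that)
    show "(a, a') \<in> fibre_rel S f"
      using a b factor_map_iter[OF S tS' f, symmetric] by (simp add: fibre_rel_def a_def a'_def)
    show "mdist (met S) x a < e" "mdist (met S) x' a' < e"
      using b by (auto simp: a_def a'_def mdist_commute[of _ x] mdist_commute[of _ x'])
    fix c c' and e :: real assume cc: "(c, c') \<in> pair_orbit_closure S a a'" and e: "e > 0"
    have c: "c \<in> pts S" "c' \<in> pts S" using cc by (auto simp: pair_orbit_closure_def)
    have "\<exists>n. mdist (met S) (iter S n a) c < 1 / (real k + 1) \<and> mdist (met S) (iter S n a') c' < 1 / (real k + 1)"
      for k :: nat
      using cc by (simp add: pair_orbit_closure_def)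
    then obtain n where n: "\<And>k. mdist (met S) (iter S (n k) a) c < 1 / (real k + 1)"
      "\<And>k. mdist (met S) (iter S (n k) a') c' < 1 / (real k + 1)" by metis
    obtain r :: "nat filter" where r: "ultrafilter r" "r \<le> sequentially"
      by (rule free_ultrafilter_nat)
    \<comment> \<open>The limit of the times \<open>n k\<close>; it sends \<open>(a, a')\<close> to
      \<open>(c, c')\<close>.\<close>
    define q where "q = filtermap n r"
    have q: "ultrafilter q" unfolding q_def by (rule ultrafilter_filtermap[OF r(1)])
    have small: "\<forall>\<^sub>F k in r. 1 / (real k + 1) < e" if "e > 0" for e
      using filter_leD[OF r(2) eventually_inverse_Suc_less[OF that]] .
    have "orbit_limit S q a c"
      unfolding q_def limitin_filtermap
    proof (rule limitin_of_mdist)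
      fix e :: real assume "e > 0"
      from small[OF this] show "\<forall>\<^sub>F k in r. mdist (met S) (iter S (n k) a) c < e"
        by (rule eventually_mono) (rule less_trans[OF n(1)])
    qed (use a c iter_in[OF S] in auto)
    moreover have "orbit_limit S q a' c'"
      unfolding q_def limitin_filtermap
    proof (rule limitin_of_mdist)
      fix e :: real assume "e > 0"
      from small[OF this] show "\<forall>\<^sub>F k in r. mdist (met S) (iter S (n k) a') c' < e"
        by (rule eventually_mono) (rule less_trans[OF n(2)])
    qed (use a c iter_in[OF S] in auto)
    ultimately have qu: "orbit_limit S (beta_plus q u) a c" "orbit_limit S (beta_plus q u) a' c'"
      using orbit_limit_beta_plus[OF S] a by blast+
    have "beta_plus q u \<in> M"
      using minimal_left_idealD(2)[OF M u] q betaZ_iff by blast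
    then obtain s where s: "s \<in> betaZ" "u = beta_plus s (beta_plus q u)"
      using minimal_left_ideal_generated[OF M] u by blast
    have su: "ultrafilter s" using s(1) betaZ_iff by blast
    have return: "orbit_limit S s w z" if zw: "z \<in> pts S" "w \<in> pts S" "orbit_limit S u z z"
      "orbit_limit S (beta_plus q u) z w" for z w
    proof -
      obtain v where v: "orbit_limit S s w v"
        using orbit_limit_exists[OF S su zw(2)] .
      then have "orbit_limit S u z v"
        using orbit_limit_beta_plus[OF S zw(1,4) v] s(2) by simp
      then show ?thesis
        using orbit_limit_unique[OF zw(3) _ uu] v by blast
    qed
    from limitin_mdist[OF return[OF a(1) c(1) a(3) qu(1)] e] limitin_mdist[OF return[OF a(2) c(2) a(4) qu(2)] e]
    have "\<forall>\<^sub>F n in s. mdist (met S) a (iter S n c) < e \<and> mdist (met S) a' (iter S n c') < e"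
      by eventually_elim (simp add: mdist_commute[of _ a] mdist_commute[of _ a'])
    then show "\<exists>n. mdist (met S) a (iter S n c) < e \<and> mdist (met S) a' (iter S n c') < e"
      by (rule eventually_happens'[OF ultrafilter_not_bot[OF su]])
  qed
qed

text \<open>Relative openness in \<open>R\<close> for the maximum metric on pairs, see
  \<open>openin_iff_rel_open\<close>. It keeps the product topology out of the estimates.\<close>

definition rel_open :: "'a metric \<Rightarrow> ('a \<times> 'a) set \<Rightarrow> ('a \<times> 'a) set \<Rightarrow> bool" where
  "rel_open d R U \<longleftrightarrow> U \<subseteq> R \<and> (\<forall>x y. (x, y) \<in> U \<longrightarrow>
     (\<exists>e>0. \<forall>x' y'. (x', y') \<in> R \<and> mdist d x x' < e \<and> mdist d y y' < e \<longrightarrow> (x', y') \<in> U))"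

lemma openin_iff_rel_open:
  assumes R: "R \<subseteq> mspace d \<times> mspace d"
  shows "openin (subtopology (prod_topology (mtopology_of d) (mtopology_of d)) R) U \<longleftrightarrow> rel_open d R U"
proof
  assume "openin (subtopology (prod_topology (mtopology_of d) (mtopology_of d)) R) U"
  then obtain V where V: "openin (prod_topology (mtopology_of d) (mtopology_of d)) V" "U = V \<inter> R"
    unfolding openin_subtopology by blast
  have "\<exists>e>0. \<forall>x' y'. (x', y') \<in> R \<and> mdist d x x' < e \<and> mdist d y y' < e \<longrightarrow> (x', y') \<in> U"
    if xy: "(x, y) \<in> U" for x y
  proof -
    obtain A B where AB: "openin (mtopology_of d) A" "openin (mtopology_of d) B" "x \<in> A" "y \<in> B" "A \<times> B \<subseteq> V"
      using V xy unfolding openin_prod_topology_alt by (metis IntD1)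
    obtain e1 where e1: "e1 > 0" "\<And>z. \<lbrakk>z \<in> mspace d; mdist d x z < e1\<rbrakk> \<Longrightarrow> z \<in> A"
      using AB(1,3) unfolding openin_mtopology_of by blast
    obtain e2 where e2: "e2 > 0" "\<And>z. \<lbrakk>z \<in> mspace d; mdist d y z < e2\<rbrakk> \<Longrightarrow> z \<in> B"
      using AB(2,4) unfolding openin_mtopology_of by blast
    show ?thesis
    proof (intro exI[of _ "min e1 e2"] conjI allI impI)
      show "min e1 e2 > 0" using e1(1) e2(1) by simp
      fix x' y' assume h: "(x', y') \<in> R \<and> mdist d x x' < min e1 e2 \<and> mdist d y y' < min e1 e2"
      then have "x' \<in> A" "y' \<in> B"
        using R e1(2) e2(2) by auto
      then show "(x', y') \<in> U" using AB(5) V(2) h by blast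
    qed
  qed
  then show "rel_open d R U" unfolding rel_open_def using V(2) by blast
next
  assume U: "rel_open d R U"
  define near where "near x y e \<longleftrightarrow> (x, y) \<in> U \<and>
    (\<forall>x' y'. (x', y') \<in> R \<and> mdist d x x' < e \<and> mdist d y y' < e \<longrightarrow> (x', y') \<in> U)" for x y e
  \<comment> \<open>The union of the products of balls whose radius is admissible for their centre
    in \<open>U\<close>.\<close>
  define V where "V = {(a, b). a \<in> mspace d \<and> b \<in> mspace d \<and>
    (\<exists>x y e. near x y e \<and> mdist d x a < e \<and> mdist d y b < e)}"
  have UR: "U \<subseteq> R" using U unfolding rel_open_def by blast
  have "openin (prod_topology (mtopology_of d) (mtopology_of d)) V"
    unfolding openin_prod_topology_alt
  proof (intro allI impI)
    fix a b assume "(a, b) \<in> V"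
    then obtain x y e where h: "near x y e" "mdist d x a < e" "mdist d y b < e" "a \<in> mspace d" "b \<in> mspace d"
      unfolding V_def by blast
    have xy: "x \<in> mspace d" "y \<in> mspace d"
      using h(1) UR R unfolding near_def by blast+
    show "\<exists>A B. openin (mtopology_of d) A \<and> openin (mtopology_of d) B \<and> a \<in> A \<and> b \<in> B \<and> A \<times> B \<subseteq> V"
      by (rule exI[of _ "{z \<in> mspace d. mdist d x z < e}"], rule exI[of _ "{z \<in> mspace d. mdist d y z < e}"])
        (use h xy openin_ball_of in \<open>auto simp: V_def\<close>)
  qed
  moreover have "U = V \<inter> R"
  proof
    show "U \<subseteq> V \<inter> R"
    proof clarify
      fix x y assume xy: "(x, y) \<in> U"
      then obtain e where e: "e > 0" "near x y e"
        using U unfolding rel_open_def near_def by blast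
      have in_d: "x \<in> mspace d" "y \<in> mspace d" using xy UR R by blast+
      then have "near x y e \<and> mdist d x x < e \<and> mdist d y y < e"
        using e by (simp add: mdist_refl)
      then show "(x, y) \<in> V \<inter> R"
        using in_d xy UR unfolding V_def by blast
    qed
    show "V \<inter> R \<subseteq> U" unfolding V_def near_def by blast
  qed
  ultimately show "openin (subtopology (prod_topology (mtopology_of d) (mtopology_of d)) R) U"
    unfolding openin_subtopology by blast
qed

lemma fibre_rel_iter:
  assumes "is_tds S" "is_tds S'" "factor_map S S' f" "(x, y) \<in> fibre_rel S f"
  shows "(iter S n x, iter S n y) \<in> fibre_rel S f"
  using assms(4) factor_map_iter[OF assms(1-3), symmetric] iter_in[OF assms(1)]
  by (simp add: fibre_rel_def)

lemma iter_saturation_rel_open: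
  assumes S: "is_tds S" and S': "is_tds S'" and f: "factor_map S S' f"
    and U: "rel_open (met S) (fibre_rel S f) U"
  shows "rel_open (met S) (fibre_rel S f) {(x, y) \<in> fibre_rel S f. \<exists>n. (iter S n x, iter S n y) \<in> U}"
    (is "rel_open _ ?R ?W")
  unfolding rel_open_def
proof (intro conjI allI impI)
  fix x y assume "(x, y) \<in> ?W"
  then obtain n where n: "(iter S n x, iter S n y) \<in> U" and xy: "x \<in> pts S" "y \<in> pts S"
    by (auto simp: fibre_rel_def)
  then obtain e where e: "e > 0" "\<And>x' y'. \<lbrakk>(x', y') \<in> ?R; mdist (met S) (iter S n x) x' < e;
      mdist (met S) (iter S n y) y' < e\<rbrakk> \<Longrightarrow> (x', y') \<in> U"
    using U unfolding rel_open_def by blast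
  obtain d1 where d1: "d1 > 0" "\<And>z. \<lbrakk>z \<in> pts S; mdist (met S) x z < d1\<rbrakk> \<Longrightarrow> mdist (met S) (iter S n x) (iter S n z) < e"
    by (rule continuous_map_mdist_bound[OF iter_continuous[OF S, of n] xy(1) e(1)]) (rule that)
  obtain d2 where d2: "d2 > 0" "\<And>z. \<lbrakk>z \<in> pts S; mdist (met S) y z < d2\<rbrakk> \<Longrightarrow> mdist (met S) (iter S n y) (iter S n z) < e"
    by (rule continuous_map_mdist_bound[OF iter_continuous[OF S, of n] xy(2) e(1)]) (rule that)
  show "\<exists>e>0. \<forall>x' y'. (x', y') \<in> ?R \<and> mdist (met S) x x' < e \<and> mdist (met S) y y' < e \<longrightarrow> (x', y') \<in> ?W"
  proof (intro exI[of _ "min d1 d2"] conjI allI impI)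
    show "min d1 d2 > 0" using d1(1) d2(1) by simp
    fix x' y' assume h: "(x', y') \<in> ?R \<and> mdist (met S) x x' < min d1 d2 \<and> mdist (met S) y y' < min d1 d2"
    then have "x' \<in> pts S" "y' \<in> pts S" by (auto simp: fibre_rel_def)
    then have "(iter S n x', iter S n y') \<in> U"
      using e(2) d1(2) d2(2) h fibre_rel_iter[OF S S' f] by simp
    then show "(x', y') \<in> ?W" using h by blast
  qed
qed blast

section \<open>A criterion for weak mixing\<close>

lemma pair_orbit_closure_iter:
  assumes S: "is_tds S" and ab: "a \<in> pts S" "b \<in> pts S" and c: "(c, d) \<in> pair_orbit_closure S a b"
  shows "(iter S k c, iter S k d) \<in> pair_orbit_closure S a b"
proof -
  have cd: "c \<in> pts S" "d \<in> pts S" using c by (auto simp: pair_orbit_closure_def)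
  have "\<exists>n. mdist (met S) (iter S n a) (iter S k c) < e \<and> mdist (met S) (iter S n b) (iter S k d) < e"
    if e: "e > 0" for e
  proof -
    obtain d1 where d1: "d1 > 0" "\<And>z. \<lbrakk>z \<in> pts S; mdist (met S) c z < d1\<rbrakk> \<Longrightarrow> mdist (met S) (iter S k c) (iter S k z) < e"
      by (rule continuous_map_mdist_bound[OF iter_continuous[OF S, of k] cd(1) e]) blast
    obtain d2 where d2: "d2 > 0" "\<And>z. \<lbrakk>z \<in> pts S; mdist (met S) d z < d2\<rbrakk> \<Longrightarrow> mdist (met S) (iter S k d) (iter S k z) < e"
      by (rule continuous_map_mdist_bound[OF iter_continuous[OF S, of k] cd(2) e]) blast
    obtain n where n: "mdist (met S) (iter S n a) c < min d1 d2" "mdist (met S) (iter S n b) d < min d1 d2"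
      using c d1(1) d2(1) unfolding pair_orbit_closure_def by (auto dest!: spec[of _ "min d1 d2"])
    have "mdist (met S) (iter S (k + n) a) (iter S k c) < e"
      using d1(2)[of "iter S n a"] n(1) iter_in[OF S ab(1)] iter_iter[OF S ab(1)] by (simp add: mdist_commute)
    moreover have "mdist (met S) (iter S (k + n) b) (iter S k d) < e"
      using d2(2)[of "iter S n b"] n(2) iter_in[OF S ab(2)] iter_iter[OF S ab(2)] by (simp add: mdist_commute)
    ultimately show ?thesis by blast
  qed
  then show ?thesis
    using cd iter_in[OF S] unfolding pair_orbit_closure_def by blast
qed

lemma pair_orbit_closure_closed:
  assumes S: "is_tds S" and ab: "a \<in> pts S" "b \<in> pts S" and p: "ultrafilter p"
    and c: "limitin (top_of S) g c p" and d: "limitin (top_of S) h d p"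
    and K: "\<And>k. (g k, h k) \<in> pair_orbit_closure S a b"
  shows "(c, d) \<in> pair_orbit_closure S a b"
proof -
  have cd: "c \<in> pts S" "d \<in> pts S"
    using limitin_topspace[OF c] limitin_topspace[OF d] by auto
  have gh: "g k \<in> pts S" "h k \<in> pts S" for k
    using K[of k] by (auto simp: pair_orbit_closure_def)
  have "\<exists>n. mdist (met S) (iter S n a) c < e \<and> mdist (met S) (iter S n b) d < e" if e: "e > 0" for e
  proof -
    have "\<forall>\<^sub>F k in p. mdist (met S) (g k) c < e / 2 \<and> mdist (met S) (h k) d < e / 2"
      using limitin_mdist[OF c half_gt_zero[OF e]] limitin_mdist[OF d half_gt_zero[OF e]]
      by (rule eventually_conj)
    then obtain k where k: "mdist (met S) (g k) c < e / 2" "mdist (met S) (h k) d < e / 2"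
      using eventually_happens'[OF ultrafilter_not_bot[OF p]] by blast
    obtain n where n: "mdist (met S) (iter S n a) (g k) < e / 2" "mdist (met S) (iter S n b) (h k) < e / 2"
      using K[of k] half_gt_zero[OF e] unfolding pair_orbit_closure_def by blast
    have "mdist (met S) (iter S n a) c \<le> mdist (met S) (iter S n a) (g k) + mdist (met S) (g k) c"
      by (intro mdist_triangle iter_in[OF S] ab gh cd)
    moreover have "mdist (met S) (iter S n b) d \<le> mdist (met S) (iter S n b) (h k) + mdist (met S) (h k) d"
      by (intro mdist_triangle iter_in[OF S] ab gh cd)
    ultimately show ?thesis using k n by (intro exI[of _ n]) simp
  qed
  then show ?thesis using cd by (auto simp: pair_orbit_closure_def)
qed

text \<open>The fibre relation is closed and invariant.\<close>

lemma pair_orbit_closure_fibre: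
  assumes S: "is_tds S" and S': "is_tds S'" and f: "factor_map S S' f"
    and ab: "(a, b) \<in> fibre_rel S f" and c: "(c, d) \<in> pair_orbit_closure S a b"
  shows "(c, d) \<in> fibre_rel S f"
proof -
  note ff = factor_mapD[OF f]
  have cd: "c \<in> pts S" "d \<in> pts S" using c by (auto simp: pair_orbit_closure_def)
  have ab': "a \<in> pts S" "b \<in> pts S" using ab by (auto simp: fibre_rel_def)
  have "mdist (met S') (f c) (f d) \<le> 0"
  proof (rule field_le_epsilon)
    fix e :: real assume "e > 0"
    then have e: "e / 2 > 0" by simp
    obtain d1 where d1: "d1 > 0" "\<And>z. \<lbrakk>z \<in> pts S; mdist (met S) c z < d1\<rbrakk> \<Longrightarrow> mdist (met S') (f c) (f z) < e / 2"
      by (rule continuous_map_mdist_bound[OF ff(1) cd(1) e]) blast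
    obtain d2 where d2: "d2 > 0" "\<And>z. \<lbrakk>z \<in> pts S; mdist (met S) d z < d2\<rbrakk> \<Longrightarrow> mdist (met S') (f d) (f z) < e / 2"
      by (rule continuous_map_mdist_bound[OF ff(1) cd(2) e]) blast
    obtain n where n: "mdist (met S) (iter S n a) c < min d1 d2" "mdist (met S) (iter S n b) d < min d1 d2"
      using c d1(1) d2(1) unfolding pair_orbit_closure_def by (auto dest!: spec[of _ "min d1 d2"])
    have "f (iter S n a) = f (iter S n b)"
      using fibre_rel_iter[OF S S' f ab] by (simp add: fibre_rel_def)
    moreover have "mdist (met S') (f c) (f (iter S n a)) < e / 2"
      using d1(2)[of "iter S n a"] n(1) iter_in[OF S ab'(1)] by (simp add: mdist_commute)
    moreover have "mdist (met S') (f d) (f (iter S n b)) < e / 2"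
      using d2(2)[of "iter S n b"] n(2) iter_in[OF S ab'(2)] by (simp add: mdist_commute)
    moreover have "mdist (met S') (f c) (f d) \<le> mdist (met S') (f c) (f (iter S n a)) + mdist (met S') (f (iter S n a)) (f d)"
      by (intro mdist_triangle ff(4) cd iter_in[OF S] ab')
    ultimately show "mdist (met S') (f c) (f d) \<le> 0 + e"
      by (simp add: mdist_commute[of _ _ "f d"])
  qed
  then have "mdist (met S') (f c) (f d) = 0"
    using mdist_nonneg[of "met S'" "f c" "f d"] by simp
  then show ?thesis
    using cd ff(4) by (simp add: fibre_rel_def mdist_zero_iff)
qed

lemma small_along_free_ultrafilter:
  assumes "r \<le> sequentially" "\<And>k. g k < 1 / (real k + 1)" "e > 0"
  shows "\<forall>\<^sub>F k in r. g k < e"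
  using filter_leD[OF assms(1) eventually_inverse_Suc_less[OF assms(3)]]
  by (rule eventually_mono) (rule less_trans[OF assms(2)])

text \<open>By minimality some iterates of \<open>a\<close> tend to \<open>x\<close>; a limit of the
  iterates of \<open>b\<close> at the same times is the second coordinate.\<close>

lemma pair_orbit_closure_surj:
  assumes S: "minimal_tds S" and ab: "a \<in> pts S" "b \<in> pts S" and x: "x \<in> pts S"
  obtains z where "(x, z) \<in> pair_orbit_closure S a b"
proof -
  note tS = minimal_tdsD[OF S]
  have "\<exists>n. mdist (met S) (iter S n a) x < 1 / (real k + 1)" for k :: nat
  proof -
    have "openin (top_of S) {y \<in> pts S. mdist (met S) x y < 1 / (real k + 1)}"
      by (rule openin_ball_of[OF x])
    moreover have "x \<in> {y \<in> pts S. mdist (met S) x y < 1 / (real k + 1)}"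
      using x by (simp add: mdist_refl)
    ultimately obtain n where "iter S n a \<in> {y \<in> pts S. mdist (met S) x y < 1 / (real k + 1)}"
      using minimal_visit[OF S _ _ ab(1)] by (metis empty_iff)
    then show ?thesis by (auto simp: mdist_commute[of _ x])
  qed
  then obtain n where n: "\<And>k :: nat. mdist (met S) (iter S (n k) a) x < 1 / (real k + 1)" by metis
  obtain r :: "nat filter" where r: "ultrafilter r" "r \<le> sequentially"
    by (rule free_ultrafilter_nat)
  have "\<forall>\<^sub>F k in r. iter S (n k) b \<in> topspace (top_of S)"
    using iter_in[OF tS ab(2)] by simp
  then obtain z where z: "limitin (top_of S) (\<lambda>k. iter S (n k) b) z r"
    by (rule compact_ultrafilter_limit[OF is_tdsD(2)[OF tS] r(1)])
  have "(x, z) \<in> pair_orbit_closure S a b"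
    unfolding pair_orbit_closure_def
  proof (clarify, intro conjI allI impI)
    show "x \<in> pts S" "z \<in> pts S" using x limitin_topspace[OF z] by auto
    fix e :: real assume e: "e > 0"
    have "\<forall>\<^sub>F k in r. mdist (met S) (iter S (n k) a) x < e \<and> mdist (met S) (iter S (n k) b) z < e"
      using small_along_free_ultrafilter[OF r(2) n e] limitin_mdist[OF z e] by (rule eventually_conj)
    then show "\<exists>n. mdist (met S) (iter S n a) x < e \<and> mdist (met S) (iter S n b) z < e"
      using eventually_happens'[OF ultrafilter_not_bot[OF r(1)]] by blast
  qed
  then show ?thesis by (rule that)
qed

text \<open>The projection to \<open>X\<close> of a neighbourhood in a minimal orbit closure has interior, although it
  need not be open; this is the Baire category theorem applied to its translates.\<close>

lemma minimal_pair_projection_interior: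
  assumes S: "minimal_tds S" and ab: "a \<in> pts S" "b \<in> pts S"
    and ap: "\<And>c d e. \<lbrakk>(c, d) \<in> pair_orbit_closure S a b; e > 0\<rbrakk> \<Longrightarrow>
       \<exists>n. mdist (met S) a (iter S n c) < e \<and> mdist (met S) b (iter S n d) < e"
    and \<delta>: "\<delta> > 0"
  obtains G where "openin (top_of S) G" "G \<noteq> {}"
    "\<And>x. x \<in> G \<Longrightarrow> \<exists>z. (x, z) \<in> pair_orbit_closure S a b \<and> mdist (met S) a x < \<delta> \<and> mdist (met S) b z < \<delta>"
proof -
  note tS = minimal_tdsD[OF S]
  \<comment> \<open>Weak inequalities make \<open>E\<close> closed, and half of
    \<open>\<delta>\<close> leaves room for the strict bounds that are required in the end.\<close>
  define E where "E = {x. \<exists>z. (x, z) \<in> pair_orbit_closure S a b \<and>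
    mdist (met S) a x \<le> \<delta> / 2 \<and> mdist (met S) b z \<le> \<delta> / 2}"
  have E_sub: "E \<subseteq> pts S" by (auto simp: E_def pair_orbit_closure_def)
  have "top_of S closure_of E \<subseteq> E"
  proof
    fix x assume "x \<in> top_of S closure_of E"
    then have x: "x \<in> pts S" and cl: "\<And>e. e > 0 \<Longrightarrow> \<exists>y\<in>E. mdist (met S) x y < e"
      unfolding in_closure_of_mtopology_of by blast+
    have "\<exists>y z. mdist (met S) y x < 1 / (real k + 1) \<and> (y, z) \<in> pair_orbit_closure S a b \<and>
      mdist (met S) a y \<le> \<delta> / 2 \<and> mdist (met S) b z \<le> \<delta> / 2" for k :: nat
      using cl[of "1 / (real k + 1)"] by (auto simp: E_def mdist_commute[of _ x])
    then obtain g h where gh: "\<And>k :: nat. mdist (met S) (g k) x < 1 / (real k + 1)"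
      "\<And>k. (g k, h k) \<in> pair_orbit_closure S a b"
      "\<And>k. mdist (met S) a (g k) \<le> \<delta> / 2" "\<And>k. mdist (met S) b (h k) \<le> \<delta> / 2" by metis
    have gh_in: "g k \<in> pts S" "h k \<in> pts S" for k
      using gh(2)[of k] by (auto simp: pair_orbit_closure_def)
    obtain r :: "nat filter" where r: "ultrafilter r" "r \<le> sequentially"
      by (rule free_ultrafilter_nat)
    have g: "limitin (top_of S) g x r"
      using small_along_free_ultrafilter[OF r(2) gh(1)] by (intro limitin_of_mdist x gh_in)
    have "\<forall>\<^sub>F k in r. h k \<in> topspace (top_of S)" using gh_in by simp
    then obtain z where z: "limitin (top_of S) h z r"
      by (rule compact_ultrafilter_limit[OF is_tdsD(2)[OF tS] r(1)])
    have "(x, z) \<in> pair_orbit_closure S a b"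
      by (rule pair_orbit_closure_closed[OF tS ab r(1) g z gh(2)])
    moreover have "mdist (met S) a x \<le> \<delta> / 2"
      by (rule ultrafilter_limit_mdist_le[OF r(1) g _ ab(1)]) (rule always_eventually, rule allI, rule gh(3))
    moreover have "mdist (met S) b z \<le> \<delta> / 2"
      by (rule ultrafilter_limit_mdist_le[OF r(1) z _ ab(2)]) (rule always_eventually, rule allI, rule gh(4))
    ultimately show "x \<in> E" unfolding E_def by blast
  qed
  then have E_closed: "closedin (top_of S) E"
    by (subst closure_of_subset_eq[symmetric]) (simp add: E_sub)
  \<comment> \<open>Countably many closed sets that cover the space, since every pair in the orbit
    closure has an iterate close to \<open>(a, b)\<close>.\<close>
  define F where "F n = {x \<in> topspace (top_of S). iter S n x \<in> E}" for n
  have F_closed: "closedin (top_of S) (F n)" for n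
    unfolding F_def by (rule closedin_continuous_map_preimage[OF iter_continuous[OF tS] E_closed])
  have cover: "\<Union>(range F) = pts S"
  proof
    show "\<Union>(range F) \<subseteq> pts S" by (auto simp: F_def)
    show "pts S \<subseteq> \<Union>(range F)"
    proof
      fix x assume x: "x \<in> pts S"
      obtain z where z: "(x, z) \<in> pair_orbit_closure S a b"
        by (rule pair_orbit_closure_surj[OF S ab x])
      obtain n where n: "mdist (met S) a (iter S n x) < \<delta> / 2" "mdist (met S) b (iter S n z) < \<delta> / 2"
        using ap[OF z half_gt_zero[OF \<delta>]] by blast
      have "iter S n x \<in> E"
        unfolding E_def using pair_orbit_closure_iter[OF tS ab z] n by (auto intro: less_imp_le)
      then show "x \<in> \<Union>(range F)" using x by (auto simp: F_def)
    qed
  qed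
  have "\<exists>n. top_of S interior_of (F n) \<noteq> {}"
  proof (rule ccontr)
    assume no: "\<not> ?thesis"
    have "top_of S interior_of \<Union>(range F) = {}"
    proof (rule Baire_category_alt)
      show "completely_metrizable_space (top_of S) \<or> locally_compact_space (top_of S) \<and> regular_space (top_of S)"
        using is_tdsD(2)[OF tS] Hausdorff_mtopology_of
        by (blast intro: compact_imp_locally_compact_space compact_Hausdorff_imp_regular_space)
      show "closedin (top_of S) T \<and> top_of S interior_of T = {}" if "T \<in> range F" for T
        using that no F_closed by blast
    qed simp
    moreover have "top_of S interior_of pts S = pts S"
      using interior_of_topspace[of "top_of S"] by simp
    ultimately show False
      using cover is_tdsD(1)[OF tS] by simp
  qed
  then obtain n where n: "top_of S interior_of (F n) \<noteq> {}" by blast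
  \<comment> \<open>The interior of \<open>F n\<close> carried forward by the \<open>n\<close>-th
    iterate, hence a subset of \<open>E\<close>.\<close>
  define G where "G = {x \<in> topspace (top_of S). iter S (- n) x \<in> top_of S interior_of (F n)}"
  have sub: "top_of S interior_of (F n) \<subseteq> F n" by (rule interior_of_subset)
  show ?thesis
  proof (rule that)
    show "openin (top_of S) G"
      unfolding G_def by (rule openin_continuous_map_preimage[OF iter_continuous[OF tS]]) simp
    obtain w where w: "w \<in> top_of S interior_of (F n)" using n by blast
    then have "w \<in> pts S" using sub by (auto simp: F_def)
    then have "iter S n w \<in> G"
      using w by (simp add: G_def iter_in[OF tS] iter_iter[OF tS])
    then show "G \<noteq> {}" by blast
    fix x assume x: "x \<in> G"
    then have "iter S (- n) x \<in> F n" using sub by (auto simp: G_def)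
    then have "x \<in> E" using x by (simp add: F_def G_def iter_iter[OF tS])
    then show "\<exists>z. (x, z) \<in> pair_orbit_closure S a b \<and> mdist (met S) a x < \<delta> \<and> mdist (met S) b z < \<delta>"
      unfolding E_def using \<delta> by force
  qed
qed

text \<open>On a compact space this says that \<open>Q_rel S f\<close> is all of
  \<open>fibre_rel S f\<close>: a pair is in \<open>Q_rel S f\<close> iff for each \<open>e\<close>
  it is a limit of pairs in the fibre relation with an \<open>e\<close>-close iterate.\<close>

definition proximally_dense :: "'a tds \<Rightarrow> ('a \<Rightarrow> 'b) \<Rightarrow> bool" where
  "proximally_dense S f \<longleftrightarrow> (\<forall>e>0. \<forall>U. rel_open (met S) (fibre_rel S f) U \<and> U \<noteq> {} \<longrightarrow>
     (\<exists>x y n. (x, y) \<in> U \<and> mdist (met S) (iter S n x) (iter S n y) < e))"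

text \<open>If two disjoint open invariant sets \<open>U\<close>, \<open>V\<close> of \<open>R\<^sub>f\<close> were nonempty, take a minimal pair
  \<open>(a, b)\<close> in \<open>U\<close> and \<open>(c, b)\<close> in \<open>V\<close>. Near it there are \<open>(x, y)\<close> and \<open>z\<close> such that \<open>(x, z)\<close> is in
  the orbit closure of \<open>(a, b)\<close>, \<open>(y, z)\<close> is in \<open>V\<close>, and some iterate brings \<open>x\<close> and \<open>y\<close> so close
  together that \<open>(y, z)\<close> also is in \<open>U\<close>.\<close>

lemma invariant_open_not_disjoint:
  assumes S: "minimal_tds S" and S': "minimal_tds S'" and f: "factor_map S S' f"
    and RIC: "RIC S S' f" and prox: "proximally_dense S f"
    and U: "rel_open (met S) (fibre_rel S f) U" "U \<noteq> {}"
    and V: "rel_open (met S) (fibre_rel S f) V" "V \<noteq> {}"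
    and U_inv: "\<And>x y n. \<lbrakk>(x, y) \<in> fibre_rel S f; (iter S n x, iter S n y) \<in> U\<rbrakk> \<Longrightarrow> (x, y) \<in> U"
    and V_inv: "\<And>x y n. \<lbrakk>(x, y) \<in> fibre_rel S f; (iter S n x, iter S n y) \<in> V\<rbrakk> \<Longrightarrow> (x, y) \<in> V"
  shows "U \<inter> V \<noteq> {}"
proof
  assume disj: "U \<inter> V = {}"
  note tS = minimal_tdsD[OF S] and tS' = minimal_tdsD[OF S']
  note ff = factor_mapD[OF f]
  let ?R = "fibre_rel S f"
  let ?d = "mdist (met S)"
  obtain M u y0 where RIC_at: "RIC_at S S' f M u y0"
    using RIC RIC_iff[OF tS tS' f] by blast
  have UR: "U \<subseteq> ?R" and VR: "V \<subseteq> ?R" using U V by (auto simp: rel_open_def)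
  have R_sym: "(y, x) \<in> ?R" if "(x, y) \<in> ?R" for x y using that by (auto simp: fibre_rel_def)
  obtain x0 y0' where xy0: "(x0, y0') \<in> U" using U(2) by auto
  then obtain e0 where e0: "e0 > 0" "\<And>x' y'. \<lbrakk>(x', y') \<in> ?R; ?d x0 x' < e0; ?d y0' y' < e0\<rbrakk> \<Longrightarrow> (x', y') \<in> U"
    using U(1) unfolding rel_open_def by blast
  obtain a b where ab: "(a, b) \<in> ?R" "?d x0 a < e0" "?d y0' b < e0"
    and ap: "\<And>c d e. \<lbrakk>(c, d) \<in> pair_orbit_closure S a b; e > 0\<rbrakk> \<Longrightarrow>
       \<exists>n. ?d a (iter S n c) < e \<and> ?d b (iter S n d) < e"
    by (rule RIC_at_minimal_pairs_dense[OF tS S' f RIC_at subsetD[OF UR xy0] e0(1)]) (rule that)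
  let ?K = "pair_orbit_closure S a b"
  have ab_in: "a \<in> pts S" "b \<in> pts S" using ab(1) by (auto simp: fibre_rel_def)
  have abU: "(a, b) \<in> U" using e0(2) ab by blast
  then obtain e1 where e1: "e1 > 0" "\<And>x' y'. \<lbrakk>(x', y') \<in> ?R; ?d a x' < e1; ?d b y' < e1\<rbrakk> \<Longrightarrow> (x', y') \<in> U"
    using U(1) unfolding rel_open_def by blast
  have KR: "(c, d) \<in> ?R" if "(c, d) \<in> ?K" for c d
    by (rule pair_orbit_closure_fibre[OF tS tS' f ab(1) that])
  \<comment> \<open>Minimality of \<open>(a, b)\<close>: some iterate of \<open>(c, d)\<close> is
    close to it, hence in \<open>U\<close>, and \<open>U\<close> is invariant.\<close>
  have KU: "(c, d) \<in> U" if cd: "(c, d) \<in> ?K" for c d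
  proof -
    obtain n where "?d a (iter S n c) < e1" "?d b (iter S n d) < e1"
      using ap[OF cd e1(1)] by blast
    then have "(iter S n c, iter S n d) \<in> U"
      using e1(2) fibre_rel_iter[OF tS tS' f KR[OF cd]] by blast
    then show ?thesis using U_inv KR[OF cd] by blast
  qed
  \<comment> \<open>A radius uniform over the compact set \<open>?K\<close>: moving the first
    coordinate of a pair in \<open>?K\<close> by less than it, within the fibre, does not leave
    \<open>U\<close>.\<close>
  have "\<exists>e>0. \<forall>x z x'. (x, z) \<in> ?K \<and> (x', z) \<in> ?R \<and> ?d x x' < e \<longrightarrow> (x', z) \<in> U"
  proof (rule ccontr)
    assume no: "\<not> ?thesis"
    have "\<exists>x z x'. (x, z) \<in> ?K \<and> (x', z) \<in> ?R \<and> ?d x x' < 1 / (real k + 1) \<and> (x', z) \<notin> U" for k :: nat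
    proof -
      have "1 / (real k + 1) > 0" by simp
      with no show ?thesis by blast
    qed
    then obtain g h g' where gh: "\<And>k :: nat. (g k, h k) \<in> ?K" "\<And>k. (g' k, h k) \<in> ?R"
      "\<And>k :: nat. ?d (g k) (g' k) < 1 / (real k + 1)" "\<And>k. (g' k, h k) \<notin> U" by metis
    have in_S: "g k \<in> pts S" "h k \<in> pts S" "g' k \<in> pts S" for k
      using gh(1,2)[of k] by (auto simp: pair_orbit_closure_def fibre_rel_def)
    obtain r :: "nat filter" where r: "ultrafilter r" "r \<le> sequentially"
      by (rule free_ultrafilter_nat)
    have "\<forall>\<^sub>F k in r. g k \<in> topspace (top_of S)" "\<forall>\<^sub>F k in r. h k \<in> topspace (top_of S)"
      using in_S by simp_all
    then obtain x z where lim: "limitin (top_of S) g x r" "limitin (top_of S) h z r"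
      by (elim compact_ultrafilter_limit[OF is_tdsD(2)[OF tS] r(1)]) (rule that)
    have xz: "(x, z) \<in> ?K"
      by (rule pair_orbit_closure_closed[OF tS ab_in r(1) lim gh(1)])
    have xS: "x \<in> pts S" "z \<in> pts S" using xz by (auto simp: pair_orbit_closure_def)
    obtain e where e: "e > 0" "\<And>x' y'. \<lbrakk>(x', y') \<in> ?R; ?d x x' < e; ?d z y' < e\<rbrakk> \<Longrightarrow> (x', y') \<in> U"
      using KU[OF xz] U(1) unfolding rel_open_def by blast
    have "\<forall>\<^sub>F k in r. ?d (g k) x < e / 2 \<and> ?d (h k) z < e \<and> ?d (g k) (g' k) < e / 2"
      by (intro eventually_conj limitin_mdist[OF lim(1)] limitin_mdist[OF lim(2)]
          small_along_free_ultrafilter[OF r(2) gh(3)]) (use e(1) in auto)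
    then obtain k where k: "?d (g k) x < e / 2" "?d (h k) z < e" "?d (g k) (g' k) < e / 2"
      using eventually_happens'[OF ultrafilter_not_bot[OF r(1)]] by blast
    have "?d x (g' k) \<le> ?d x (g k) + ?d (g k) (g' k)"
      by (intro mdist_triangle xS in_S)
    then have "(g' k, h k) \<in> U"
      using k by (intro e(2) gh(2)) (simp_all add: mdist_commute[of _ x] mdist_commute[of _ z])
    with gh(4) show False by blast
  qed
  then obtain \<epsilon> where \<epsilon>: "\<epsilon> > 0" "\<And>x z x'. \<lbrakk>(x, z) \<in> ?K; (x', z) \<in> ?R; ?d x x' < \<epsilon>\<rbrakk> \<Longrightarrow> (x', z) \<in> U"
    by blast
  \<comment> \<open>Minimality of \<open>S\<close> brings \<open>b\<close> close to \<open>w\<close>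
    at some time. As \<open>f\<close> is open, \<open>v\<close> can be moved slightly into the fibre
    of that iterate of \<open>b\<close>, and invariance of \<open>V\<close> undoes the time.\<close>
  obtain c where c: "(c, b) \<in> V"
  proof -
    obtain v w where vw: "(v, w) \<in> V" using V(2) by auto
    then have vwR: "v \<in> pts S" "w \<in> pts S" "f v = f w" using VR by (auto simp: fibre_rel_def)
    obtain e where e: "e > 0" "\<And>x' y'. \<lbrakk>(x', y') \<in> ?R; ?d v x' < e; ?d w y' < e\<rbrakk> \<Longrightarrow> (x', y') \<in> V"
      using vw V(1) unfolding rel_open_def by blast
    obtain r where r: "r > 0" "\<And>y. \<lbrakk>y \<in> pts S'; mdist (met S') (f v) y < r\<rbrakk> \<Longrightarrow> \<exists>x'\<in>pts S. f x' = y \<and> ?d v x' < e"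
      by (rule RIC_at_imp_open[OF tS S' f RIC_at vwR(1) e(1)]) (rule that)
    obtain s where s: "s > 0" "\<And>y. \<lbrakk>y \<in> pts S; ?d w y < s\<rbrakk> \<Longrightarrow> mdist (met S') (f w) (f y) < r"
      by (rule continuous_map_mdist_bound[OF ff(1) vwR(2) r(1)]) (rule that)
    have "openin (top_of S) {y \<in> pts S. ?d w y < min e s}" by (rule openin_ball_of[OF vwR(2)])
    moreover have "w \<in> {y \<in> pts S. ?d w y < min e s}" using vwR(2) e(1) s(1) by (simp add: mdist_refl)
    ultimately obtain n where n: "iter S n b \<in> {y \<in> pts S. ?d w y < min e s}"
      using minimal_visit[OF S _ _ ab_in(2)] by (metis empty_iff)
    then have "mdist (met S') (f v) (f (iter S n b)) < r" using s(2) vwR(3) by simp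
    then obtain x' where x': "x' \<in> pts S" "f x' = f (iter S n b)" "?d v x' < e"
      using r(2) ff(4) iter_in[OF tS ab_in(2)] by blast
    then have "(x', iter S n b) \<in> V"
      using n iter_in[OF tS ab_in(2)] by (intro e(2)) (auto simp: fibre_rel_def)
    moreover have "iter S n (iter S (- n) x') = x'" using x'(1) by (simp add: iter_iter[OF tS])
    moreover have "(iter S (- n) x', b) \<in> ?R"
    proof -
      have "(x', iter S n b) \<in> ?R" using x' iter_in[OF tS ab_in(2)] by (simp add: fibre_rel_def)
      from fibre_rel_iter[OF tS tS' f this, of "- n"] show ?thesis
        by (simp add: iter_iter[OF tS ab_in(2)])
    qed
    ultimately have "(iter S (- n) x', b) \<in> V" using V_inv by metis
    then show ?thesis by (rule that)
  qed
  have cR: "c \<in> pts S" "f c = f b" "f a = f b" using c VR ab(1) by (auto simp: fibre_rel_def)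
  obtain e2 where e2: "e2 > 0" "\<And>x' y'. \<lbrakk>(x', y') \<in> ?R; ?d c x' < e2; ?d b y' < e2\<rbrakk> \<Longrightarrow> (x', y') \<in> V"
    using c V(1) unfolding rel_open_def by blast
  obtain r where r: "r > 0" "\<And>y. \<lbrakk>y \<in> pts S'; mdist (met S') (f c) y < r\<rbrakk> \<Longrightarrow> \<exists>x'\<in>pts S. f x' = y \<and> ?d c x' < e2"
    by (rule RIC_at_imp_open[OF tS S' f RIC_at cR(1) e2(1)]) (rule that)
  obtain s where s: "s > 0" "\<And>y. \<lbrakk>y \<in> pts S; ?d a y < s\<rbrakk> \<Longrightarrow> mdist (met S') (f a) (f y) < r"
    by (rule continuous_map_mdist_bound[OF ff(1) ab_in(1) r(1)]) (rule that)
  \<comment> \<open>With \<open>s\<close>, the point \<open>c\<close> can be moved slightly into the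
    fibre of any \<open>x\<close> in \<open>G\<close>; with \<open>e2\<close>, the resulting pair
    \<open>(y, z)\<close> is in \<open>V\<close>.\<close>
  have "min s e2 > 0" using s(1) e2(1) by simp
  then obtain G where G: "openin (top_of S) G" "G \<noteq> {}"
    "\<And>x. x \<in> G \<Longrightarrow> \<exists>z. (x, z) \<in> ?K \<and> ?d a x < min s e2 \<and> ?d b z < min s e2"
    using minimal_pair_projection_interior[OF S ab_in ap] by blast
  have G_sub: "G \<subseteq> pts S" using openin_subset[OF G(1)] by simp
  let ?W = "{(x, y) \<in> ?R. x \<in> G \<and> ?d c y < e2}"
  have "rel_open (met S) ?R ?W"
    unfolding rel_open_def
  proof (intro conjI allI impI)
    fix x y assume xy: "(x, y) \<in> ?W"
    obtain t where t: "t > 0" "\<And>z. \<lbrakk>z \<in> pts S; ?d x z < t\<rbrakk> \<Longrightarrow> z \<in> G"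
      using xy G(1) unfolding openin_mtopology_of by blast
    show "\<exists>e>0. \<forall>x' y'. (x', y') \<in> ?R \<and> ?d x x' < e \<and> ?d y y' < e \<longrightarrow> (x', y') \<in> ?W"
    proof (intro exI[of _ "min t (e2 - ?d c y)"] conjI allI impI)
      show "min t (e2 - ?d c y) > 0" using t(1) xy by simp
      fix x' y' assume h: "(x', y') \<in> ?R \<and> ?d x x' < min t (e2 - ?d c y) \<and> ?d y y' < min t (e2 - ?d c y)"
      then have in_S: "x' \<in> pts S" "y' \<in> pts S" "y \<in> pts S" using xy by (auto simp: fibre_rel_def)
      have "?d c y' \<le> ?d c y + ?d y y'" by (intro mdist_triangle cR in_S)
      then show "(x', y') \<in> ?W" using h t(2) in_S by auto
    qed
  qed blast
  moreover have "?W \<noteq> {}"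
  proof -
    obtain x where x: "x \<in> G" using G(2) by blast
    then have "?d a x < s" using G(3) by force
    then have "mdist (met S') (f c) (f x) < r" using s(2) x G_sub cR by auto
    then obtain y where "y \<in> pts S" "f y = f x" "?d c y < e2"
      using r(2) ff(4) x G_sub by blast
    then have "(x, y) \<in> ?W" using x G_sub by (auto simp: fibre_rel_def)
    then show ?thesis by blast
  qed
  ultimately obtain x y n where xy: "(x, y) \<in> ?R" "x \<in> G" "?d c y < e2"
    and n: "?d (iter S n x) (iter S n y) < \<epsilon>"
    using prox \<epsilon>(1) unfolding proximally_dense_def by blast
  obtain z where z: "(x, z) \<in> ?K" "?d b z < e2" using G(3)[OF xy(2)] by auto
  have yz: "(y, z) \<in> ?R" using xy(1) KR[OF z(1)] by (auto simp: fibre_rel_def)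
  have "(y, z) \<in> V" using e2(2)[OF yz xy(3) z(2)] .
  \<comment> \<open>At time \<open>n\<close> the points \<open>x\<close> and \<open>y\<close> are
    within \<open>\<epsilon>\<close>, and the iterate of \<open>(x, z)\<close> still is in
    \<open>?K\<close>.\<close>
  moreover have "(iter S n y, iter S n z) \<in> U"
    using \<epsilon>(2)[OF pair_orbit_closure_iter[OF tS ab_in z(1)] fibre_rel_iter[OF tS tS' f yz] n] .
  then have "(y, z) \<in> U" using U_inv yz by blast
  ultimately show False using disj by blast
qed

lemma weakly_mixing_iff:
  "weakly_mixing_map S f \<longleftrightarrow> (\<forall>U V. rel_open (met S) (fibre_rel S f) U \<and> rel_open (met S) (fibre_rel S f) V \<and>
     U \<noteq> {} \<and> V \<noteq> {} \<longrightarrow> (\<exists>n x y. (x, y) \<in> U \<and> (iter S n x, iter S n y) \<in> V))"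
proof -
  have R: "fibre_rel S f \<subseteq> pts S \<times> pts S" by (auto simp: fibre_rel_def)
  have "map_prod g g ` U \<inter> V \<noteq> {} \<longleftrightarrow> (\<exists>x y. (x, y) \<in> U \<and> (g x, g y) \<in> V)" for g :: "'a \<Rightarrow> 'a" and U V
  proof -
    have "map_prod g g ` U \<inter> V \<noteq> {} \<longleftrightarrow> (\<exists>w. w \<in> U \<and> map_prod g g w \<in> V)"
    proof
      assume "map_prod g g ` U \<inter> V \<noteq> {}"
      then obtain v where "v \<in> map_prod g g ` U" "v \<in> V" by (meson IntE ex_in_conv)
      moreover from this(1) obtain w where "v = map_prod g g w" "w \<in> U" by (rule imageE)
      ultimately show "\<exists>w. w \<in> U \<and> map_prod g g w \<in> V" by (intro exI[of _ w]) simp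
    next
      assume "\<exists>w. w \<in> U \<and> map_prod g g w \<in> V"
      then obtain w where "w \<in> U \<and> map_prod g g w \<in> V" by (rule exE)
      then have "map_prod g g w \<in> map_prod g g ` U \<inter> V" by (intro IntI imageI) simp_all
      then show "map_prod g g ` U \<inter> V \<noteq> {}" by (metis empty_iff)
    qed
    then show ?thesis
      by (simp only: split_paired_Ex map_prod_simp)
  qed
  then show ?thesis
    unfolding weakly_mixing_map_def transitive_action_def openin_iff_rel_open[OF R] by simp
qed

text \<open>Both open sets are replaced by their saturations under iteration. A point common to the
  saturations is in \<open>U\<close> at one time and in \<open>V\<close> at another, and the
  difference of the times is the iterate sought.\<close>

lemma RIC_proximally_dense_imp_weakly_mixing:
  assumes S: "minimal_tds S" and S': "minimal_tds S'" and f: "factor_map S S' f"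
    and RIC: "RIC S S' f" and prox: "proximally_dense S f"
  shows "weakly_mixing_map S f"
  unfolding weakly_mixing_iff
proof (intro allI impI)
  fix U V assume h: "rel_open (met S) (fibre_rel S f) U \<and> rel_open (met S) (fibre_rel S f) V \<and> U \<noteq> {} \<and> V \<noteq> {}"
  note tS = minimal_tdsD[OF S] and tS' = minimal_tdsD[OF S']
  let ?sat = "\<lambda>U. {(x, y) \<in> fibre_rel S f. \<exists>n. (iter S n x, iter S n y) \<in> U}"
  have sat: "rel_open (met S) (fibre_rel S f) (?sat W) \<and> ?sat W \<noteq> {} \<and>
      (\<forall>x y n. (x, y) \<in> fibre_rel S f \<and> (iter S n x, iter S n y) \<in> ?sat W \<longrightarrow> (x, y) \<in> ?sat W)"
    if W: "rel_open (met S) (fibre_rel S f) W" "W \<noteq> {}" for W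
  proof (intro conjI allI impI)
    show "rel_open (met S) (fibre_rel S f) (?sat W)"
      by (rule iter_saturation_rel_open[OF tS tS' f W(1)])
    obtain x y where "(x, y) \<in> W" using W(2) by auto
    then have "(x, y) \<in> ?sat W"
      using W(1) unfolding rel_open_def by (auto intro!: exI[of _ 0])
    then show "?sat W \<noteq> {}" by blast
    fix x y n assume xy: "(x, y) \<in> fibre_rel S f \<and> (iter S n x, iter S n y) \<in> ?sat W"
    then obtain k where "(iter S k (iter S n x), iter S k (iter S n y)) \<in> W" by blast
    then have "(iter S (k + n) x, iter S (k + n) y) \<in> W"
      using xy by (simp add: fibre_rel_def iter_iter[OF tS])
    then show "(x, y) \<in> ?sat W" using xy by blast
  qed
  have "?sat U \<inter> ?sat V \<noteq> {}"
    by (rule invariant_open_not_disjoint[OF S S' f RIC prox]) (use sat h in blast)+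
  then obtain x y k n where xy: "(x, y) \<in> fibre_rel S f" "(iter S k x, iter S k y) \<in> U"
    "(iter S n x, iter S n y) \<in> V" by blast
  then have "(iter S (n - k) (iter S k x), iter S (n - k) (iter S k y)) \<in> V"
    by (simp add: fibre_rel_def iter_iter[OF tS])
  with xy(2) show "\<exists>n x y. (x, y) \<in> U \<and> (iter S n x, iter S n y) \<in> V" by blast
qed

text \<open>The \<open>e\<close>-neighbourhood of the diagonal is a nonempty open subset of the
  fibre relation, so transitivity moves some pair of \<open>U\<close> into it.\<close>

lemma weakly_mixing_imp_proximally_dense:
  assumes S: "is_tds S" and wm: "weakly_mixing_map S f"
  shows "proximally_dense S f"
  unfolding proximally_dense_def
proof (intro allI impI)
  fix e :: real and U assume e: "e > 0" and U: "rel_open (met S) (fibre_rel S f) U \<and> U \<noteq> {}"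
  let ?V = "{(x, y) \<in> fibre_rel S f. mdist (met S) x y < e}"
  have "rel_open (met S) (fibre_rel S f) ?V"
    unfolding rel_open_def
  proof (intro conjI allI impI)
    fix x y assume xy: "(x, y) \<in> ?V"
    show "\<exists>r>0. \<forall>x' y'. (x', y') \<in> fibre_rel S f \<and> mdist (met S) x x' < r \<and> mdist (met S) y y' < r \<longrightarrow> (x', y') \<in> ?V"
    proof (intro exI[of _ "(e - mdist (met S) x y) / 2"] conjI allI impI)
      show "(e - mdist (met S) x y) / 2 > 0" using xy by simp
      fix x' y' assume h: "(x', y') \<in> fibre_rel S f \<and> mdist (met S) x x' < (e - mdist (met S) x y) / 2 \<and>
        mdist (met S) y y' < (e - mdist (met S) x y) / 2"
      then have in_S: "x \<in> pts S" "y \<in> pts S" "x' \<in> pts S" "y' \<in> pts S"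
        using xy by (auto simp: fibre_rel_def)
      have "mdist (met S) x' y' \<le> mdist (met S) x' x + mdist (met S) x y'"
        "mdist (met S) x y' \<le> mdist (met S) x y + mdist (met S) y y'"
        by (intro mdist_triangle in_S)+
      then show "(x', y') \<in> ?V" using h by (simp add: mdist_commute[of _ x' x] field_simps)
    qed
  qed blast
  moreover have "?V \<noteq> {}"
  proof -
    obtain x where "x \<in> pts S" using is_tdsD(1)[OF S] by blast
    then have "(x, x) \<in> ?V" using e by (simp add: fibre_rel_def mdist_refl)
    then show ?thesis by blast
  qed
  ultimately obtain n x y where "(x, y) \<in> U" "(iter S n x, iter S n y) \<in> ?V"
    using wm U unfolding weakly_mixing_iff by blast
  then show "\<exists>x y n. (x, y) \<in> U \<and> mdist (met S) (iter S n x) (iter S n y) < e" by blast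
qed

section \<open>Passage to powers\<close>

lemma power_invariant_iter:
  assumes "is_tds S" "power_invariant S m A" "x \<in> pts S"
  shows "iter S (int m * n) x \<in> A \<longleftrightarrow> x \<in> A"
proof
  assume h: "iter S (int m * n) x \<in> A"
  have "iter S (int m * (- n)) (iter S (int m * n) x) = x"
    by (simp add: iter_iter[OF assms(1,3)])
  then show "x \<in> A"
    using iter_power_subsystem(2)[OF assms(1,2) h, of "- n"] by simp
qed (rule iter_power_subsystem(2)[OF assms(1,2)])

text \<open>Negative multiples of \<open>m\<close> are included in the assumption; they give
  surjectivity of T^m on \<open>A\<close>.\<close>

lemma power_invariant_of_iter:
  assumes "is_tds S" "closedin (top_of S) A" "A \<noteq> {}" "\<And>x n. x \<in> A \<Longrightarrow> iter S (int m * n) x \<in> A"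
  shows "power_invariant S m A"
  unfolding power_invariant_def
proof (intro conjI assms)
  have sub: "A \<subseteq> pts S" using closedin_subset[OF assms(2)] by simp
  show "(act S ^^ m) ` A = A"
  proof
    show "(act S ^^ m) ` A \<subseteq> A"
      using assms(4)[of _ 1] by (auto simp: iter_nat)
    show "A \<subseteq> (act S ^^ m) ` A"
    proof
      fix x assume x: "x \<in> A"
      then have "x = (act S ^^ m) (iter S (int m * (- 1)) x)"
        using sub by (auto simp: iter_nat[symmetric] iter_iter[OF assms(1)])
      then show "x \<in> (act S ^^ m) ` A"
        using assms(4)[OF x, of "- 1"] by (rule image_eqI)
    qed
  qed
qed

section \<open>Dilation of ultrafilters and RIC for powers\<close>

text \<open>For \<open>m \<ge> 1\<close> this embeds the semigroup of ultrafilters into itself, the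
  image being the ultrafilters that contain the multiples of \<open>m\<close>. It translates the
  action of T^m into that of T.\<close>

definition dilate :: "nat \<Rightarrow> int filter \<Rightarrow> int filter" where
  "dilate m p = filtermap (\<lambda>n. int m * n) p"

lemma eventually_dilate: "eventually P (dilate m p) \<longleftrightarrow> eventually (\<lambda>n. P (int m * n)) p"
  by (simp add: dilate_def eventually_filtermap)

lemma dilate_ultrafilter: "ultrafilter p \<Longrightarrow> ultrafilter (dilate m p)"
  unfolding dilate_def by (rule ultrafilter_filtermap)

lemma dilate_beta_plus: "dilate m (beta_plus p q) = beta_plus (dilate m p) (dilate m q)"
  by (simp add: filter_eq_iff eventually_dilate eventually_beta_plus distrib_left)

lemma dilate_inj: "\<lbrakk>m \<ge> 1; dilate m p = dilate m q\<rbrakk> \<Longrightarrow> p = q"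
  unfolding dilate_def by (subst (asm) filtermap_eq_strong) (auto simp: inj_on_def)

lemma dilate_surj:
  assumes "ultrafilter p" "\<forall>\<^sub>F n in p. int m dvd n"
  obtains q where "ultrafilter q" "dilate m q = p"
proof
  let ?q = "filtermap (\<lambda>n. n div int m) p"
  show "ultrafilter ?q" by (rule ultrafilter_filtermap[OF assms(1)])
  have "eventually P (dilate m ?q) \<longleftrightarrow> eventually P p" for P
  proof -
    have "\<forall>\<^sub>F n in p. P (int m * (n div int m)) = P n"
      using assms(2) by (rule eventually_mono) simp
    then show ?thesis
      unfolding eventually_dilate eventually_filtermap by (rule eventually_subst)
  qed
  then show "dilate m ?q = p" by (simp add: filter_eq_iff)
qed

text \<open>The residue mod \<open>m\<close> that an ultrafilter selects is additive under
  \<open>beta_plus\<close>. For an idempotent it satisfies \<open>r + r = r\<close> mod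
  \<open>m\<close>, hence is \<open>0\<close>.\<close>

lemma idempotent_eventually_dvd:
  assumes "ultrafilter u" "beta_plus u u = u" "m \<ge> 1"
  shows "\<forall>\<^sub>F n in u. int m dvd n"
proof -
  have "\<forall>\<^sub>F n in u. \<exists>r\<in>{0..<int m}. n mod int m = r"
    using assms(3) by (intro always_eventually allI) auto
  then obtain r where r: "r \<in> {0..<int m}" "\<forall>\<^sub>F n in u. n mod int m = r"
    using ultrafilter_finite_union[OF assms(1), of "{0..<int m}" "\<lambda>r n. n mod int m = r"] by auto
  have "\<forall>\<^sub>F n in u. \<forall>\<^sub>F k in u. (n + k) mod int m = (r + r) mod int m"
    using r(2)
  proof (rule eventually_mono)
    fix n assume n: "n mod int m = r"
    show "\<forall>\<^sub>F k in u. (n + k) mod int m = (r + r) mod int m"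
      using r(2) by (rule eventually_mono) (metis n mod_add_eq mod_mod_trivial)
  qed
  then have "\<forall>\<^sub>F n in beta_plus u u. n mod int m = (r + r) mod int m"
    unfolding eventually_beta_plus .
  then have "\<forall>\<^sub>F n in u. n mod int m = (r + r) mod int m \<and> n mod int m = r"
    using r(2) unfolding assms(2) by (rule eventually_conj)
  then obtain n where "n mod int m = (r + r) mod int m" "n mod int m = r"
    using eventually_happens'[OF ultrafilter_not_bot[OF assms(1)]] by blast
  then have "(r + r) mod int m = r mod int m" using r(1) by simp
  then have "int m dvd (r + r) - r" by (simp only: mod_eq_dvd_iff)
  then have "r = 0" using r(1) zdvd_not_zless[of r "int m"] by fastforce
  then show ?thesis using r(2) by (simp add: dvd_eq_mod_eq_0)
qed

text \<open>For minimality, take \<open>n\<close> in a smaller left ideal and \<open>q\<close> in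
  the pullback. Minimality of \<open>M\<close> gives \<open>dilate m q = s + dilate m n\<close>.
  Both dilations contain the multiples of \<open>m\<close>, hence so does \<open>s\<close>, which is
  therefore a dilation as well; cancelling the dilations exhibits \<open>q\<close> in the left ideal
  of \<open>n\<close>.\<close>

lemma minimal_left_ideal_dilate:
  assumes M: "minimal_left_ideal M" and u: "u \<in> betaZ" "dilate m u \<in> M" and m: "m \<ge> 1"
  shows "minimal_left_ideal {p \<in> betaZ. dilate m p \<in> M}" (is "minimal_left_ideal ?M")
  unfolding minimal_left_ideal_def
proof (intro conjI allI impI)
  show "left_ideal ?M"
    unfolding left_ideal_def
  proof (intro conjI ballI)
    show "?M \<noteq> {}" using u by blast
    show "?M \<subseteq> betaZ" by blast
    fix p q assume p: "p \<in> betaZ" and q: "q \<in> ?M"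
    have "dilate m p \<in> betaZ"
      using p dilate_ultrafilter unfolding betaZ_iff by blast
    then have "beta_plus (dilate m p) (dilate m q) \<in> M"
      using minimal_left_idealD(2)[OF M] q by blast
    then show "beta_plus p q \<in> ?M"
      using p q by (simp add: dilate_beta_plus beta_plus_betaZ)
  qed
  fix N assume N: "left_ideal N \<and> N \<subseteq> ?M"
  then obtain n where n: "n \<in> N" unfolding left_ideal_def by blast
  then have nM: "dilate m n \<in> M" and n_ultra: "ultrafilter n" using N betaZ_iff by blast+
  have "q \<in> N" if q: "q \<in> ?M" for q
  proof -
    have q_ultra: "ultrafilter q" using q betaZ_iff by blast
    obtain s where s: "s \<in> betaZ" "dilate m q = beta_plus s (dilate m n)"
      using minimal_left_ideal_generated[OF M nM] q by blast
    have "\<forall>\<^sub>F k in dilate m q. int m dvd k" by (simp add: eventually_dilate)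
    then have "\<forall>\<^sub>F i in s. \<forall>\<^sub>F k in n. int m dvd i + int m * k"
      unfolding s(2) eventually_beta_plus eventually_dilate .
    then have "\<forall>\<^sub>F i in s. int m dvd i"
    proof (rule eventually_mono)
      fix i assume "\<forall>\<^sub>F k in n. int m dvd i + int m * k"
      then obtain k where "int m dvd i + int m * k"
        using eventually_happens'[OF ultrafilter_not_bot[OF n_ultra]] by blast
      then show "int m dvd i" by (simp add: dvd_add_left_iff)
    qed
    then obtain s' where s': "ultrafilter s'" "dilate m s' = s"
      using dilate_surj s(1) betaZ_iff by metis
    have "dilate m q = dilate m (beta_plus s' n)"
      by (simp add: s(2) s'(2) dilate_beta_plus)
    then have "q = beta_plus s' n" by (rule dilate_inj[OF m])
    moreover have "s' \<in> betaZ" using s'(1) by (simp add: betaZ_iff)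
    ultimately show "q \<in> N"
      using N n unfolding left_ideal_def by blast
  qed
  then show "N = ?M" using N by blast
qed

text \<open>The limit stays in \<open>A\<close> because \<open>A\<close> is closed.\<close>

lemma orbit_limit_power_subsystem:
  assumes "is_tds S" "power_invariant S m A" "x \<in> A" "ultrafilter p"
  shows "orbit_limit (power_subsystem S A m) p x y \<longleftrightarrow> orbit_limit S (dilate m p) x y"
proof -
  have it: "iter (power_subsystem S A m) n x = iter S (int m * n) x" "iter S (int m * n) x \<in> A" for n
    using iter_power_subsystem[OF assms(1-3)] by auto
  have "y \<in> A" if "limitin (top_of S) (\<lambda>n. iter S (int m * n) x) y p"
    using that
  proof (rule limitin_closedin)
    show "closedin (top_of S) A" using assms(2) by (simp add: power_invariant_def)
    show "\<forall>\<^sub>F n in p. iter S (int m * n) x \<in> A" using it(2) by simp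
  qed (simp add: assms(4))
  then show ?thesis
    unfolding power_subsystem_simps limitin_subtopology dilate_def limitin_filtermap it(1)
    using it(2) by auto
qed

text \<open>The base point of RIC need not lie in the image of \<open>A\<close>, but some iterate of
  it does; since iterates commute with the action of ultrafilters, this iterate serves as the new
  base point. Openness of \<open>A\<close> keeps the approximating points in the piece.\<close>

lemma RIC_power_subsystem:
  assumes S: "minimal_tds S" and S': "minimal_tds S'" and f: "factor_map S S' f"
    and RIC: "RIC S S' f" and A: "power_invariant S m A" "openin (top_of S) A" and m: "m \<ge> 1"
  shows "RIC (power_subsystem S A m) (power_subsystem S' (f ` A) m) f"
proof -
  note tS = minimal_tdsD[OF S] and tS' = minimal_tdsD[OF S']
  note ff = factor_mapD[OF f]
  let ?P = "power_subsystem S A m" and ?P' = "power_subsystem S' (f ` A) m"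
  note A' = power_invariant_image[OF tS tS' f A(1)]
  note P = is_tds_power_subsystem[OF tS A(1)] and P' = is_tds_power_subsystem[OF tS' A']
  note fP = factor_map_power_subsystem[OF tS tS' f A(1) refl]
  have sub: "A \<subseteq> pts S" and sub': "f ` A \<subseteq> pts S'"
    using power_invariant_subset A(1) A' by blast+
  note pts = power_subsystem_pts[OF sub, of m] power_subsystem_pts[OF sub', of m]
  obtain M v y0 where RIC_at: "RIC_at S S' f M v y0"
    using RIC RIC_iff[OF tS tS' f] by blast
  then have M: "minimal_left_ideal M" and v: "v \<in> M" "beta_plus v v = v"
    and y0: "y0 \<in> pts S'" "orbit_limit S' v y0 y0" by (auto simp: RIC_at_def)
  have v_ultra: "ultrafilter v" by (rule minimal_left_idealD(3)[OF M v(1)])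
  obtain u where u: "ultrafilter u" "dilate m u = v"
    using dilate_surj[OF v_ultra idempotent_eventually_dvd[OF v_ultra v(2) m]] .
  let ?M = "{p \<in> betaZ. dilate m p \<in> M}"
  have "y0 \<in> f ` pts S" using y0(1) unfolding ff(2) .
  then obtain w where w: "f w = y0" "w \<in> pts S" by (auto simp: image_iff)
  obtain i where i: "iter S i w \<in> A"
    by (rule minimal_visit[OF S A(2) _ w(2)]) (use A(1) in \<open>simp add: power_invariant_def\<close>)
  let ?y = "iter S' i y0"
  have y: "?y \<in> f ` A" using imageI[OF i, of f] factor_map_iter[OF tS tS' f w(2), of i] w(1) by simp
  have "RIC_at ?P ?P' f ?M u ?y"
    unfolding RIC_at_def
  proof (intro conjI ballI impI allI)
    show "minimal_left_ideal ?M"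
      by (rule minimal_left_ideal_dilate[OF M _ _ m]) (use u v betaZ_iff in auto)
    show "u \<in> ?M" using u v betaZ_iff by auto
    show "beta_plus u u = u"
      by (rule dilate_inj[OF m]) (simp add: dilate_beta_plus u(2) v(2))
    show "?y \<in> pts ?P'" using y by (simp add: pts)
    show "orbit_limit ?P' u ?y ?y"
      unfolding orbit_limit_power_subsystem[OF tS' A' y u(1)] u(2)
      by (rule orbit_limit_iter[OF tS' y0])
    fix p x and e :: real
    assume p: "p \<in> ?M" and "x \<in> pts ?P" and lim: "orbit_limit ?P' p ?y (f x)" and e: "e > 0"
    then have xA: "x \<in> A" and p_ultra: "ultrafilter p" using pts betaZ_iff by auto
    have x: "x \<in> pts S" using xA sub by blast
    let ?x = "iter S (- i) x"
    have x': "?x \<in> pts S" by (rule iter_in[OF tS x])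
    have ix: "iter S i ?x = x" by (simp add: iter_iter[OF tS x])
    have "orbit_limit S' (dilate m p) ?y (f x)"
      using lim unfolding orbit_limit_power_subsystem[OF tS' A' y p_ultra] .
    then have "orbit_limit S' (dilate m p) (iter S' (- i) ?y) (iter S' (- i) (f x))"
      by (rule orbit_limit_iter[OF tS' iter_in[OF tS' y0(1)]])
    then have lim': "orbit_limit S' (dilate m p) y0 (f ?x)"
      by (simp add: iter_iter[OF tS' y0(1)] factor_map_iter[OF tS tS' f x])
    \<comment> \<open>Within \<open>e1\<close> of \<open>x\<close> everything is in
      \<open>A\<close>. This puts the approximating iterates in \<open>A\<close> and, by
      T^m-invariance, their starting points as well.\<close>
    obtain e1 where e1: "e1 > 0" "\<And>z. \<lbrakk>z \<in> pts S; mdist (met S) x z < e1\<rbrakk> \<Longrightarrow> z \<in> A"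
      using A(2) xA unfolding openin_mtopology_of by blast
    obtain \<delta> where \<delta>: "\<delta> > 0"
      "\<And>z. \<lbrakk>z \<in> pts S; mdist (met S) ?x z < \<delta>\<rbrakk> \<Longrightarrow> mdist (met S) (iter S i ?x) (iter S i z) < min e e1"
      by (rule continuous_map_mdist_bound[OF iter_continuous[OF tS, of i] x', of "min e e1"])
        (use e e1 in auto)
    have "\<forall>\<^sub>F n in dilate m p. \<exists>a\<in>{a \<in> pts S. f a = y0 \<and> orbit_limit S v a a}. mdist (met S) (iter S n a) ?x < \<delta>"
      by (rule RIC_at_approx[OF RIC_at _ x' lim' \<delta>(1)]) (use p in blast)
    then have "\<forall>\<^sub>F n in p. \<exists>a\<in>{a \<in> pts S. f a = y0 \<and> orbit_limit S v a a}. mdist (met S) (iter S (int m * n) a) ?x < \<delta>"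
      unfolding eventually_dilate .
    then show "\<forall>\<^sub>F n in p. \<exists>a\<in>{a \<in> pts ?P. f a = ?y \<and> orbit_limit ?P u a a}. mdist (met ?P) (iter ?P n a) x < e"
    proof (rule eventually_mono)
      fix n assume "\<exists>a\<in>{a \<in> pts S. f a = y0 \<and> orbit_limit S v a a}. mdist (met S) (iter S (int m * n) a) ?x < \<delta>"
      then obtain a where a: "a \<in> pts S" "f a = y0" "orbit_limit S v a a"
        "mdist (met S) (iter S (int m * n) a) ?x < \<delta>" by auto
      have b: "iter S i a \<in> pts S" by (rule iter_in[OF tS a(1)])
      have "mdist (met S) (iter S i ?x) (iter S i (iter S (int m * n) a)) < min e e1"
        using a(4) by (intro \<delta>(2) iter_in[OF tS a(1)]) (simp add: mdist_commute)
      then have near: "mdist (met S) x (iter S (int m * n) (iter S i a)) < min e e1"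
        unfolding ix by (simp add: iter_iter[OF tS a(1)] add.commute)
      then have "iter S (int m * n) (iter S i a) \<in> A"
        using e1(2) iter_in[OF tS b] by simp
      then have bA: "iter S i a \<in> A"
        using power_invariant_iter[OF tS A(1) b] by simp
      have "orbit_limit ?P u (iter S i a) (iter S i a)"
        unfolding orbit_limit_power_subsystem[OF tS A(1) bA u(1)] u(2)
        by (rule orbit_limit_iter[OF tS a(1,3)])
      moreover have "f (iter S i a) = ?y"
        using factor_map_iter[OF tS tS' f a(1), of i] a(2) by simp
      moreover have "mdist (met ?P) (iter ?P n (iter S i a)) x < e"
        using near iter_power_subsystem(1)[OF tS A(1) bA, of n] by (simp add: mdist_commute)
      ultimately show "\<exists>a\<in>{a \<in> pts ?P. f a = ?y \<and> orbit_limit ?P u a a}. mdist (met ?P) (iter ?P n a) x < e"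
        using bA pts by (intro bexI[of _ "iter S i a"]) auto
    qed
  qed
  then show ?thesis
    using RIC_iff[OF P P' fP] by blast
qed

section \<open>Proximality, proximal density and Q for powers\<close>

lemma proximal_map_iff:
  "proximal_map S f \<longleftrightarrow>
     (\<forall>x y. (x, y) \<in> fibre_rel S f \<longrightarrow> (\<forall>e>0. \<exists>n. mdist (met S) (iter S n x) (iter S n y) < e))"
proof -
  have "(INF n::int. mdist (met S) (iter S n x) (iter S n y)) = 0 \<longleftrightarrow>
      (\<forall>e>0. \<exists>n. mdist (met S) (iter S n x) (iter S n y) < e)" (is "?I = 0 \<longleftrightarrow> ?R") for x y
  proof -
    have bdd: "bdd_below (range (\<lambda>n. mdist (met S) (iter S n x) (iter S n y)))"
      by (rule bdd_belowI2[of _ 0]) (rule mdist_nonneg)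
    have "0 \<le> ?I" by (rule cINF_greatest) (auto simp: mdist_nonneg)
    have "?I = 0 \<longleftrightarrow> (\<forall>e>0. ?I < e)"
    proof
      assume "\<forall>e>0. ?I < e"
      then have "\<not> ?I > 0" by blast
      with \<open>0 \<le> ?I\<close> show "?I = 0" by (simp only: order_le_less) simp
    qed simp
    also have "\<dots> \<longleftrightarrow> ?R"
      using cINF_less_iff[OF _ bdd] by simp
    finally show ?thesis .
  qed
  then show ?thesis unfolding proximal_map_def by auto
qed

lemma funpow_equicontinuous:
  assumes "is_tds S" "e > 0"
  obtains \<delta> where "\<delta> > 0"
    "\<And>r x y. \<lbrakk>r < k; x \<in> pts S; y \<in> pts S; mdist (met S) x y < \<delta>\<rbrakk> \<Longrightarrow>
       mdist (met S) (iter S (int r) x) (iter S (int r) y) < e"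
proof -
  have "\<exists>\<delta>>0. \<forall>r<k. \<forall>x\<in>pts S. \<forall>y\<in>pts S. mdist (met S) x y < \<delta> \<longrightarrow>
       mdist (met S) (iter S (int r) x) (iter S (int r) y) < e"
  proof (induction k)
    case 0
    show ?case by (auto intro: exI[of _ 1])
  next
    case (Suc k)
    then obtain d1 where d1: "d1 > 0" "\<forall>r<k. \<forall>x\<in>pts S. \<forall>y\<in>pts S. mdist (met S) x y < d1 \<longrightarrow>
       mdist (met S) (iter S (int r) x) (iter S (int r) y) < e" by blast
    obtain d2 where d2: "d2 > 0" "\<And>x y. \<lbrakk>x \<in> pts S; y \<in> pts S; mdist (met S) x y < d2\<rbrakk> \<Longrightarrow>
       mdist (met S) (iter S (int k) x) (iter S (int k) y) < e"
      by (rule continuous_map_unif_bound[OF is_tdsD(2)[OF assms(1)] iter_continuous[OF assms(1), of "int k"] assms(2)])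
        (rule that)
    show ?case
      by (rule exI[of _ "min d1 d2"]) (use d1 d2 in \<open>auto simp: less_Suc_eq\<close>)
  qed
  then show ?thesis using that by blast
qed

text \<open>The next multiple of \<open>m\<close> after \<open>n\<close> is at most \<open>m\<close> steps away.\<close>

lemma close_at_multiple:
  assumes S: "is_tds S" and m: "m \<ge> 1" and e: "e > 0"
  obtains \<delta> where "\<delta> > 0"
    "\<And>x y n. \<lbrakk>x \<in> pts S; y \<in> pts S; mdist (met S) (iter S n x) (iter S n y) < \<delta>\<rbrakk> \<Longrightarrow>
       \<exists>k. mdist (met S) (iter S (int m * k) x) (iter S (int m * k) y) < e"
proof -
  obtain \<delta> where \<delta>: "\<delta> > 0" "\<And>r x y. \<lbrakk>r < Suc m; x \<in> pts S; y \<in> pts S; mdist (met S) x y < \<delta>\<rbrakk> \<Longrightarrow>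
       mdist (met S) (iter S (int r) x) (iter S (int r) y) < e"
    by (rule funpow_equicontinuous[OF S e]) (rule that)
  show ?thesis
  proof (rule that[OF \<delta>(1)])
    fix x y n assume xy: "x \<in> pts S" "y \<in> pts S" "mdist (met S) (iter S n x) (iter S n y) < \<delta>"
    \<comment> \<open>\<open>r\<close> ranges over 1, ..., \<open>m\<close>, so that
      \<open>n + r\<close> is the next larger multiple of \<open>m\<close>; hence the bound
      \<open>Suc m\<close> on the iterates above.\<close>
    define r where "r = nat (int m - n mod int m)"
    have "0 \<le> n mod int m" "n mod int m < int m" using m by simp_all
    then have r: "int r = int m - n mod int m" "r < Suc m" by (auto simp: r_def)
    have eq: "int r + n = int m * (n div int m + 1)"
      unfolding distrib_left using r(1) mult_div_mod_eq[of "int m" n] by linarith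
    have "mdist (met S) (iter S (int r) (iter S n x)) (iter S (int r) (iter S n y)) < e"
      using \<delta>(2)[OF r(2)] iter_in[OF S] xy by blast
    then show "\<exists>k. mdist (met S) (iter S (int m * k) x) (iter S (int m * k) y) < e"
      unfolding iter_iter[OF S xy(1)] iter_iter[OF S xy(2)] eq by blast
  qed
qed

lemma fibre_rel_power_subsystem:
  "A \<subseteq> pts S \<Longrightarrow> fibre_rel (power_subsystem S A m) f = fibre_rel S f \<inter> A \<times> A"
  by (auto simp: fibre_rel_def power_subsystem_pts)

lemma proximal_map_power_subsystem:
  assumes S: "is_tds S" and f: "proximal_map S f" and A: "power_invariant S m A" and m: "m \<ge> 1"
  shows "proximal_map (power_subsystem S A m) f"
  unfolding proximal_map_iff mdist_power_subsystem
proof (intro allI impI)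
  fix x y and e :: real
  assume xy: "(x, y) \<in> fibre_rel (power_subsystem S A m) f" and e: "e > 0"
  then have R: "(x, y) \<in> fibre_rel S f" and xyA: "x \<in> A" "y \<in> A"
    unfolding fibre_rel_power_subsystem[OF power_invariant_subset[OF A]] by auto
  obtain \<delta> where \<delta>: "\<delta> > 0" "\<And>x y n. \<lbrakk>x \<in> pts S; y \<in> pts S; mdist (met S) (iter S n x) (iter S n y) < \<delta>\<rbrakk> \<Longrightarrow>
       \<exists>k. mdist (met S) (iter S (int m * k) x) (iter S (int m * k) y) < e"
    by (rule close_at_multiple[OF S m e]) (rule that)
  obtain n where "mdist (met S) (iter S n x) (iter S n y) < \<delta>"
    using f R \<delta>(1) unfolding proximal_map_iff by blast
  then obtain k where "mdist (met S) (iter S (int m * k) x) (iter S (int m * k) y) < e"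
    using \<delta>(2) xyA power_invariant_subset[OF A] by blast
  then show "\<exists>n. mdist (met S) (iter (power_subsystem S A m) n x) (iter (power_subsystem S A m) n y) < e"
    using xyA by (auto simp: iter_power_subsystem(1)[OF S A])
qed

text \<open>Openness of \<open>A\<close> makes a relatively open set of pairs over the piece
  relatively open in the whole fibre relation, so that density for \<open>S\<close> applies to it.
  The time of closeness is then moved to a multiple of \<open>m\<close>.\<close>

lemma proximally_dense_power_subsystem:
  assumes S: "is_tds S" and f: "proximally_dense S f" and A: "power_invariant S m A"
    and A_open: "openin (top_of S) A" and m: "m \<ge> 1"
  shows "proximally_dense (power_subsystem S A m) f"
  unfolding proximally_dense_def mdist_power_subsystem
proof (intro allI impI)
  fix e :: real and U
  assume e: "e > 0" and U: "rel_open (met (power_subsystem S A m)) (fibre_rel (power_subsystem S A m) f) U \<and> U \<noteq> {}"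
  note sub = power_invariant_subset[OF A]
  note fib = fibre_rel_power_subsystem[OF sub, of m f]
  have U_sub: "U \<subseteq> fibre_rel S f \<inter> A \<times> A"
    using U unfolding rel_open_def fib by blast
  from U have "rel_open (met (power_subsystem S A m)) (fibre_rel (power_subsystem S A m) f) U"
    by (rule conjunct1)
  then have U_open: "\<forall>x y. (x, y) \<in> U \<longrightarrow> (\<exists>e>0. \<forall>x' y'. (x', y') \<in> fibre_rel S f \<inter> A \<times> A \<and>
      mdist (met S) x x' < e \<and> mdist (met S) y y' < e \<longrightarrow> (x', y') \<in> U)"
    unfolding rel_open_def fib mdist_power_subsystem by (rule conjunct2)
  have "rel_open (met S) (fibre_rel S f) U"
    unfolding rel_open_def
  proof (intro conjI allI impI)
    show "U \<subseteq> fibre_rel S f" using U_sub by blast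
    fix x y assume xy: "(x, y) \<in> U"
    obtain e0 where e0: "e0 > 0" "\<forall>x' y'. (x', y') \<in> fibre_rel S f \<inter> A \<times> A \<and> mdist (met S) x x' < e0 \<and>
        mdist (met S) y y' < e0 \<longrightarrow> (x', y') \<in> U"
      using U_open[rule_format, OF xy] by (elim exE conjE) (rule that)
    have "x \<in> A" "y \<in> A" using xy U_sub by auto
    note xyA = this
    obtain e1 where e1: "e1 > 0" "\<And>z. \<lbrakk>z \<in> pts S; mdist (met S) x z < e1\<rbrakk> \<Longrightarrow> z \<in> A"
      using A_open xyA(1) unfolding openin_mtopology_of by blast
    obtain e2 where e2: "e2 > 0" "\<And>z. \<lbrakk>z \<in> pts S; mdist (met S) y z < e2\<rbrakk> \<Longrightarrow> z \<in> A"
      using A_open xyA(2) unfolding openin_mtopology_of by blast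
    show "\<exists>e>0. \<forall>x' y'. (x', y') \<in> fibre_rel S f \<and> mdist (met S) x x' < e \<and> mdist (met S) y y' < e \<longrightarrow> (x', y') \<in> U"
    proof (intro exI[of _ "min e0 (min e1 e2)"] conjI allI impI)
      show "min e0 (min e1 e2) > 0" using e0(1) e1(1) e2(1) by simp
      fix x' y' assume h: "(x', y') \<in> fibre_rel S f \<and> mdist (met S) x x' < min e0 (min e1 e2) \<and>
        mdist (met S) y y' < min e0 (min e1 e2)"
      then have "x' \<in> pts S" "y' \<in> pts S" by (auto simp: fibre_rel_def)
      then have "x' \<in> A" "y' \<in> A" using h e1(2) e2(2) by simp_all
      then show "(x', y') \<in> U" using h e0(2) by simp
    qed
  qed
  moreover obtain \<delta> where \<delta>: "\<delta> > 0" "\<And>x y n. \<lbrakk>x \<in> pts S; y \<in> pts S; mdist (met S) (iter S n x) (iter S n y) < \<delta>\<rbrakk> \<Longrightarrow>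
       \<exists>k. mdist (met S) (iter S (int m * k) x) (iter S (int m * k) y) < e"
    by (rule close_at_multiple[OF S m e]) (rule that)
  ultimately obtain x y n where xy: "(x, y) \<in> U" "mdist (met S) (iter S n x) (iter S n y) < \<delta>"
    using f U unfolding proximally_dense_def by blast
  have xyA: "x \<in> A" "y \<in> A" using xy(1) U_sub by auto
  then obtain k where "mdist (met S) (iter S (int m * k) x) (iter S (int m * k) y) < e"
    using \<delta>(2) xy(2) sub by blast
  then show "\<exists>x y n. (x, y) \<in> U \<and> mdist (met S) (iter (power_subsystem S A m) n x) (iter (power_subsystem S A m) n y) < e"
    using xy(1) xyA by (intro exI[of _ x] exI[of _ y] exI[of _ k]) (simp add: iter_power_subsystem(1)[OF S A])
qed

lemma weakly_mixing_power_subsystem: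
  assumes S: "minimal_tds S" and S': "minimal_tds S'" and f: "factor_map S S' f"
    and RIC: "RIC S S' f" and wm: "weakly_mixing_map S f" and m: "m \<ge> 1"
    and A: "A \<subseteq> pts S" "minimal_tds (power_subsystem S A m)" "openin (top_of S) A"
  shows "weakly_mixing_map (power_subsystem S A m) f"
proof -
  note tS = minimal_tdsD[OF S] and tS' = minimal_tdsD[OF S']
  have inv: "power_invariant S m A" by (rule power_invariantI[OF minimal_tdsD[OF A(2)] A(1)])
  show ?thesis
  proof (rule RIC_proximally_dense_imp_weakly_mixing[OF A(2)])
    show "minimal_tds (power_subsystem S' (f ` A) m)"
      by (rule minimal_power_image[OF tS tS' f A(1,2)])
    show "factor_map (power_subsystem S A m) (power_subsystem S' (f ` A) m) f"
      by (rule factor_map_power_subsystem[OF tS tS' f inv refl])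
    show "RIC (power_subsystem S A m) (power_subsystem S' (f ` A) m) f"
      by (rule RIC_power_subsystem[OF S S' f RIC inv A(3) m])
    show "proximally_dense (power_subsystem S A m) f"
      by (rule proximally_dense_power_subsystem[OF tS weakly_mixing_imp_proximally_dense[OF tS wm] inv A(3) m])
  qed
qed

text \<open>For the harder inclusion, a subsequence of times with constant residue \<open>r\<close>
  mod \<open>m\<close> is selected. Shifted back by \<open>r\<close> these are multiples of
  \<open>m\<close>, and the common limit \<open>z\<close> is replaced by its iterate at
  \<open>- r\<close>. Openness of \<open>A\<close> puts the approximating pairs in the piece from
  some index on.\<close>

lemma Q_rel_power_subsystem:
  assumes S: "is_tds S" and A: "power_invariant S m A" and A_open: "openin (top_of S) A" and m: "m \<ge> 1"
  shows "Q_rel (power_subsystem S A m) f = Q_rel S f \<inter> A \<times> A"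
proof
  note sub = power_invariant_subset[OF A]
  note fib = fibre_rel_power_subsystem[OF sub, of m f]
  let ?P = "power_subsystem S A m"
  show "Q_rel ?P f \<subseteq> Q_rel S f \<inter> A \<times> A"
  proof (clarify, intro conjI IntI SigmaI)
    fix x y assume "(x, y) \<in> Q_rel ?P f"
    then obtain xs ys n z where xs: "\<And>i :: nat. (xs i, ys i) \<in> fibre_rel S f \<inter> A \<times> A"
      and lim: "limitin (subtopology (top_of S) A) xs x sequentially" "limitin (subtopology (top_of S) A) ys y sequentially"
      "limitin (subtopology (top_of S) A) (\<lambda>i. iter ?P (n i) (xs i)) z sequentially"
      "limitin (subtopology (top_of S) A) (\<lambda>i. iter ?P (n i) (ys i)) z sequentially"
      unfolding Q_rel_def fib power_subsystem_simps by blast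
    have it: "iter ?P (n i) (xs i) = iter S (int m * n i) (xs i)" "iter ?P (n i) (ys i) = iter S (int m * n i) (ys i)" for i
      using xs[of i] by (auto intro!: iter_power_subsystem(1)[OF S A])
    show "(x, y) \<in> Q_rel S f"
      unfolding Q_rel_def mem_Collect_eq prod.case
      by (rule exI[of _ xs], rule exI[of _ ys], rule exI[of _ "\<lambda>i. int m * n i"], rule exI[of _ z])
        (use xs lim in \<open>simp add: limitin_subtopology it\<close>)
    show "x \<in> A" "y \<in> A" using lim(1,2) by (simp_all add: limitin_subtopology)
  qed
  show "Q_rel S f \<inter> A \<times> A \<subseteq> Q_rel ?P f"
  proof clarify
    fix x y assume "(x, y) \<in> Q_rel S f" and xA: "x \<in> A" and yA: "y \<in> A"
    then obtain xs ys n z where xs: "\<And>i :: nat. (xs i, ys i) \<in> fibre_rel S f"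
      and lim: "limitin (top_of S) xs x sequentially" "limitin (top_of S) ys y sequentially"
      "limitin (top_of S) (\<lambda>i. iter S (n i) (xs i)) z sequentially"
      "limitin (top_of S) (\<lambda>i. iter S (n i) (ys i)) z sequentially"
      unfolding Q_rel_def by blast
    have in_S: "xs i \<in> pts S" "ys i \<in> pts S" for i using xs[of i] by (auto simp: fibre_rel_def)
    have "\<forall>\<^sub>F i in sequentially. xs i \<in> A \<and> ys i \<in> A"
      using limitinD[OF lim(1) A_open xA] limitinD[OF lim(2) A_open yA] by (rule eventually_conj)
    then obtain N where N: "\<And>i. i \<ge> N \<Longrightarrow> xs i \<in> A \<and> ys i \<in> A"
      unfolding eventually_sequentially by blast
    have "finite ((\<lambda>i. n i mod int m) ` {N..})"
      by (rule finite_subset[of _ "{0..<int m}"]) (use m in auto)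
    then obtain i0 where i0: "infinite {i \<in> {N..}. n i mod int m = n i0 mod int m}"
      using pigeonhole_infinite[of "{N..}"] infinite_Ici by blast
    define r where "r = n i0 mod int m"
    define g where "g = enumerate {i \<in> {N..}. n i mod int m = r}"
    have g: "strict_mono g" "\<And>i. g i \<ge> N" "\<And>i. n (g i) mod int m = r"
      using strict_mono_enumerate[OF i0] enumerate_in_set[OF i0] by (auto simp: g_def r_def)
    let ?k = "\<lambda>i. n (g i) div int m"
    have split: "int m * ?k i = - r + n (g i)" for i
      using mult_div_mod_eq[of "int m" "n (g i)"] g(3)[of i] by linarith
    have gA: "xs (g i) \<in> A" "ys (g i) \<in> A" for i using N[OF g(2)] by auto
    have it: "iter ?P (?k i) w = iter S (- r) (iter S (n (g i)) w)" "iter ?P (?k i) w \<in> A" if "w \<in> A" for i w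
    proof -
      have "w \<in> pts S" using that sub by blast
      then show "iter ?P (?k i) w = iter S (- r) (iter S (n (g i)) w)"
        unfolding iter_power_subsystem(1)[OF S A that] split by (simp add: iter_iter[OF S])
      show "iter ?P (?k i) w \<in> A"
        unfolding iter_power_subsystem(1)[OF S A that] by (rule iter_power_subsystem(2)[OF S A that])
    qed
    have lim3: "limitin (top_of S) (\<lambda>i. iter S (- r) (iter S (n (g i)) (xs (g i)))) (iter S (- r) z) sequentially"
      using continuous_map_limit[OF iter_continuous[OF S, of "- r"] limitin_subsequence[OF g(1) lim(3)]]
      by (simp add: o_def)
    have lim4: "limitin (top_of S) (\<lambda>i. iter S (- r) (iter S (n (g i)) (ys (g i)))) (iter S (- r) z) sequentially"
      using continuous_map_limit[OF iter_continuous[OF S, of "- r"] limitin_subsequence[OF g(1) lim(4)]]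
      by (simp add: o_def)
    have zA: "iter S (- r) z \<in> A"
    proof (rule limitin_closedin[OF lim3])
      show "closedin (top_of S) A" using A by (simp add: power_invariant_def)
      show "\<forall>\<^sub>F i in sequentially. iter S (- r) (iter S (n (g i)) (xs (g i))) \<in> A"
        using it[OF gA(1)] by simp
    qed simp
    show "(x, y) \<in> Q_rel ?P f"
      unfolding Q_rel_def mem_Collect_eq prod.case fib power_subsystem_simps limitin_subtopology
    proof (intro exI conjI allI)
      show "(xs (g i), ys (g i)) \<in> fibre_rel S f \<inter> A \<times> A" for i using xs gA by blast
      show "limitin (top_of S) (\<lambda>i. xs (g i)) x sequentially" "limitin (top_of S) (\<lambda>i. ys (g i)) y sequentially"
        using limitin_subsequence[OF g(1) lim(1)] limitin_subsequence[OF g(1) lim(2)] by (simp_all add: o_def)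
      show "limitin (top_of S) (\<lambda>i. iter ?P (?k i) (xs (g i))) (iter S (- r) z) sequentially"
        "limitin (top_of S) (\<lambda>i. iter ?P (?k i) (ys (g i))) (iter S (- r) z) sequentially"
        unfolding it(1)[OF gA(1)] it(1)[OF gA(2)] by (rule lim3, rule lim4)
    qed (use xA yA zA gA it(2) in auto)
  qed
qed

section \<open>Cyclic decompositions\<close>

lemma cyclic_decompositionD:
  assumes S: "is_tds S" and A: "cyclic_decomposition S m l A" and j: "j \<in> {1..l}"
  shows "A j \<subseteq> pts S" "minimal_tds (power_subsystem S (A j) m)" "power_invariant S m (A j)"
    "openin (top_of S) (A j)" "act S ` A j = A (j mod l + 1)" "j mod l + 1 \<in> {1..l}"
proof -
  have Un: "(\<Union>j\<in>{1..l}. A j) = pts S" and disj: "disjoint_family_on A {1..l}"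
    and min: "\<And>j. j \<in> {1..l} \<Longrightarrow> minimal_tds (power_subsystem S (A j) m)"
    using A unfolding cyclic_decomposition_def by blast+
  have sub: "A j \<subseteq> pts S" if "j \<in> {1..l}" for j using Un that by blast
  have inv: "power_invariant S m (A j)" if "j \<in> {1..l}" for j
    by (rule power_invariantI[OF minimal_tdsD[OF min[OF that]] sub[OF that]])
  show "A j \<subseteq> pts S" "minimal_tds (power_subsystem S (A j) m)" "power_invariant S m (A j)"
    by (rule sub[OF j], rule min[OF j], rule inv[OF j])
  \<comment> \<open>A piece is open, being the complement of the finitely many other pieces, which
    are closed.\<close>
  have "A j = topspace (top_of S) - (\<Union>i\<in>{1..l} - {j}. A i)"
  proof
    show "A j \<subseteq> topspace (top_of S) - (\<Union>i\<in>{1..l} - {j}. A i)"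
      using sub[OF j] disj j unfolding disjoint_family_on_def by fastforce
    show "topspace (top_of S) - (\<Union>i\<in>{1..l} - {j}. A i) \<subseteq> A j"
      using Un by auto
  qed
  moreover have "closedin (top_of S) (\<Union>i\<in>{1..l} - {j}. A i)"
    by (rule closedin_Union) (use inv in \<open>auto simp: power_invariant_def\<close>)
  ultimately show "openin (top_of S) (A j)"
    using openin_diff[OF openin_topspace, of "top_of S"] by metis
  show "act S ` A j = A (j mod l + 1)" using A j unfolding cyclic_decomposition_def by blast
  have "j mod l < l" using j by (intro mod_less_divisor) auto
  then show "j mod l + 1 \<in> {1..l}" by auto
qed

lemma cyclic_decomposition_disjoint:
  "\<lbrakk>cyclic_decomposition S m l A; i \<in> {1..l}; j \<in> {1..l}; x \<in> A i; x \<in> A j\<rbrakk> \<Longrightarrow> i = j"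
  unfolding cyclic_decomposition_def disjoint_family_on_def by blast

text \<open>Indices start at \<open>1\<close>, so the cyclic shift is computed on
  \<open>j - 1\<close> and \<open>1\<close> is added at the end.\<close>

lemma cyclic_decomposition_funpow:
  assumes S: "is_tds S" and A: "cyclic_decomposition S m l A" and j: "j \<in> {1..l}"
  shows "iter S (int k) ` A j = A ((j - 1 + k) mod l + 1)"
proof (induction k)
  case 0
  have "j - 1 < l" using j by auto
  then show ?case using j by simp
next
  case (Suc k)
  let ?i = "(j - 1 + k) mod l + 1"
  have "(j - 1 + k) mod l < l" using j by (intro mod_less_divisor) auto
  then have i: "?i \<in> {1..l}" by auto
  have "iter S (int (Suc k)) ` A j = act S ` iter S (int k) ` A j"
    by (simp add: iter_nat image_comp del: of_nat_Suc)
  also have "\<dots> = A (?i mod l + 1)"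
    unfolding Suc.IH by (rule cyclic_decompositionD(5)[OF S A i])
  also have "?i mod l = (j - 1 + Suc k) mod l"
    by (simp add: mod_Suc_eq)
  finally show ?case .
qed

lemma cyclic_decomposition_iter:
  assumes S: "is_tds S" and A: "cyclic_decomposition S m l A" and m: "m \<ge> 1" and j: "j \<in> {1..l}"
  obtains i where "i \<in> {1..l}" "\<And>x. x \<in> A j \<Longrightarrow> iter S n x \<in> A i"
proof
  \<comment> \<open>A negative time is reached by first going back \<open>\<bar>n\<bar>\<close>
    multiples of \<open>m\<close>, which preserves the piece, and then forward by the nonnegative
    \<open>k\<close>.\<close>
  define k where "k = nat (n + int m * \<bar>n\<bar>)"
  have "\<bar>n\<bar> \<le> int m * \<bar>n\<bar>" using m by (simp add: mult_le_cancel_right1)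
  then have k: "int k = n + int m * \<bar>n\<bar>" by (simp add: k_def)
  have "(j - 1 + k) mod l < l" using j by (intro mod_less_divisor) auto
  then show "(j - 1 + k) mod l + 1 \<in> {1..l}" by auto
  fix x assume x: "x \<in> A j"
  then have xS: "x \<in> pts S" using cyclic_decompositionD(1)[OF S A j] by blast
  have "iter S (int m * (- \<bar>n\<bar>)) x \<in> A j"
    by (rule iter_power_subsystem(2)[OF S cyclic_decompositionD(3)[OF S A j] x])
  then have "iter S (int k) (iter S (int m * (- \<bar>n\<bar>)) x) \<in> A ((j - 1 + k) mod l + 1)"
    unfolding cyclic_decomposition_funpow[OF S A j, symmetric] by (rule imageI)
  then show "iter S n x \<in> A ((j - 1 + k) mod l + 1)"
    by (simp add: iter_iter[OF S xS] k)
qed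

lemma Q_rel_same_piece:
  assumes S: "is_tds S" and A: "cyclic_decomposition S m l A" and m: "m \<ge> 1"
    and Q: "(x, y) \<in> Q_rel S f" and ij: "i \<in> {1..l}" "j \<in> {1..l}" "x \<in> A i" "y \<in> A j"
  shows "i = j"
proof -
  obtain xs ys n z where xs: "\<And>k :: nat. (xs k, ys k) \<in> fibre_rel S f"
    and lim: "limitin (top_of S) xs x sequentially" "limitin (top_of S) ys y sequentially"
      "limitin (top_of S) (\<lambda>i. iter S (n i) (xs i)) z sequentially"
      "limitin (top_of S) (\<lambda>i. iter S (n i) (ys i)) z sequentially"
    using Q unfolding Q_rel_def by blast
  have "z \<in> pts S" using limitin_topspace[OF lim(3)] by simp
  \<comment> \<open>The piece of the common limit. Both iterated sequences are in it eventually, and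
    going back by the same time leads into a single piece.\<close>
  then obtain c where c: "c \<in> {1..l}" "z \<in> A c" using A unfolding cyclic_decomposition_def by blast
  note op = cyclic_decompositionD(4)[OF S A]
  have "\<forall>\<^sub>F k in sequentially. xs k \<in> A i \<and> ys k \<in> A j \<and> iter S (n k) (xs k) \<in> A c \<and> iter S (n k) (ys k) \<in> A c"
    by (intro eventually_conj limitinD[OF lim(1) op] limitinD[OF lim(2) op] limitinD[OF lim(3) op]
        limitinD[OF lim(4) op] ij c)
  then obtain k where k: "xs k \<in> A i" "ys k \<in> A j" "iter S (n k) (xs k) \<in> A c" "iter S (n k) (ys k) \<in> A c"
    using eventually_happens'[OF sequentially_bot] by blast
  have in_S: "xs k \<in> pts S" "ys k \<in> pts S" using xs[of k] by (auto simp: fibre_rel_def)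
  obtain d where d: "d \<in> {1..l}" "\<And>w. w \<in> A c \<Longrightarrow> iter S (- n k) w \<in> A d"
    by (rule cyclic_decomposition_iter[OF S A m c(1), of "- n k"]) (rule that)
  have "xs k \<in> A d" "ys k \<in> A d"
    using d(2)[OF k(3)] d(2)[OF k(4)] by (simp_all add: iter_iter[OF S] in_S)
  then show ?thesis
    using cyclic_decomposition_disjoint[OF A] ij(1,2) d(1) k(1,2) by blast
qed

text \<open>Disjointness has to be assumed since it does not pass to images; it is what may fail for
  the pieces of \<open>Y\<^sub>0\<close>.\<close>

lemma cyclic_decomposition_image:
  assumes S: "is_tds S" and S': "is_tds S'" and f: "factor_map S S' f" and A: "cyclic_decomposition S m l A"
    and disj: "disjoint_family_on (\<lambda>j. f ` A j) {1..l}"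
  shows "cyclic_decomposition S' m l (\<lambda>j. f ` A j)"
  unfolding cyclic_decomposition_def
proof (intro conjI ballI disj)
  note ff = factor_mapD[OF f]
  have "(\<Union>j\<in>{1..l}. A j) = pts S" using A unfolding cyclic_decomposition_def by blast
  then show "(\<Union>j\<in>{1..l}. f ` A j) = pts S'" unfolding ff(2)[symmetric] by blast
  fix j assume j: "j \<in> {1..l}"
  note D = cyclic_decompositionD[OF S A j]
  show "minimal_tds (power_subsystem S' (f ` A j) m)"
    by (rule minimal_power_image[OF S S' f D(1,2)])
  have "act S' ` f ` A j = f ` act S ` A j"
    unfolding image_image by (rule image_cong[OF refl]) (use ff(3) D(1) in auto)
  then show "act S' ` f ` A j = f ` A (j mod l + 1)"
    unfolding D(5) .
qed

section \<open>Minimality of pieces in proximal extensions and inverse limits\<close>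

text \<open>Minimality phrased within \<open>S\<close>, so that pieces are compared through their
  closed T^m-invariant subsets without changing the space.\<close>

lemma minimal_power_subsystem_iff:
  assumes S: "is_tds S" and A: "power_invariant S m A"
  shows "minimal_tds (power_subsystem S A m) \<longleftrightarrow> (\<forall>C. power_invariant S m C \<and> C \<subseteq> A \<longrightarrow> C = A)"
proof
  let ?P = "power_subsystem S A m"
  note sub = power_invariant_subset[OF A]
  have A_closed: "closedin (top_of S) A" using A by (simp add: power_invariant_def)
  {
    assume min: "minimal_tds ?P"
    show "\<forall>C. power_invariant S m C \<and> C \<subseteq> A \<longrightarrow> C = A"
    proof (intro allI impI)
      fix C assume C: "power_invariant S m C \<and> C \<subseteq> A"
      have "C = pts ?P"
      proof (rule minimal_closed_invariant[OF min])
        show "closedin (top_of ?P) C"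
          unfolding power_subsystem_simps using C by (simp add: closedin_subset_topspace power_invariant_def)
        show "C \<noteq> {}" using C by (simp add: power_invariant_def)
        fix x n assume x: "x \<in> C"
        then have "x \<in> A" using C by blast
        then show "iter ?P n x \<in> C"
          using iter_power_subsystem(2)[OF S _ x] C by (simp add: iter_power_subsystem(1)[OF S A])
      qed
      then show "C = A" by (simp add: power_subsystem_pts[OF sub])
    qed
  }
  assume h: "\<forall>C. power_invariant S m C \<and> C \<subseteq> A \<longrightarrow> C = A"
  show "minimal_tds ?P"
  proof (rule minimal_tdsI[OF is_tds_power_subsystem[OF S A]])
    fix C assume C: "closedin (top_of ?P) C" "C \<noteq> {}" "\<And>x n. x \<in> C \<Longrightarrow> iter ?P n x \<in> C"
    have CA: "C \<subseteq> A" using closedin_subset[OF C(1)] by (simp add: power_subsystem_simps)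
    have "power_invariant S m C"
    proof (rule power_invariant_of_iter[OF S _ C(2)])
      show "closedin (top_of S) C"
        using C(1) A_closed unfolding power_subsystem_simps by (rule closedin_trans_full)
      show "iter S (int m * n) x \<in> C" if "x \<in> C" for x n
        using C(3)[OF that] iter_power_subsystem(1)[OF S A] that CA by (simp add: subset_iff)
    qed
    then show "C = pts ?P" using h CA by (simp add: power_subsystem_pts[OF sub])
  qed
qed

lemma power_invariant_preimage:
  assumes S: "is_tds S" and S': "is_tds S'" and f: "factor_map S S' f" and A: "power_invariant S' m A"
  shows "power_invariant S m {x \<in> pts S. f x \<in> A}"
proof (rule power_invariant_of_iter[OF S])
  note ff = factor_mapD[OF f]
  show "closedin (top_of S) {x \<in> pts S. f x \<in> A}"
    using closedin_continuous_map_preimage[OF ff(1)] A by (simp add: power_invariant_def)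
  obtain a where a: "a \<in> A" using A by (auto simp: power_invariant_def)
  then have "a \<in> f ` pts S" using power_invariant_subset[OF A] unfolding ff(2) by blast
  then show "{x \<in> pts S. f x \<in> A} \<noteq> {}" using a by blast
  fix x n assume "x \<in> {x \<in> pts S. f x \<in> A}"
  then show "iter S (int m * n) x \<in> {x \<in> pts S. f x \<in> A}"
    using iter_power_subsystem(2)[OF S' A] by (simp add: iter_in[OF S] factor_map_iter[OF S S' f, symmetric])
qed

lemma power_invariant_iter_preimage:
  assumes S: "is_tds S" and A: "power_invariant S m A"
  shows "power_invariant S m {x \<in> pts S. iter S k x \<in> A}"
proof (rule power_invariant_of_iter[OF S])
  note sub = power_invariant_subset[OF A]
  show "closedin (top_of S) {x \<in> pts S. iter S k x \<in> A}"
    using closedin_continuous_map_preimage[OF iter_continuous[OF S]] A by (simp add: power_invariant_def)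
  obtain a where a: "a \<in> A" using A by (auto simp: power_invariant_def)
  then have "iter S (- k) a \<in> {x \<in> pts S. iter S k x \<in> A}"
    using sub by (auto simp: iter_in[OF S] iter_iter[OF S])
  then show "{x \<in> pts S. iter S k x \<in> A} \<noteq> {}" by blast
  fix x n assume x: "x \<in> {x \<in> pts S. iter S k x \<in> A}"
  then have "iter S (int m * n) (iter S k x) \<in> A"
    by (intro iter_power_subsystem(2)[OF S A]) simp
  then show "iter S (int m * n) x \<in> {x \<in> pts S. iter S k x \<in> A}"
    using x by (simp add: iter_in[OF S] iter_iter[OF S] add.commute)
qed

lemma power_invariant_Int:
  assumes S: "is_tds S" and "power_invariant S m A" "power_invariant S m B" "A \<inter> B \<noteq> {}"
  shows "power_invariant S m (A \<inter> B)"
proof (rule power_invariant_of_iter[OF S _ assms(4)])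
  show "closedin (top_of S) (A \<inter> B)" using assms(2,3) by (simp add: power_invariant_def closedin_Int)
  show "iter S (int m * n) x \<in> A \<inter> B" if "x \<in> A \<inter> B" for x n
    using iter_power_subsystem(2)[OF S assms(2), of x n] iter_power_subsystem(2)[OF S assms(3), of x n] that by simp
qed

text \<open>Minimality of \<open>A\<close> makes the image of \<open>C\<close> all of
  \<open>A\<close>, so that some \<open>c\<close> in \<open>C\<close> and \<open>d\<close> in
  \<open>D\<close> lie over the same point. Their iterates at multiples of \<open>m\<close> come
  arbitrarily close, and a common limit belongs to both closed sets.\<close>

lemma proximal_preimage_meet:
  assumes S: "is_tds S" and S': "is_tds S'" and f: "factor_map S S' f" and prox: "proximal_map S f"
    and m: "m \<ge> 1" and A: "power_invariant S' m A" "minimal_tds (power_subsystem S' A m)"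
    and C: "power_invariant S m C" "f ` C \<subseteq> A" and D: "power_invariant S m D" "f ` D \<subseteq> A"
  shows "C \<inter> D \<noteq> {}"
proof -
  have image: "f ` C = A"
    using A C power_invariant_image[OF S S' f C(1)] minimal_power_subsystem_iff[OF S' A(1)] by blast
  obtain d where d: "d \<in> D" using D(1) by (auto simp: power_invariant_def)
  then have "f d \<in> f ` C" using D(2) image by blast
  then obtain c where c: "c \<in> C" "f c = f d" by (auto simp: image_iff)
  have cd_S: "c \<in> pts S" "d \<in> pts S"
    using c d power_invariant_subset[OF C(1)] power_invariant_subset[OF D(1)] by auto
  have "\<exists>k. mdist (met S) (iter S (int m * k) c) (iter S (int m * k) d) < 1 / (real i + 1)" for i :: nat
  proof -
    have pos: "1 / (real i + 1) > 0" by simp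
    obtain \<delta> where \<delta>: "\<delta> > 0" "\<And>x y n. \<lbrakk>x \<in> pts S; y \<in> pts S; mdist (met S) (iter S n x) (iter S n y) < \<delta>\<rbrakk> \<Longrightarrow>
       \<exists>k. mdist (met S) (iter S (int m * k) x) (iter S (int m * k) y) < 1 / (real i + 1)"
      by (rule close_at_multiple[OF S m pos]) (rule that)
    have "(c, d) \<in> fibre_rel S f" using cd_S c(2) by (simp add: fibre_rel_def)
    then obtain n where "mdist (met S) (iter S n c) (iter S n d) < \<delta>"
      using prox \<delta>(1) unfolding proximal_map_iff by blast
    then show ?thesis using \<delta>(2) cd_S by blast
  qed
  then obtain k where k: "\<And>i :: nat. mdist (met S) (iter S (int m * k i) c) (iter S (int m * k i) d) < 1 / (real i + 1)"
    by metis
  let ?c = "\<lambda>i. iter S (int m * k i) c" and ?d = "\<lambda>i. iter S (int m * k i) d"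
  have cC: "?c i \<in> C" and dD: "?d i \<in> D" for i
    using iter_power_subsystem(2)[OF S C(1) c(1)] iter_power_subsystem(2)[OF S D(1) d] by auto
  obtain r :: "nat filter" where r: "ultrafilter r" "r \<le> sequentially"
    by (rule free_ultrafilter_nat)
  have "\<forall>\<^sub>F i in r. ?c i \<in> topspace (top_of S)" using iter_in[OF S cd_S(1)] by simp
  then obtain z where z: "limitin (top_of S) ?c z r"
    by (rule compact_ultrafilter_limit[OF is_tdsD(2)[OF S] r(1)])
  have zS: "z \<in> pts S" using limitin_topspace[OF z] by simp
  have z': "limitin (top_of S) ?d z r"
  proof (rule limitin_of_mdist[OF zS iter_in[OF S cd_S(2)]])
    fix e :: real assume "e > 0"
    then have e: "e / 2 > 0" by simp
    have "\<forall>\<^sub>F i in r. mdist (met S) (?c i) z < e / 2 \<and> mdist (met S) (?c i) (?d i) < e / 2"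
      using limitin_mdist[OF z e] small_along_free_ultrafilter[OF r(2) k e] by (rule eventually_conj)
    then show "\<forall>\<^sub>F i in r. mdist (met S) (?d i) z < e"
    proof (rule eventually_mono)
      fix i assume "mdist (met S) (?c i) z < e / 2 \<and> mdist (met S) (?c i) (?d i) < e / 2"
      moreover have "mdist (met S) (?d i) z \<le> mdist (met S) (?d i) (?c i) + mdist (met S) (?c i) z"
        by (intro mdist_triangle iter_in[OF S] cd_S zS)
      ultimately show "mdist (met S) (?d i) z < e" by (simp add: mdist_commute[of _ "?d i"])
    qed
  qed
  have "z \<in> C"
    by (rule limitin_closedin[OF z]) (use C(1) cC r(1) in \<open>auto simp: power_invariant_def\<close>)
  moreover have "z \<in> D"
    by (rule limitin_closedin[OF z']) (use D(1) dD r(1) in \<open>auto simp: power_invariant_def\<close>)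
  ultimately show ?thesis by blast
qed

text \<open>For closed \<open>T\<^sup>m\<close>-invariant \<open>C\<close> inside the preimage \<open>B\<close> of a piece, the translates
  \<open>T\<^bsup>-lk\<^esup> C\<close> have a common point by proximality; their intersection \<open>E\<close> is \<open>T\<^sup>l\<close>-invariant, so its
  first \<open>l\<close> translates cover the space by minimality, and only \<open>E\<close> itself meets \<open>B\<close>.\<close>

lemma minimal_proximal_preimage:
  assumes S: "minimal_tds S" and S': "is_tds S'" and f: "factor_map S S' f" and prox: "proximal_map S f"
    and m: "m \<ge> 1" "l dvd m" and A: "cyclic_decomposition S' m l A" and j: "j \<in> {1..l}"
  shows "minimal_tds (power_subsystem S {x \<in> pts S. f x \<in> A j} m)"
proof -
  note tS = minimal_tdsD[OF S]
  note ff = factor_mapD[OF f]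
  note D = cyclic_decompositionD[OF S' A]
  define B where "B = {x \<in> pts S. f x \<in> A j}"
  have B: "power_invariant S m B"
    unfolding B_def by (rule power_invariant_preimage[OF tS S' f D(3)[OF j]])
  have l: "l \<ge> 1" using j by auto
  obtain N where N: "m = l * N" using m(2) by (rule dvdE)
  then have N1: "N \<ge> 1" using m(1) by (cases N) auto
  have "C = B" if C: "power_invariant S m C" "C \<subseteq> B" for C
  proof
    show "C \<subseteq> B" by (rule C(2))
    have C_sub: "C \<subseteq> pts S" by (rule power_invariant_subset[OF C(1)])
    have CA: "f ` C \<subseteq> A j" using C(2) by (auto simp: B_def)
    \<comment> \<open>The pieces recur after \<open>l\<close> steps, also backwards in time: a
      negative time is first compensated by multiples of \<open>m\<close>.\<close>
    have step: "iter S' (int l * k) y \<in> A j" if y: "y \<in> A j" for k y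
    proof -
      have yS: "y \<in> pts S'" using D(1)[OF j] y by blast
      have nat: "iter S' (int l * int i) w \<in> A j" if w: "w \<in> A j" for i w
      proof -
        have "j - 1 < l" using j by auto
        then have "(j - 1 + l * i) mod l + 1 = j" using j by (simp only: mod_mult_self2 mod_less) simp
        then have "iter S' (int (l * i)) ` A j = A j"
          by (simp only: cyclic_decomposition_funpow[OF S' A j])
        then show ?thesis using w by auto
      qed
      define q where "q = nat (k + int N * \<bar>k\<bar>)"
      have "\<bar>k\<bar> \<le> int N * \<bar>k\<bar>" using N1 by (simp add: mult_le_cancel_right1)
      then have q: "int q = k + int N * \<bar>k\<bar>" by (simp add: q_def)
      have "iter S' (int m * (- \<bar>k\<bar>)) y \<in> A j"
        by (rule iter_power_subsystem(2)[OF S' D(3)[OF j] y])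
      from nat[OF this, of q] show ?thesis
        by (simp add: iter_iter[OF S' yS] q N algebra_simps)
    qed
    have meet: "\<exists>D. power_invariant S m D \<and> D \<subseteq> B \<and> (\<forall>x\<in>D. \<forall>i<n. iter S (int l * int i) x \<in> C)" for n :: nat
    proof (induction n)
      case 0
      then show ?case using B by auto
    next
      case (Suc n)
      then obtain D where D: "power_invariant S m D" "D \<subseteq> B" "\<forall>x\<in>D. \<forall>i<n. iter S (int l * int i) x \<in> C"
        by blast
      let ?E = "{x \<in> pts S. iter S (int l * int n) x \<in> C}"
      have E: "power_invariant S m ?E" by (rule power_invariant_iter_preimage[OF tS C(1)])
      have EA: "f ` ?E \<subseteq> A j"
      proof clarify
        fix x assume x: "x \<in> pts S" "iter S (int l * int n) x \<in> C"
        have "f (iter S (int l * int n) x) \<in> A j" using CA x(2) by blast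
        then have "iter S' (int l * int n) (f x) \<in> A j"
          by (simp add: factor_map_iter[OF tS S' f x(1)])
        from step[OF this, of "- int n"] show "f x \<in> A j"
          by (simp add: iter_iter[OF S' ff(4)[OF x(1)]])
      qed
      have "D \<inter> ?E \<noteq> {}"
        by (rule proximal_preimage_meet[OF tS S' f prox m(1) cyclic_decompositionD(3,2)[OF S' A j]  D(1) _ E EA])
          (use D(2) in \<open>auto simp: B_def\<close>)
      then have "power_invariant S m (D \<inter> ?E)" by (rule power_invariant_Int[OF tS D(1) E])
      moreover have "\<forall>x\<in>D \<inter> ?E. \<forall>i<Suc n. iter S (int l * int i) x \<in> C"
        using D(3) by (auto simp: less_Suc_eq)
      ultimately show ?case using D(2) by (intro exI[of _ "D \<inter> ?E"]) blast
    qed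
    define E where "E = {x \<in> pts S. \<forall>i. iter S (int l * i) x \<in> C}"
    have E_iter: "iter S (int l * k) x \<in> E" if "x \<in> E" for x k
      using that unfolding E_def by (simp add: iter_in[OF tS] iter_iter[OF tS] distrib_left[symmetric])
    have "E \<noteq> {}"
    proof -
      \<comment> \<open>The first \<open>N = m / l\<close> translates are enough because
        \<open>C\<close> is T^m-invariant: exponents may be reduced mod \<open>N\<close>.\<close>
      obtain D where D: "power_invariant S m D" "\<forall>x\<in>D. \<forall>i<N. iter S (int l * int i) x \<in> C"
        using meet by blast
      obtain x where x: "x \<in> D" using D(1) by (auto simp: power_invariant_def)
      then have xS: "x \<in> pts S" using power_invariant_subset[OF D(1)] by blast
      have "iter S (int l * i) x \<in> C" for i
      proof -
        define r where "r = nat (i mod int N)"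
        have r: "r < N" "int r = i mod int N" using N1 by (auto simp: r_def nat_less_iff)
        have "iter S (int m * (i div int N)) (iter S (int l * int r) x) \<in> C"
          using D(2) x r(1) by (intro iter_power_subsystem(2)[OF tS C(1)]) blast
        moreover have "int m * (i div int N) + int l * int r = int l * i"
          unfolding r(2) N of_nat_mult mult.assoc distrib_left[symmetric] mult_div_mod_eq by (rule refl)
        ultimately show ?thesis by (simp add: iter_iter[OF tS xS])
      qed
      then show ?thesis using xS unfolding E_def by blast
    qed
    have E_closed: "closedin (top_of S) E"
    proof -
      have "E = (\<Inter>i. {x \<in> topspace (top_of S). iter S (int l * i) x \<in> C})" by (auto simp: E_def)
      also have "closedin (top_of S) \<dots>"
        using C(1) by (intro closedin_Inter) (auto simp: power_invariant_def
            intro!: closedin_continuous_map_preimage[OF iter_continuous[OF tS], simplified])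
      finally show ?thesis .
    qed
    have E_sub: "E \<subseteq> pts S" by (auto simp: E_def)
    \<comment> \<open>A finite union of closed sets, invariant because a translate of
      \<open>E\<close> depends only on the exponent mod \<open>l\<close>.\<close>
    define F where "F = (\<Union>i\<in>{0..<int l}. {x \<in> topspace (top_of S). iter S (- i) x \<in> E})"
    have "F = pts S"
    proof (rule minimal_closed_invariant[OF S])
      show "closedin (top_of S) F"
        unfolding F_def by (rule closedin_Union)
          (use closedin_continuous_map_preimage[OF iter_continuous[OF tS] E_closed] in auto)
      obtain x where "x \<in> E" using \<open>E \<noteq> {}\<close> by blast
      then have "x \<in> F" unfolding F_def using l E_sub by (auto intro!: bexI[of _ 0])
      then show "F \<noteq> {}" by blast
      fix x n assume "x \<in> F"
      then obtain i where i: "x \<in> pts S" "iter S (- i) x \<in> E" by (auto simp: F_def)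
      let ?r = "(n + i) mod int l"
      have "?r \<in> {0..<int l}" using l by simp
      moreover have "iter S (- ?r) (iter S n x) \<in> E"
      proof -
        have "- ?r + n = int l * ((n + i) div int l) + - i"
          using mult_div_mod_eq[of "int l" "n + i"] by linarith
        then have "iter S (- ?r) (iter S n x) = iter S (int l * ((n + i) div int l)) (iter S (- i) x)"
          by (simp add: iter_iter[OF tS i(1)])
        then show ?thesis using E_iter[OF i(2)] by simp
      qed
      ultimately show "iter S n x \<in> F"
        unfolding F_def using iter_in[OF tS i(1)] by auto
    qed
    show "B \<subseteq> C"
    proof
      fix b assume b: "b \<in> B"
      then have bS: "b \<in> pts S" and fb: "f b \<in> A j" by (auto simp: B_def)
      have "b \<in> F" using bS unfolding \<open>F = pts S\<close> .
      then obtain i where i: "i \<in> {0..<int l}" "iter S (- i) b \<in> E"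
        unfolding F_def by auto
      have EC: "E \<subseteq> C"
      proof
        fix x assume "x \<in> E"
        then have "iter S (int l * 0) x \<in> C" unfolding E_def by blast
        then show "x \<in> C" by simp
      qed
      \<comment> \<open>\<open>b\<close> is obtained by \<open>k < l\<close> steps from a point over
        the \<open>j\<close>-th piece and is itself over that piece; hence
        \<open>k = 0\<close>.\<close>
      define k where "k = nat i"
      have k: "int k = i" "k < l" using i(1) by (auto simp: k_def)
      have "f (iter S (- i) b) \<in> A j" using i(2) EC CA by blast
      then have "iter S' (int k) (f (iter S (- i) b)) \<in> iter S' (int k) ` A j" by (rule imageI)
      moreover have "iter S' (int k) (f (iter S (- i) b)) = f b"
        unfolding k(1) by (simp add: factor_map_iter[OF tS S' f] iter_in[OF tS] iter_iter[OF tS] bS)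
      ultimately have "f b \<in> A ((j - 1 + k) mod l + 1)"
        unfolding cyclic_decomposition_funpow[OF S' A j] by (simp only:)
      moreover have "(j - 1 + k) mod l < l" using l by (intro mod_less_divisor) auto
      then have "(j - 1 + k) mod l + 1 \<in> {1..l}" by auto
      ultimately have eq: "(j - 1 + k) mod l + 1 = j"
        using cyclic_decomposition_disjoint[OF A _ j _ fb] by blast
      have "k = 0"
      proof (cases "j - 1 + k < l")
        case True
        from eq[unfolded mod_less[OF True]] show ?thesis using l by arith
      next
        case False
        then have "(j - 1 + k) mod l = (j - 1 + k - l) mod l" by (simp only: le_mod_geq not_less)
        also have "j - 1 + k - l < l" using k(2) j by auto
        then have "(j - 1 + k - l) mod l = j - 1 + k - l" by (rule mod_less)
        finally have mod: "(j - 1 + k) mod l = j - 1 + k - l" .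
        from eq[unfolded mod] show ?thesis using j k(2) False by auto
      qed
      then show "b \<in> C" using i(2) EC k(1) by auto
    qed
  qed
  then show ?thesis
    using minimal_power_subsystem_iff[OF tS B] unfolding B_def by blast
qed

lemma cyclic_decomposition_preimage:
  assumes S: "is_tds S" and S': "is_tds S'" and f: "factor_map S S' f" and A: "cyclic_decomposition S' m l A"
    and min: "\<And>j. j \<in> {1..l} \<Longrightarrow> minimal_tds (power_subsystem S {x \<in> pts S. f x \<in> A j} m)"
  shows "cyclic_decomposition S m l (\<lambda>j. {x \<in> pts S. f x \<in> A j})"
  unfolding cyclic_decomposition_def
proof (intro conjI ballI min)
  note ff = factor_mapD[OF f]
  show "(\<Union>j\<in>{1..l}. {x \<in> pts S. f x \<in> A j}) = pts S"
    using A ff(4) unfolding cyclic_decomposition_def by blast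
  show "disjoint_family_on (\<lambda>j. {x \<in> pts S. f x \<in> A j}) {1..l}"
    using A unfolding cyclic_decomposition_def disjoint_family_on_def by blast
  fix j assume j: "j \<in> {1..l}"
  note D = cyclic_decompositionD[OF S' A j]
  show "act S ` {x \<in> pts S. f x \<in> A j} = {x \<in> pts S. f x \<in> A (j mod l + 1)}"
  proof
    show "act S ` {x \<in> pts S. f x \<in> A j} \<subseteq> {x \<in> pts S. f x \<in> A (j mod l + 1)}"
      using D(5) ff(3) is_tdsD(5)[OF S] by auto
    show "{x \<in> pts S. f x \<in> A (j mod l + 1)} \<subseteq> act S ` {x \<in> pts S. f x \<in> A j}"
    proof clarify
      fix x assume x: "x \<in> pts S" "f x \<in> A (j mod l + 1)"
      have "x \<in> act S ` pts S" using x(1) is_tdsD(5)[OF S] by simp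
      then obtain w where w: "x = act S w" "w \<in> pts S" by (rule imageE)
      have "f x \<in> act S' ` A j" using x(2) unfolding D(5) .
      then obtain a where a: "f x = act S' a" "a \<in> A j" by (rule imageE)
      have "act S' (f w) = act S' a" using a(1) w ff(3) by simp
      then have "f w = a"
        using inj_onD[OF is_tdsD(4)[OF S']] ff(4)[OF w(2)] a(2) D(1) by blast
      then show "x \<in> act S ` {x \<in> pts S. f x \<in> A j}" using w a(2) by blast
    qed
  qed
qed

text \<open>A closed invariant \<open>C\<close> in \<open>B \<nu>\<close> projects onto each
  \<open>B \<mu>\<close> by minimality. For \<open>x\<close> in \<open>B \<nu>\<close>, the sets of
  points of \<open>C\<close> that agree with \<open>x\<close> at level \<open>\<mu>\<close> are
  therefore nonempty; they are compact and decrease with \<open>\<mu>\<close>. A point in all of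
  them agrees with \<open>x\<close> at every level, so it is \<open>x\<close>.\<close>

lemma minimal_inverse_limit:
  fixes \<nu> :: "'i::wellorder"
  assumes S: "\<And>\<mu>. \<mu> \<le> \<nu> \<Longrightarrow> is_tds (S \<mu>)"
    and c: "\<And>\<mu>. \<mu> < \<nu> \<Longrightarrow> factor_map (S \<nu>) (S \<mu>) (c \<nu> \<mu>)"
    and coh: "\<And>\<mu> \<kappa> x. \<lbrakk>\<mu> < \<nu>; \<kappa> \<le> \<mu>; x \<in> pts (S \<nu>)\<rbrakk> \<Longrightarrow> c \<mu> \<kappa> (c \<nu> \<mu> x) = c \<nu> \<kappa> x"
    and inj: "\<And>x y. \<lbrakk>x \<in> pts (S \<nu>); y \<in> pts (S \<nu>); \<And>\<mu>. \<mu> < \<nu> \<Longrightarrow> c \<nu> \<mu> x = c \<nu> \<mu> y\<rbrakk> \<Longrightarrow> x = y"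
    and B: "power_invariant (S \<nu>) m (B \<nu>)"
    and B_sub: "\<And>\<mu>. \<mu> < \<nu> \<Longrightarrow> c \<nu> \<mu> ` B \<nu> \<subseteq> B \<mu>" "\<And>\<mu>. \<mu> < \<nu> \<Longrightarrow> B \<mu> \<subseteq> pts (S \<mu>)"
    and min: "\<And>\<mu>. \<mu> < \<nu> \<Longrightarrow> minimal_tds (power_subsystem (S \<mu>) (B \<mu>) m)"
  shows "minimal_tds (power_subsystem (S \<nu>) (B \<nu>) m)"
proof -
  have tS: "is_tds (S \<nu>)" by (rule S) simp
  have "C = B \<nu>" if C: "power_invariant (S \<nu>) m C" "C \<subseteq> B \<nu>" for C
  proof (intro equalityI C(2) subsetI)
    fix x assume x: "x \<in> B \<nu>"
    then have xS: "x \<in> pts (S \<nu>)" using power_invariant_subset[OF B] by blast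
    have C_sub: "C \<subseteq> pts (S \<nu>)" by (rule power_invariant_subset[OF C(1)])
    have C_closed: "closedin (top_of (S \<nu>)) C" using C(1) by (simp add: power_invariant_def)
    have surj: "c \<nu> \<mu> ` C = B \<mu>" if \<mu>: "\<mu> < \<nu>" for \<mu>
    proof -
      have tS\<mu>: "is_tds (S \<mu>)" using S \<mu> by simp
      have "power_invariant (S \<mu>) m (c \<nu> \<mu> ` C)"
        by (rule power_invariant_image[OF tS tS\<mu> c[OF \<mu>] C(1)])
      moreover have "c \<nu> \<mu> ` C \<subseteq> B \<mu>" using C(2) B_sub(1)[OF \<mu>] by blast
      moreover have "power_invariant (S \<mu>) m (B \<mu>)"
        by (rule power_invariantI[OF minimal_tdsD[OF min[OF \<mu>]] B_sub(2)[OF \<mu>]])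
      ultimately show ?thesis
        using minimal_power_subsystem_iff[OF tS\<mu>] min[OF \<mu>] by blast
    qed
    define F where "F \<mu> = {z \<in> C. c \<nu> \<mu> z = c \<nu> \<mu> x}" for \<mu>
    have F_closed: "closedin (top_of (S \<nu>)) (F \<mu>)" if \<mu>: "\<mu> < \<nu>" for \<mu>
    proof -
      note cc = factor_mapD[OF c[OF \<mu>]]
      have "closedin (top_of (S \<mu>)) {c \<nu> \<mu> x}"
        using cc(4)[OF xS] by (intro compactin_imp_closedin[OF Hausdorff_mtopology_of]) simp
      from closedin_continuous_map_preimage[OF cc(1) this]
      have "closedin (top_of (S \<nu>)) (C \<inter> {z \<in> topspace (top_of (S \<nu>)). c \<nu> \<mu> z \<in> {c \<nu> \<mu> x}})"
        using C_closed by (intro closedin_Int)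
      moreover have "F \<mu> = C \<inter> {z \<in> topspace (top_of (S \<nu>)). c \<nu> \<mu> z \<in> {c \<nu> \<mu> x}}"
        using C_sub by (auto simp: F_def)
      ultimately show ?thesis by simp
    qed
    have F_ne: "F \<mu> \<noteq> {}" if \<mu>: "\<mu> < \<nu>" for \<mu>
    proof -
      have "c \<nu> \<mu> x \<in> c \<nu> \<mu> ` C" using surj[OF \<mu>] B_sub(1)[OF \<mu>] x by blast
      then show ?thesis by (auto simp: F_def image_iff)
    qed
    have F_mono: "F \<mu> \<subseteq> F \<kappa>" if "\<kappa> \<le> \<mu>" "\<mu> < \<nu>" for \<kappa> \<mu>
    proof
      fix z assume z: "z \<in> F \<mu>"
      then have zC: "z \<in> C" and eq: "c \<nu> \<mu> z = c \<nu> \<mu> x" by (auto simp: F_def)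
      have "c \<nu> \<kappa> z = c \<nu> \<kappa> x"
        using coh[OF that(2,1), of z] coh[OF that(2,1) xS] eq zC C_sub by auto
      with zC show "z \<in> F \<kappa>" by (simp add: F_def)
    qed
    \<comment> \<open>\<open>C\<close> is included so that the common point lies in \<open>C\<close>
      even when no index is below \<open>\<nu>\<close>.\<close>
    have "\<Inter>(insert C (F ` {..<\<nu>})) \<noteq> {}"
    proof (rule is_tdsD(2)[OF tS, unfolded compact_space_fip, rule_format], intro conjI allI impI ballI)
      fix T assume "T \<in> insert C (F ` {..<\<nu>})"
      then show "closedin (top_of (S \<nu>)) T" using C_closed F_closed by auto
    next
      fix \<F> assume "finite \<F> \<and> \<F> \<subseteq> insert C (F ` {..<\<nu>})"
      then have fin: "finite (\<F> - {C})" "\<F> - {C} \<subseteq> F ` {..<\<nu>}" by auto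
      obtain I where I: "I \<subseteq> {..<\<nu>}" "finite I" "\<F> - {C} = F ` I"
        using finite_subset_image[OF fin] by blast
      show "\<Inter>\<F> \<noteq> {}"
      proof (cases "I = {}")
        case True
        then have "\<F> \<subseteq> {C}" using I(3) by auto
        moreover have "C \<noteq> {}" using C(1) by (simp add: power_invariant_def)
        ultimately show ?thesis by (auto simp: subset_singleton_iff)
      next
        case False
        then have Max: "Max I \<in> I" "\<And>\<mu>. \<mu> \<in> I \<Longrightarrow> \<mu> \<le> Max I" using I(2) by simp_all
        then have "F (Max I) \<noteq> {}" using F_ne I(1) by auto
        moreover have "F (Max I) \<subseteq> \<Inter>\<F>"
        proof (rule Inter_greatest)
          fix T assume T: "T \<in> \<F>"
          show "F (Max I) \<subseteq> T"
          proof (cases "T = C")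
            case True
            then show ?thesis by (auto simp: F_def)
          next
            case False
            then obtain \<mu> where "\<mu> \<in> I" "T = F \<mu>" using T I(3) by blast
            then show ?thesis using F_mono[OF Max(2)] Max(1) I(1) by blast
          qed
        qed
        ultimately show ?thesis by blast
      qed
    qed
    then obtain z where z: "z \<in> C" "\<And>\<mu>. \<mu> < \<nu> \<Longrightarrow> z \<in> F \<mu>" by auto
    have "z = x"
    proof (rule inj)
      show "z \<in> pts (S \<nu>)" "x \<in> pts (S \<nu>)" using z(1) C_sub xS by auto
      show "c \<nu> \<mu> z = c \<nu> \<mu> x" if "\<mu> < \<nu>" for \<mu> using z(2)[OF that] by (simp add: F_def)
    qed
    with z(1) show "x \<in> C" by simp
  qed
  then show ?thesis using minimal_power_subsystem_iff[OF tS B] by blast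
qed

section \<open>The tower\<close>

text \<open>A thread with entries in the pieces comes from a point of \<open>B \<nu>\<close> because
  membership in \<open>B \<nu>\<close> is decided at the single level \<open>\<kappa>\<close>. Thus
  the homeomorphism onto the space of threads restricts.\<close>

lemma inverse_limit_power_subsystem:
  fixes \<nu> :: "'i::wellorder"
  assumes lim: "is_inverse_limit \<nu> S c" and \<kappa>: "\<kappa> < \<nu>"
    and sub: "\<And>\<mu>. \<mu> \<le> \<nu> \<Longrightarrow> B \<mu> \<subseteq> pts (S \<mu>)"
    and image: "\<And>\<mu>. \<mu> < \<nu> \<Longrightarrow> c \<nu> \<mu> ` B \<nu> \<subseteq> B \<mu>"
    and preimage: "\<And>x. \<lbrakk>x \<in> pts (S \<nu>); c \<nu> \<kappa> x \<in> B \<kappa>\<rbrakk> \<Longrightarrow> x \<in> B \<nu>"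
  shows "is_inverse_limit \<nu> (\<lambda>\<mu>. power_subsystem (S \<mu>) (B \<mu>) m) c"
proof -
  let ?h = "\<lambda>x. \<lambda>\<mu>\<in>{..<\<nu>}. c \<nu> \<mu> x"
  let ?prod = "product_topology (\<lambda>\<mu>. top_of (S \<mu>)) {..<\<nu>}"
  let ?coh = "{t. \<forall>\<mu><\<nu>. \<forall>\<kappa>\<le>\<mu>. c \<mu> \<kappa> (t \<mu>) = t \<kappa>}"
  let ?Th = "(\<Pi>\<^sub>E \<mu>\<in>{..<\<nu>}. pts (S \<mu>)) \<inter> ?coh"
  let ?ThB = "(\<Pi>\<^sub>E \<mu>\<in>{..<\<nu>}. B \<mu>) \<inter> ?coh"
  have Th: "{t \<in> (\<Pi>\<^sub>E \<mu>\<in>{..<\<nu>}. pts (S \<mu>)). \<forall>\<mu><\<nu>. \<forall>\<kappa>\<le>\<mu>. c \<mu> \<kappa> (t \<mu>) = t \<kappa>} = ?Th" by blast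
  have hom: "homeomorphic_map (top_of (S \<nu>)) (subtopology ?prod ?Th) ?h"
    using lim unfolding is_inverse_limit_def Th .
  have PiE_mono: "(\<Pi>\<^sub>E \<mu>\<in>{..<\<nu>}. B \<mu>) \<subseteq> (\<Pi>\<^sub>E \<mu>\<in>{..<\<nu>}. pts (S \<mu>))"
    by (rule PiE_mono) (use sub in auto)
  have top_prod: "topspace (subtopology ?prod ?Th) = ?Th"
    by auto
  have surj: "?h ` pts (S \<nu>) = ?Th"
    using homeomorphic_imp_surjective_map[OF hom] unfolding top_prod by simp
  have image_B: "?h ` (topspace (top_of (S \<nu>)) \<inter> B \<nu>) = topspace (subtopology ?prod ?Th) \<inter> ?ThB"
    unfolding top_prod
  proof
    show "?h ` (topspace (top_of (S \<nu>)) \<inter> B \<nu>) \<subseteq> ?Th \<inter> ?ThB"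
    proof clarify
      fix x assume x: "x \<in> topspace (top_of (S \<nu>))" "x \<in> B \<nu>"
      then have "?h x \<in> ?Th" unfolding surj[symmetric] by simp
      moreover have "?h x \<in> (\<Pi>\<^sub>E \<mu>\<in>{..<\<nu>}. B \<mu>)"
        using image x(2) by (auto simp: restrict_PiE_iff)
      ultimately show "?h x \<in> ?Th \<inter> ?ThB" by blast
    qed
    show "?Th \<inter> ?ThB \<subseteq> ?h ` (topspace (top_of (S \<nu>)) \<inter> B \<nu>)"
    proof
      fix t assume t: "t \<in> ?Th \<inter> ?ThB"
      then have "t \<in> ?h ` pts (S \<nu>)" unfolding surj by blast
      then obtain x where x: "t = ?h x" "x \<in> pts (S \<nu>)" by (rule imageE)
      have "t \<kappa> \<in> B \<kappa>" using t \<kappa> by (auto simp: PiE_iff)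
      then have "c \<nu> \<kappa> x \<in> B \<kappa>" using x(1) \<kappa> by simp
      then show "t \<in> ?h ` (topspace (top_of (S \<nu>)) \<inter> B \<nu>)"
        using preimage[OF x(2)] x by auto
    qed
  qed
  have "homeomorphic_map (subtopology (top_of (S \<nu>)) (B \<nu>)) (subtopology (subtopology ?prod ?Th) ?ThB) ?h"
    by (rule homeomorphic_map_subtopologies[OF hom image_B])
  moreover have "subtopology (subtopology ?prod ?Th) ?ThB =
      subtopology (product_topology (\<lambda>\<mu>. subtopology (top_of (S \<mu>)) (B \<mu>)) {..<\<nu>}) ?ThB"
  proof -
    have "?Th \<inter> ?ThB = ?ThB" "(\<Pi>\<^sub>E \<mu>\<in>{..<\<nu>}. B \<mu>) \<inter> ?ThB = ?ThB" using PiE_mono by blast+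
    then show ?thesis
      unfolding subtopology_product_topology[symmetric] subtopology_subtopology by (simp only:)
  qed
  moreover have "{t \<in> (\<Pi>\<^sub>E \<mu>\<in>{..<\<nu>}. pts (power_subsystem (S \<mu>) (B \<mu>) m)). \<forall>\<mu><\<nu>. \<forall>\<kappa>\<le>\<mu>. c \<mu> \<kappa> (t \<mu>) = t \<kappa>} = ?ThB"
  proof -
    have "(\<Pi>\<^sub>E \<mu>\<in>{..<\<nu>}. pts (power_subsystem (S \<mu>) (B \<mu>) m)) = (\<Pi>\<^sub>E \<mu>\<in>{..<\<nu>}. B \<mu>)"
      by (rule PiE_cong) (use sub in \<open>simp add: power_subsystem_pts\<close>)
    then show ?thesis by blast
  qed
  ultimately show ?thesis
    unfolding is_inverse_limit_def power_subsystem_simps by simp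
qed

lemma inverse_limit_inj:
  assumes "is_inverse_limit \<nu> S c" "x \<in> pts (S \<nu>)" "y \<in> pts (S \<nu>)" "\<And>\<mu>. \<mu> < \<nu> \<Longrightarrow> c \<nu> \<mu> x = c \<nu> \<mu> y"
  shows "x = y"
proof -
  have "inj_on (\<lambda>x. \<lambda>\<mu>\<in>{..<\<nu>}. c \<nu> \<mu> x) (topspace (top_of (S \<nu>)))"
    using assms(1) unfolding is_inverse_limit_def by (rule homeomorphic_imp_injective_map)
  moreover have "(\<lambda>\<mu>\<in>{..<\<nu>}. c \<nu> \<mu> x) = (\<lambda>\<mu>\<in>{..<\<nu>}. c \<nu> \<mu> y)"
    using assms(4) by (intro restrict_ext) simp
  ultimately show ?thesis
    using assms(2,3) by (simp add: inj_on_def)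
qed

section \<open>Zero, successors and limits in a well-order\<close>

lemma ozero_le: "ozero \<le> (\<nu> :: 'i::wellorder)"
  unfolding ozero_def by (rule Least_le) simp

lemma less_osucc: "\<nu> < \<eta> \<Longrightarrow> \<nu> < osucc (\<nu> :: 'i::wellorder)"
  unfolding osucc_def by (rule LeastI)

lemma osucc_le: "\<nu> < \<mu> \<Longrightarrow> osucc (\<nu> :: 'i::wellorder) \<le> \<mu>"
  unfolding osucc_def by (rule Least_le)

text \<open>At a greatest element \<open>osucc\<close> is a \<open>LEAST\<close> over the empty set;
  the first two hypotheses exclude this.\<close>

lemma osucc_inj:
  fixes \<nu> \<mu> :: "'i::wellorder"
  assumes "\<nu> < osucc \<nu>" "\<mu> < osucc \<mu>" "osucc \<nu> = osucc \<mu>"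
  shows "\<nu> = \<mu>"
proof (rule antisym)
  show "\<nu> \<le> \<mu>"
  proof (rule leI, rule notI)
    assume "\<mu> < \<nu>"
    from osucc_le[OF this] assms show False by simp
  qed
  show "\<mu> \<le> \<nu>"
  proof (rule leI, rule notI)
    assume "\<nu> < \<mu>"
    from osucc_le[OF this] assms show False by simp
  qed
qed

lemma ordinal_cases:
  fixes \<nu> :: "'i::wellorder"
  obtains "\<nu> = ozero" | \<mu> where "\<mu> < \<nu>" "\<nu> = osucc \<mu>" | "olimit \<nu>"
proof (cases "\<nu> = ozero \<or> olimit \<nu>")
  case False
  then obtain \<mu> where \<mu>: "\<mu> < \<nu>" "\<not> osucc \<mu> < \<nu>" unfolding olimit_def by blast
  then have "\<nu> = osucc \<mu>" using osucc_le[OF \<mu>(1)] by simp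
  with \<mu>(1) show ?thesis by (rule that(2))
qed (use that in blast)

lemma factor_map_compose:
  assumes "factor_map S1 S2 f" "factor_map S2 S3 g"
  shows "factor_map S1 S3 (\<lambda>x. g (f x))"
proof -
  note f = factor_mapD[OF assms(1)] and g = factor_mapD[OF assms(2)]
  show ?thesis
    unfolding factor_map_def
  proof (intro conjI ballI)
    show "continuous_map (top_of S1) (top_of S3) (\<lambda>x. g (f x))"
      using continuous_map_compose[OF f(1) g(1)] by (simp add: o_def)
    show "(\<lambda>x. g (f x)) ` pts S1 = pts S3"
      unfolding g(2)[symmetric] f(2)[symmetric] by (rule image_image[symmetric])
    show "g (f (act S1 x)) = act S3 (g (f x))" if "x \<in> pts S1" for x
      using f(3,4) g(3) that by simp
  qed
qed

lemma preimage_image: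
  assumes "factor_map S S' f" "A \<subseteq> pts S'"
  shows "f ` {x \<in> pts S. f x \<in> A} = A"
  using assms(2) unfolding factor_mapD(2)[OF assms(1), symmetric] by blast

section \<open>The pieces at all levels of a given tower\<close>

locale PI_tower_power =
  fixes X :: "'a tds" and Y :: "'b tds" and \<pi> :: "'a \<Rightarrow> 'b"
    and m l :: nat and XD :: "nat \<Rightarrow> 'a set"
    and \<eta> :: "'i::wellorder" and P :: "('i, 'a, 'b, 'x, 'y, 'z) tower"
  assumes m: "m \<ge> 1" "l dvd m"
    and tower: "is_PI_tower \<eta> X Y \<pi> P"
    and XD: "cyclic_decomposition X m l XD"
begin

lemma tower_base:
  "minimal_tds X" "minimal_tds Y" "factor_map X Y \<pi>"
  "factor_map (towX P ozero) X (tow\<theta>t0 P)" "proximal_map (towX P ozero) (tow\<theta>t0 P)"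
  "factor_map (towY P ozero) Y (tow\<theta>0 P)" "proximal_map (towY P ozero) (tow\<theta>0 P)"
  "x \<in> pts (towX P ozero) \<Longrightarrow> \<pi> (tow\<theta>t0 P x) = tow\<theta>0 P (tow\<pi> P ozero x)"
  "weakly_mixing_map (towX P \<eta>) (tow\<pi> P \<eta>)"
  using tower by (simp_all add: is_PI_tower_def)

lemma tower_level:
  assumes "\<nu> \<le> \<eta>"
  shows "minimal_tds (towX P \<nu>)" "minimal_tds (towY P \<nu>)"
    "factor_map (towX P \<nu>) (towY P \<nu>) (tow\<pi> P \<nu>)" "RIC (towX P \<nu>) (towY P \<nu>) (tow\<pi> P \<nu>)"
    "is_tds (towX P \<nu>)" "is_tds (towY P \<nu>)"
  using tower assms by (simp_all add: is_PI_tower_def minimal_tdsD)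

lemma tower_succ:
  assumes "\<nu> < \<eta>"
  shows "minimal_tds (towZ P (osucc \<nu>))"
    "factor_map (towX P \<nu>) (towZ P (osucc \<nu>)) (tow\<sigma> P (osucc \<nu>))"
    "fibre_rel (towX P \<nu>) (tow\<sigma> P (osucc \<nu>)) = Q_rel (towX P \<nu>) (tow\<pi> P \<nu>)"
    "factor_map (towZ P (osucc \<nu>)) (towY P \<nu>) (tow\<rho> P (osucc \<nu>))"
    "factor_map (towY P (osucc \<nu>)) (towZ P (osucc \<nu>)) (tow\<theta> P (osucc \<nu>))"
    "proximal_map (towY P (osucc \<nu>)) (tow\<theta> P (osucc \<nu>))"
    "factor_map (towX P (osucc \<nu>)) (towX P \<nu>) (tow\<theta>t P (osucc \<nu>))"
    "proximal_map (towX P (osucc \<nu>)) (tow\<theta>t P (osucc \<nu>))"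
    "x \<in> pts (towX P \<nu>) \<Longrightarrow> tow\<rho> P (osucc \<nu>) (tow\<sigma> P (osucc \<nu>) x) = tow\<pi> P \<nu> x"
    "x' \<in> pts (towX P (osucc \<nu>)) \<Longrightarrow> tow\<sigma> P (osucc \<nu>) (tow\<theta>t P (osucc \<nu>) x') = tow\<theta> P (osucc \<nu>) (tow\<pi> P (osucc \<nu>) x')"
    "x' \<in> pts (towX P (osucc \<nu>)) \<Longrightarrow> conX P (osucc \<nu>) \<nu> x' = tow\<theta>t P (osucc \<nu>) x'"
    "y \<in> pts (towY P (osucc \<nu>)) \<Longrightarrow> conY P (osucc \<nu>) \<nu> y = tow\<rho> P (osucc \<nu>) (tow\<theta> P (osucc \<nu>) y)"
  using tower assms unfolding is_PI_tower_def Let_def by blast+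

lemma tower_con:
  assumes "\<nu> \<le> \<eta>" "\<mu> \<le> \<nu>"
  shows "factor_map (towX P \<nu>) (towX P \<mu>) (conX P \<nu> \<mu>)"
    "factor_map (towY P \<nu>) (towY P \<mu>) (conY P \<nu> \<mu>)"
    "x \<in> pts (towX P \<nu>) \<Longrightarrow> conX P \<nu> \<nu> x = x"
    "y \<in> pts (towY P \<nu>) \<Longrightarrow> conY P \<nu> \<nu> y = y"
    "\<lbrakk>\<kappa> \<le> \<mu>; x \<in> pts (towX P \<nu>)\<rbrakk> \<Longrightarrow> conX P \<mu> \<kappa> (conX P \<nu> \<mu> x) = conX P \<nu> \<kappa> x"
    "\<lbrakk>\<kappa> \<le> \<mu>; y \<in> pts (towY P \<nu>)\<rbrakk> \<Longrightarrow> conY P \<mu> \<kappa> (conY P \<nu> \<mu> y) = conY P \<nu> \<kappa> y"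
    "x \<in> pts (towX P \<nu>) \<Longrightarrow> tow\<pi> P \<mu> (conX P \<nu> \<mu> x) = conY P \<nu> \<mu> (tow\<pi> P \<nu> x)"
  using tower assms by (simp_all add: is_PI_tower_def inverse_system_def)

lemma tower_limit:
  assumes "\<nu> \<le> \<eta>" "olimit \<nu>"
  shows "is_inverse_limit \<nu> (towX P) (conX P)" "is_inverse_limit \<nu> (towY P) (conY P)"
  using tower assms by (simp_all add: is_PI_tower_def)

text \<open>Pulled back in one step through level 0, without recursion over the ordinals;
  \<open>XT_con\<close> gives the compatibility between levels.\<close>

definition XT :: "'i \<Rightarrow> nat \<Rightarrow> 'x set" where
  "XT \<nu> j = {x \<in> pts (towX P \<nu>). tow\<theta>t0 P (conX P \<nu> ozero x) \<in> XD j}"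

definition YT :: "'i \<Rightarrow> nat \<Rightarrow> 'y set" where
  "YT \<nu> j = tow\<pi> P \<nu> ` XT \<nu> j"

text \<open>The union ranges over the unique predecessor of \<open>\<kappa>\<close>.\<close>

definition ZT :: "'i \<Rightarrow> nat \<Rightarrow> 'z set" where
  "ZT \<kappa> j = (\<Union>\<nu>\<in>{\<nu>. \<nu> < \<kappa> \<and> osucc \<nu> = \<kappa>}. tow\<sigma> P \<kappa> ` XT \<nu> j)"

abbreviation XP :: "'i \<Rightarrow> nat \<Rightarrow> 'x tds" where
  "XP \<nu> j \<equiv> power_subsystem (towX P \<nu>) (XT \<nu> j) m"

abbreviation YP :: "'i \<Rightarrow> nat \<Rightarrow> 'y tds" where
  "YP \<nu> j \<equiv> power_subsystem (towY P \<nu>) (YT \<nu> j) m"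

abbreviation ZP :: "'i \<Rightarrow> nat \<Rightarrow> 'z tds" where
  "ZP \<nu> j \<equiv> power_subsystem (towZ P \<nu>) (ZT \<nu> j) m"

lemma ZT_osucc:
  assumes "\<nu> < \<eta>"
  shows "ZT (osucc \<nu>) j = tow\<sigma> P (osucc \<nu>) ` XT \<nu> j"
proof -
  have "{\<mu>. \<mu> < osucc \<nu> \<and> osucc \<mu> = osucc \<nu>} = {\<nu>}"
    using osucc_inj[OF _ less_osucc[OF assms]] less_osucc[OF assms] by auto
  then show ?thesis by (simp add: ZT_def)
qed

lemma XT_subset: "XT \<nu> j \<subseteq> pts (towX P \<nu>)"
  by (auto simp: XT_def)

lemma XT_con:
  assumes "\<nu> \<le> \<eta>" "\<mu> \<le> \<nu>"
  shows "XT \<nu> j = {x \<in> pts (towX P \<nu>). conX P \<nu> \<mu> x \<in> XT \<mu> j}"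
  using factor_mapD(4)[OF tower_con(1)[OF assms]] tower_con(5)[OF assms ozero_le]
  by (auto simp: XT_def)

lemma XT_factor:
  assumes "\<nu> \<le> \<eta>"
  shows "factor_map (towX P \<nu>) X (\<lambda>x. tow\<theta>t0 P (conX P \<nu> ozero x))"
  by (rule factor_map_compose[OF tower_con(1)[OF assms ozero_le] tower_base(4)])

text \<open>Separated from \<open>minimal_XT\<close> because the successor step of that induction
  needs the whole decomposition one level down.\<close>

lemma cyclic_XT_aux:
  assumes "\<nu> \<le> \<eta>" "\<And>j. j \<in> {1..l} \<Longrightarrow> minimal_tds (XP \<nu> j)"
  shows "cyclic_decomposition (towX P \<nu>) m l (XT \<nu>)"
  unfolding XT_def[abs_def]
  by (rule cyclic_decomposition_preimage[OF tower_level(5)[OF assms(1)] minimal_tdsD[OF tower_base(1)] XT_factor[OF assms(1)] XD])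
    (rule assms(2)[unfolded XT_def])

lemma minimal_XT:
  assumes "\<nu> \<le> \<eta>" "j \<in> {1..l}"
  shows "minimal_tds (XP \<nu> j)"
  using assms
proof (induction \<nu> arbitrary: j rule: less_induct)
  case (less \<nu>)
  note \<nu> = less.prems(1) and j = less.prems(2)
  show ?case
  proof (cases \<nu> rule: ordinal_cases)
    case 1
    have "XT ozero j = {x \<in> pts (towX P ozero). tow\<theta>t0 P x \<in> XD j}"
      using tower_con(3)[OF ozero_le order_refl] by (auto simp: XT_def)
    then show ?thesis
      using minimal_proximal_preimage[OF tower_level(1)[OF ozero_le] minimal_tdsD[OF tower_base(1)]
          tower_base(4,5) m XD j] 1 by simp
  next
    case (2 \<mu>)
    have \<mu>: "\<mu> < \<eta>" "\<mu> \<le> \<eta>" using 2(1) \<nu> by auto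
    have "cyclic_decomposition (towX P \<mu>) m l (XT \<mu>)"
      by (rule cyclic_XT_aux[OF \<mu>(2) less.IH[OF 2(1) \<mu>(2)]])
    \<comment> \<open>The connecting map to the predecessor is \<open>tow\<theta>t\<close>, which is
      proximal.\<close>
    from minimal_proximal_preimage[OF tower_level(1)[OF \<nu>, unfolded 2(2)] tower_level(5)[OF \<mu>(2)] tower_succ(7,8)[OF \<mu>(1)] m this j]
    show ?thesis
      using XT_con[OF \<nu> less_imp_le[OF 2(1)], of j] tower_succ(11)[OF \<mu>(1)] unfolding 2(2)
      by (simp cong: conj_cong)
  next
    case 3
    show ?thesis
    proof (rule minimal_inverse_limit[where c = "conX P" and B = "\<lambda>\<mu>. XT \<mu> j"])
      show "is_tds (towX P \<mu>)" if "\<mu> \<le> \<nu>" for \<mu> using tower_level(5) that \<nu> by simp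
      show "factor_map (towX P \<nu>) (towX P \<mu>) (conX P \<nu> \<mu>)" if "\<mu> < \<nu>" for \<mu>
        using tower_con(1)[OF \<nu>] that by simp
      show "conX P \<mu> \<kappa> (conX P \<nu> \<mu> x) = conX P \<nu> \<kappa> x" if "\<mu> < \<nu>" "\<kappa> \<le> \<mu>" "x \<in> pts (towX P \<nu>)" for \<mu> \<kappa> x
        using tower_con(5)[OF \<nu>] that by simp
      show "x = y" if "x \<in> pts (towX P \<nu>)" "y \<in> pts (towX P \<nu>)"
        "\<And>\<mu>. \<mu> < \<nu> \<Longrightarrow> conX P \<nu> \<mu> x = conX P \<nu> \<mu> y" for x y
        by (rule inverse_limit_inj[OF tower_limit(1)[OF \<nu> 3] that])
      show "power_invariant (towX P \<nu>) m (XT \<nu> j)"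
        unfolding XT_def
        by (rule power_invariant_preimage[OF tower_level(5)[OF \<nu>] minimal_tdsD[OF tower_base(1)] XT_factor[OF \<nu>]
            cyclic_decompositionD(3)[OF minimal_tdsD[OF tower_base(1)] XD j]])
      show "conX P \<nu> \<mu> ` XT \<nu> j \<subseteq> XT \<mu> j" if "\<mu> < \<nu>" for \<mu>
        using XT_con[OF \<nu> less_imp_le[OF that], of j] by blast
      show "XT \<mu> j \<subseteq> pts (towX P \<mu>)" for \<mu> by (rule XT_subset)
      show "minimal_tds (XP \<mu> j)" if "\<mu> < \<nu>" for \<mu>
        using less.IH[OF that _ j] that \<nu> by simp
    qed
  qed
qed

lemma cyclic_XT: "\<nu> \<le> \<eta> \<Longrightarrow> cyclic_decomposition (towX P \<nu>) m l (XT \<nu>)"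
  by (rule cyclic_XT_aux) (simp_all add: minimal_XT)

lemma con_image_XT: "\<lbrakk>\<nu> \<le> \<eta>; \<mu> \<le> \<nu>\<rbrakk> \<Longrightarrow> conX P \<nu> \<mu> ` XT \<nu> j = XT \<mu> j"
  unfolding XT_con[of \<nu> \<mu> j] by (rule preimage_image[OF tower_con(1) XT_subset])

lemma con_image_YT:
  assumes "\<nu> \<le> \<eta>" "\<mu> \<le> \<nu>"
  shows "conY P \<nu> \<mu> ` YT \<nu> j = YT \<mu> j"
proof -
  have "conY P \<nu> \<mu> ` YT \<nu> j = tow\<pi> P \<mu> ` conX P \<nu> \<mu> ` XT \<nu> j"
    unfolding YT_def image_image
    by (rule image_cong[OF refl], drule subsetD[OF XT_subset], simp add: tower_con(7)[OF assms])
  then show ?thesis by (simp add: con_image_XT[OF assms] YT_def)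
qed

lemma \<theta>t0_image_XT:
  assumes "j \<in> {1..l}"
  shows "tow\<theta>t0 P ` XT ozero j = XD j"
proof -
  have "XT ozero j = {x \<in> pts (towX P ozero). tow\<theta>t0 P x \<in> XD j}"
    using tower_con(3)[OF ozero_le order_refl] by (auto simp: XT_def)
  then show ?thesis
    using preimage_image[OF tower_base(4) cyclic_decompositionD(1)[OF minimal_tdsD[OF tower_base(1)] XD assms]] by simp
qed

lemma \<theta>t_image_XT:
  assumes "\<nu> < \<eta>"
  shows "tow\<theta>t P (osucc \<nu>) ` XT (osucc \<nu>) j = XT \<nu> j"
proof -
  have s: "osucc \<nu> \<le> \<eta>" "\<nu> \<le> osucc \<nu>"
    using osucc_le[OF assms] less_osucc[OF assms] by auto
  have "tow\<theta>t P (osucc \<nu>) ` XT (osucc \<nu>) j = conX P (osucc \<nu>) \<nu> ` XT (osucc \<nu>) j"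
    by (rule image_cong[OF refl], drule subsetD[OF XT_subset], simp add: tower_succ(11)[OF assms])
  then show ?thesis by (simp add: con_image_XT[OF s])
qed

text \<open>The fibre relation of \<open>tow\<sigma>\<close> is Q, which does not join different
  pieces.\<close>

lemma \<sigma>_same_piece:
  assumes \<nu>: "\<nu> < \<eta>" and ij: "i \<in> {1..l}" "j \<in> {1..l}" and xy: "x \<in> XT \<nu> i" "y \<in> XT \<nu> j"
    and eq: "tow\<sigma> P (osucc \<nu>) x = tow\<sigma> P (osucc \<nu>) y"
  shows "i = j"
proof -
  have "(x, y) \<in> fibre_rel (towX P \<nu>) (tow\<sigma> P (osucc \<nu>))"
    using xy eq XT_subset by (auto simp: fibre_rel_def)
  then have Q: "(x, y) \<in> Q_rel (towX P \<nu>) (tow\<pi> P \<nu>)"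
    unfolding tower_succ(3)[OF \<nu>] .
  show ?thesis
    by (rule Q_rel_same_piece[OF tower_level(5) cyclic_XT m(1) Q ij xy]) (use \<nu> in auto)
qed

text \<open>Both points are projected to the first successor level. There the tower identity between
  \<open>tow\<sigma>\<close> after \<open>tow\<theta>t\<close> and \<open>tow\<theta>\<close> after
  \<open>tow\<pi>\<close> turns equal images in \<open>Y\<close> into equal images in the first
  \<open>Z\<close>, where the pieces are separated.\<close>

lemma \<pi>_same_piece:
  assumes \<nu>: "\<nu> \<le> \<eta>" "\<nu> \<noteq> ozero" and ij: "i \<in> {1..l}" "j \<in> {1..l}" and xy: "x \<in> XT \<nu> i" "y \<in> XT \<nu> j"
    and eq: "tow\<pi> P \<nu> x = tow\<pi> P \<nu> y"
  shows "i = j"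
proof -
  have z: "ozero < \<nu>" using \<nu>(2) ozero_le[of \<nu>] by (simp add: order_le_less)
  then have z': "ozero < \<eta>" using \<nu>(1) by simp
  let ?s = "osucc ozero :: 'i"
  have s: "?s \<le> \<nu>" by (rule osucc_le[OF z])
  have s\<eta>: "?s \<le> \<eta>" using s \<nu>(1) by simp
  let ?x = "conX P \<nu> ?s x" and ?y = "conX P \<nu> ?s y"
  have in_s: "?x \<in> XT ?s i" "?y \<in> XT ?s j"
    using con_image_XT[OF \<nu>(1) s] xy by blast+
  have "tow\<pi> P ?s ?x = tow\<pi> P ?s ?y"
    by (simp only: tower_con(7)[OF \<nu>(1) s subsetD[OF XT_subset xy(1)]]
        tower_con(7)[OF \<nu>(1) s subsetD[OF XT_subset xy(2)]] eq)
  moreover have "?x \<in> pts (towX P ?s)" "?y \<in> pts (towX P ?s)"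
    using in_s XT_subset by auto
  ultimately have "tow\<sigma> P ?s (tow\<theta>t P ?s ?x) = tow\<sigma> P ?s (tow\<theta>t P ?s ?y)"
    by (simp add: tower_succ(10)[OF z'])
  moreover have "tow\<theta>t P ?s ?x \<in> XT ozero i" "tow\<theta>t P ?s ?y \<in> XT ozero j"
    using \<theta>t_image_XT[OF z'] in_s by blast+
  ultimately show ?thesis
    using \<sigma>_same_piece[OF z' ij] by blast
qed

lemma cyclic_YT:
  assumes "\<nu> \<le> \<eta>" "\<nu> \<noteq> ozero"
  shows "cyclic_decomposition (towY P \<nu>) m l (YT \<nu>)"
  unfolding YT_def[abs_def]
proof (rule cyclic_decomposition_image[OF tower_level(5,6,3)[OF assms(1)] cyclic_XT[OF assms(1)]])
  show "disjoint_family_on (\<lambda>j. tow\<pi> P \<nu> ` XT \<nu> j) {1..l}"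
    unfolding disjoint_family_on_def using \<pi>_same_piece[OF assms] by blast
qed

lemma cyclic_ZT:
  assumes "\<nu> < \<eta>"
  shows "cyclic_decomposition (towZ P (osucc \<nu>)) m l (ZT (osucc \<nu>))"
proof -
  have "ZT (osucc \<nu>) = (\<lambda>j. tow\<sigma> P (osucc \<nu>) ` XT \<nu> j)"
    using ZT_osucc[OF assms] by blast
  moreover have "cyclic_decomposition (towZ P (osucc \<nu>)) m l (\<lambda>j. tow\<sigma> P (osucc \<nu>) ` XT \<nu> j)"
  proof (rule cyclic_decomposition_image[OF tower_level(5) minimal_tdsD[OF tower_succ(1)[OF assms]]
        tower_succ(2)[OF assms] cyclic_XT])
    show "disjoint_family_on (\<lambda>j. tow\<sigma> P (osucc \<nu>) ` XT \<nu> j) {1..l}"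
      unfolding disjoint_family_on_def using \<sigma>_same_piece[OF assms] by blast
  qed (use assms in auto)
  ultimately show ?thesis by simp
qed

lemma \<rho>_image_ZT:
  assumes "\<nu> < \<eta>"
  shows "tow\<rho> P (osucc \<nu>) ` ZT (osucc \<nu>) j = YT \<nu> j"
  unfolding ZT_osucc[OF assms] YT_def image_image
  by (rule image_cong[OF refl], drule subsetD[OF XT_subset], simp add: tower_succ(9)[OF assms])

lemma \<theta>_image_YT:
  assumes "\<nu> < \<eta>"
  shows "tow\<theta> P (osucc \<nu>) ` YT (osucc \<nu>) j = ZT (osucc \<nu>) j"
proof -
  have "tow\<theta> P (osucc \<nu>) ` YT (osucc \<nu>) j = tow\<sigma> P (osucc \<nu>) ` tow\<theta>t P (osucc \<nu>) ` XT (osucc \<nu>) j"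
    unfolding YT_def image_image
    by (rule image_cong[OF refl], drule subsetD[OF XT_subset], simp add: tower_succ(10)[OF assms])
  then show ?thesis by (simp add: \<theta>t_image_XT[OF assms] ZT_osucc[OF assms])
qed

lemma \<theta>0_image_YT:
  assumes "j \<in> {1..l}"
  shows "tow\<theta>0 P ` YT ozero j = \<pi> ` XD j"
proof -
  have "tow\<theta>0 P ` YT ozero j = \<pi> ` tow\<theta>t0 P ` XT ozero j"
    unfolding YT_def image_image
    by (rule image_cong[OF refl], drule subsetD[OF XT_subset], simp add: tower_base(8))
  then show ?thesis by (simp add: \<theta>t0_image_XT[OF assms])
qed

lemma invariant_pieces:
  assumes \<nu>: "\<nu> \<le> \<eta>" and j: "j \<in> {1..l}"
  shows "power_invariant (towX P \<nu>) m (XT \<nu> j)" "openin (top_of (towX P \<nu>)) (XT \<nu> j)"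
    "power_invariant (towY P \<nu>) m (YT \<nu> j)" "minimal_tds (YP \<nu> j)"
proof -
  note D = cyclic_decompositionD[OF tower_level(5)[OF \<nu>] cyclic_XT[OF \<nu>] j]
  show "power_invariant (towX P \<nu>) m (XT \<nu> j)" "openin (top_of (towX P \<nu>)) (XT \<nu> j)"
    by (rule D(3), rule D(4))
  show "power_invariant (towY P \<nu>) m (YT \<nu> j)"
    unfolding YT_def by (rule power_invariant_image[OF tower_level(5,6,3)[OF \<nu>] D(3)])
  show "minimal_tds (YP \<nu> j)"
    unfolding YT_def by (rule minimal_power_image[OF tower_level(5,6,3)[OF \<nu>] D(1,2)])
qed

lemma YT_subset: "\<lbrakk>\<nu> \<le> \<eta>; j \<in> {1..l}\<rbrakk> \<Longrightarrow> YT \<nu> j \<subseteq> pts (towY P \<nu>)"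
  by (rule power_invariant_subset[OF invariant_pieces(3)])

text \<open>The pieces of \<open>Y\<close> are defined as images. That a piece at a higher level is
  a full preimage follows from disjointness at level \<open>\<kappa>\<close>, hence the restriction
  to \<open>\<kappa>\<close> above zero.\<close>

lemma YT_preimage:
  assumes \<nu>: "\<nu> \<le> \<eta>" "ozero < \<kappa>" "\<kappa> \<le> \<nu>" and j: "j \<in> {1..l}" and y: "y \<in> pts (towY P \<nu>)" "conY P \<nu> \<kappa> y \<in> YT \<kappa> j"
  shows "y \<in> YT \<nu> j"
proof -
  have \<nu>0: "\<nu> \<noteq> ozero" and \<kappa>: "\<kappa> \<le> \<eta>" "\<kappa> \<noteq> ozero" using \<nu> by auto
  obtain i where i: "i \<in> {1..l}" "y \<in> YT \<nu> i"
    using cyclic_YT[OF \<nu>(1) \<nu>0] y(1) unfolding cyclic_decomposition_def by blast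
  then have "conY P \<nu> \<kappa> y \<in> YT \<kappa> i"
    using con_image_YT[OF \<nu>(1,3)] by blast
  then have "i = j"
    using cyclic_decomposition_disjoint[OF cyclic_YT[OF \<kappa>] i(1) j _ y(2)] by blast
  with i(2) show ?thesis by simp
qed

lemma inverse_system_pieces:
  assumes j: "j \<in> {1..l}"
  shows "inverse_system \<eta> (\<lambda>\<nu>. XP \<nu> j) (conX P)"
    and "inverse_system \<eta> (\<lambda>\<nu>. YP \<nu> j) (conY P)"
proof -
  have X: "x \<in> pts (towX P \<nu>)" if "x \<in> pts (XP \<nu> j)" for \<nu> x
    using that by (simp add: power_subsystem_def)
  have Y: "y \<in> pts (towY P \<nu>)" if "y \<in> pts (YP \<nu> j)" for \<nu> y
    using that by (simp add: power_subsystem_def)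
  show "inverse_system \<eta> (\<lambda>\<nu>. XP \<nu> j) (conX P)"
    unfolding inverse_system_def
  proof (intro conjI allI impI ballI)
    fix \<nu> \<mu> :: 'i assume \<nu>: "\<nu> \<le> \<eta>" and \<mu>: "\<mu> \<le> \<nu>"
    show "factor_map (XP \<nu> j) (XP \<mu> j) (conX P \<nu> \<mu>)"
      by (rule factor_map_power_subsystem[OF tower_level(5)[OF \<nu>] tower_level(5)[OF order_trans[OF \<mu> \<nu>]]
            tower_con(1)[OF \<nu> \<mu>] invariant_pieces(1)[OF \<nu> j] con_image_XT[OF \<nu> \<mu>]])
  qed (use X tower_con(3)[OF _ order_refl] tower_con(5) in auto)
  show "inverse_system \<eta> (\<lambda>\<nu>. YP \<nu> j) (conY P)"
    unfolding inverse_system_def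
  proof (intro conjI allI impI ballI)
    fix \<nu> \<mu> :: 'i assume \<nu>: "\<nu> \<le> \<eta>" and \<mu>: "\<mu> \<le> \<nu>"
    show "factor_map (YP \<nu> j) (YP \<mu> j) (conY P \<nu> \<mu>)"
      by (rule factor_map_power_subsystem[OF tower_level(6)[OF \<nu>] tower_level(6)[OF order_trans[OF \<mu> \<nu>]]
            tower_con(2)[OF \<nu> \<mu>] invariant_pieces(3)[OF \<nu> j] con_image_YT[OF \<nu> \<mu>]])
  qed (use Y tower_con(4)[OF _ order_refl] tower_con(6) in auto)
qed

text \<open>Threads are tested at level 0 for \<open>X\<close>, but at the first successor for
  \<open>Y\<close>, whose pieces at level 0 may overlap. A limit level lies above both.\<close>

lemma inverse_limit_pieces:
  assumes \<nu>: "\<nu> \<le> \<eta>" "olimit \<nu>" and j: "j \<in> {1..l}"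
  shows "is_inverse_limit \<nu> (\<lambda>\<nu>. XP \<nu> j) (conX P)"
    and "is_inverse_limit \<nu> (\<lambda>\<nu>. YP \<nu> j) (conY P)"
proof -
  have z: "ozero < \<nu>" using \<nu>(2) ozero_le[of \<nu>] unfolding olimit_def by (auto simp: order_le_less)
  then have s: "osucc ozero < \<nu>" using \<nu>(2) unfolding olimit_def by blast
  have le: "\<mu> \<le> \<eta>" if "\<mu> \<le> \<nu>" for \<mu> using that \<nu>(1) by simp
  show "is_inverse_limit \<nu> (\<lambda>\<nu>. XP \<nu> j) (conX P)"
  proof (rule inverse_limit_power_subsystem[OF tower_limit(1)[OF \<nu>] z])
    show "XT \<mu> j \<subseteq> pts (towX P \<mu>)" for \<mu> by (rule XT_subset)
    show "conX P \<nu> \<mu> ` XT \<nu> j \<subseteq> XT \<mu> j" if "\<mu> < \<nu>" for \<mu>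
      using con_image_XT[OF \<nu>(1) less_imp_le[OF that], of j] by simp
    show "x \<in> XT \<nu> j" if "x \<in> pts (towX P \<nu>)" "conX P \<nu> ozero x \<in> XT ozero j" for x
      using that unfolding XT_con[OF \<nu>(1) ozero_le, of j] by blast
  qed
  show "is_inverse_limit \<nu> (\<lambda>\<nu>. YP \<nu> j) (conY P)"
  proof (rule inverse_limit_power_subsystem[OF tower_limit(2)[OF \<nu>] s])
    show "YT \<mu> j \<subseteq> pts (towY P \<mu>)" if "\<mu> \<le> \<nu>" for \<mu> by (rule YT_subset[OF le[OF that] j])
    show "conY P \<nu> \<mu> ` YT \<nu> j \<subseteq> YT \<mu> j" if "\<mu> < \<nu>" for \<mu>
      using con_image_YT[OF \<nu>(1) less_imp_le[OF that], of j] by simp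
    show "y \<in> YT \<nu> j" if "y \<in> pts (towY P \<nu>)" "conY P \<nu> (osucc ozero) y \<in> YT (osucc ozero) j" for y
      by (rule YT_preimage[OF \<nu>(1) less_osucc[OF z] less_imp_le[OF s] j that])
  qed
qed

lemma PI_tower_pieces:
  assumes j: "j \<in> {1..l}"
  shows "is_PI_tower \<eta> (power_subsystem X (XD j) m) (power_subsystem Y (\<pi> ` XD j) m) \<pi>
    (restrict_tower m (\<lambda>\<nu>. XT \<nu> j) (\<lambda>\<nu>. YT \<nu> j) (\<lambda>\<nu>. ZT \<nu> j) P)"
proof -
  note tX = minimal_tdsD[OF tower_base(1)] and tY = minimal_tdsD[OF tower_base(2)]
  note DX = cyclic_decompositionD[OF tX XD j]
  note z = ozero_le[of \<eta>]
  have level: "minimal_tds (XP \<nu> j)"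
    "minimal_tds (YP \<nu> j)"
    "factor_map (XP \<nu> j) (YP \<nu> j) (tow\<pi> P \<nu>)"
    "RIC (XP \<nu> j) (YP \<nu> j) (tow\<pi> P \<nu>)"
    if \<nu>: "\<nu> \<le> \<eta>" for \<nu>
  proof -
    note piece = invariant_pieces[OF \<nu> j]
    show "minimal_tds (XP \<nu> j)" by (rule minimal_XT[OF \<nu> j])
    show "minimal_tds (YP \<nu> j)" by (rule piece(4))
    show "factor_map (XP \<nu> j) (YP \<nu> j) (tow\<pi> P \<nu>)"
      by (rule factor_map_power_subsystem[OF tower_level(5,6,3)[OF \<nu>] piece(1)]) (simp add: YT_def)
    show "RIC (XP \<nu> j) (YP \<nu> j) (tow\<pi> P \<nu>)"
      unfolding YT_def by (rule RIC_power_subsystem[OF tower_level(1,2,3,4)[OF \<nu>] piece(1,2) m(1)])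
  qed
  have succ: "minimal_tds (ZP (osucc \<nu>) j)"
    "factor_map (XP \<nu> j) (ZP (osucc \<nu>) j) (tow\<sigma> P (osucc \<nu>))"
    "fibre_rel (XP \<nu> j) (tow\<sigma> P (osucc \<nu>)) =
      Q_rel (XP \<nu> j) (tow\<pi> P \<nu>)"
    "factor_map (ZP (osucc \<nu>) j) (YP \<nu> j) (tow\<rho> P (osucc \<nu>))"
    "factor_map (YP (osucc \<nu>) j) (ZP (osucc \<nu>) j) (tow\<theta> P (osucc \<nu>))"
    "proximal_map (YP (osucc \<nu>) j) (tow\<theta> P (osucc \<nu>))"
    "factor_map (XP (osucc \<nu>) j) (XP \<nu> j) (tow\<theta>t P (osucc \<nu>))"
    "proximal_map (XP (osucc \<nu>) j) (tow\<theta>t P (osucc \<nu>))"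
    if \<nu>: "\<nu> < \<eta>" for \<nu>
  proof -
    have n: "\<nu> \<le> \<eta>" and s: "osucc \<nu> \<le> \<eta>" using \<nu> osucc_le[OF \<nu>] by auto
    note piece = invariant_pieces[OF n j] and piece' = invariant_pieces[OF s j]
    note tZ = minimal_tdsD[OF tower_succ(1)[OF \<nu>]]
    note DZ = cyclic_decompositionD[OF tZ cyclic_ZT[OF \<nu>] j]
    show "minimal_tds (ZP (osucc \<nu>) j)" by (rule DZ(2))
    show "factor_map (XP \<nu> j) (ZP (osucc \<nu>) j) (tow\<sigma> P (osucc \<nu>))"
      by (rule factor_map_power_subsystem[OF tower_level(5)[OF n] tZ tower_succ(2)[OF \<nu>] piece(1) ZT_osucc[OF \<nu>, symmetric]])
    show "fibre_rel (XP \<nu> j) (tow\<sigma> P (osucc \<nu>)) =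
      Q_rel (XP \<nu> j) (tow\<pi> P \<nu>)"
      unfolding fibre_rel_power_subsystem[OF XT_subset] tower_succ(3)[OF \<nu>]
        Q_rel_power_subsystem[OF tower_level(5)[OF n] piece(1,2) m(1)] by (rule refl)
    show "factor_map (ZP (osucc \<nu>) j) (YP \<nu> j) (tow\<rho> P (osucc \<nu>))"
      by (rule factor_map_power_subsystem[OF tZ tower_level(6)[OF n] tower_succ(4)[OF \<nu>] DZ(3) \<rho>_image_ZT[OF \<nu>]])
    show "factor_map (YP (osucc \<nu>) j) (ZP (osucc \<nu>) j) (tow\<theta> P (osucc \<nu>))"
      by (rule factor_map_power_subsystem[OF tower_level(6)[OF s] tZ tower_succ(5)[OF \<nu>] piece'(3) \<theta>_image_YT[OF \<nu>]])
    show "proximal_map (YP (osucc \<nu>) j) (tow\<theta> P (osucc \<nu>))"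
      by (rule proximal_map_power_subsystem[OF tower_level(6)[OF s] tower_succ(6)[OF \<nu>] piece'(3) m(1)])
    show "factor_map (XP (osucc \<nu>) j) (XP \<nu> j) (tow\<theta>t P (osucc \<nu>))"
      by (rule factor_map_power_subsystem[OF tower_level(5)[OF s] tower_level(5)[OF n] tower_succ(7)[OF \<nu>] piece'(1) \<theta>t_image_XT[OF \<nu>]])
    show "proximal_map (XP (osucc \<nu>) j) (tow\<theta>t P (osucc \<nu>))"
      by (rule proximal_map_power_subsystem[OF tower_level(5)[OF s] tower_succ(8)[OF \<nu>] piece'(1) m(1)])
  qed
  note piece0 = invariant_pieces[OF z j]
  have X: "x \<in> pts (towX P \<nu>)" if "x \<in> pts (XP \<nu> j)" for \<nu> x
    using that by (simp add: power_subsystem_def)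
  have Y: "y \<in> pts (towY P \<nu>)" if "y \<in> pts (YP \<nu> j)" for \<nu> y
    using that by (simp add: power_subsystem_def)
  have sel: "towX (restrict_tower m A B C P) = (\<lambda>\<nu>. power_subsystem (towX P \<nu>) (A \<nu>) m)"
    "towY (restrict_tower m A B C P) = (\<lambda>\<nu>. power_subsystem (towY P \<nu>) (B \<nu>) m)"
    "towZ (restrict_tower m A B C P) = (\<lambda>\<nu>. power_subsystem (towZ P \<nu>) (C \<nu>) m)"
    "tow\<pi> (restrict_tower m A B C P) = tow\<pi> P" "tow\<sigma> (restrict_tower m A B C P) = tow\<sigma> P"
    "tow\<rho> (restrict_tower m A B C P) = tow\<rho> P" "tow\<theta>0 (restrict_tower m A B C P) = tow\<theta>0 P"
    "tow\<theta> (restrict_tower m A B C P) = tow\<theta> P" "tow\<theta>t0 (restrict_tower m A B C P) = tow\<theta>t0 P"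
    "tow\<theta>t (restrict_tower m A B C P) = tow\<theta>t P" "conX (restrict_tower m A B C P) = conX P"
    "conY (restrict_tower m A B C P) = conY P" for A B C
    by (simp_all add: restrict_tower_def)
  show ?thesis
    unfolding is_PI_tower_def Let_def sel
  proof (intro conjI allI impI ballI)
    show "minimal_tds (power_subsystem X (XD j) m)" by (rule DX(2))
    show "minimal_tds (power_subsystem Y (\<pi> ` XD j) m)"
      by (rule minimal_power_image[OF tX tY tower_base(3) DX(1,2)])
    show "factor_map (power_subsystem X (XD j) m) (power_subsystem Y (\<pi> ` XD j) m) \<pi>"
      by (rule factor_map_power_subsystem[OF tX tY tower_base(3) DX(3) refl])
    show "factor_map (XP ozero j) (power_subsystem X (XD j) m) (tow\<theta>t0 P)"
      by (rule factor_map_power_subsystem[OF tower_level(5)[OF z] tX tower_base(4) piece0(1) \<theta>t0_image_XT[OF j]])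
    show "proximal_map (XP ozero j) (tow\<theta>t0 P)"
      by (rule proximal_map_power_subsystem[OF tower_level(5)[OF z] tower_base(5) piece0(1) m(1)])
    show "factor_map (YP ozero j) (power_subsystem Y (\<pi> ` XD j) m) (tow\<theta>0 P)"
      by (rule factor_map_power_subsystem[OF tower_level(6)[OF z] tY tower_base(6) piece0(3) \<theta>0_image_YT[OF j]])
    show "proximal_map (YP ozero j) (tow\<theta>0 P)"
      by (rule proximal_map_power_subsystem[OF tower_level(6)[OF z] tower_base(7) piece0(3) m(1)])
    show "weakly_mixing_map (XP \<eta> j) (tow\<pi> P \<eta>)"
      by (rule weakly_mixing_power_subsystem[OF tower_level(1,2,3,4)[OF order_refl] tower_base(9) m(1) XT_subset
            minimal_XT[OF order_refl j] invariant_pieces(2)[OF order_refl j]])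
  qed (simp_all add: level succ inverse_system_pieces[OF j] inverse_limit_pieces[OF _ _ j] X Y tower_base(8)
      tower_succ(9-12) tower_con(7))
qed

end

theorem theorem5p6:
  fixes X :: "'a tds" and Y :: "'b tds" and \<pi> :: "'a \<Rightarrow> 'b"
    and m l :: nat and XD :: "nat \<Rightarrow> 'a set"
    and \<eta> :: "'i::wellorder" and P :: "('i, 'a, 'b, 'x, 'y, 'z) tower"
  assumes "minimal_tds X" and "minimal_tds Y" and "factor_map X Y \<pi>"
    and "m \<ge> 1"
    and "is_PI_tower \<eta> X Y \<pi> P"
    and "l dvd m" and "cyclic_decomposition X m l XD"
  shows "\<exists>(XT :: 'i \<Rightarrow> nat \<Rightarrow> 'x set) (YT :: 'i \<Rightarrow> nat \<Rightarrow> 'y set) (ZT :: 'i \<Rightarrow> nat \<Rightarrow> 'z set).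
    (\<forall>j\<in>{1..l}. YT ozero j = tow\<pi> P ozero ` XT ozero j) \<and>
    (\<forall>\<nu>\<le>\<eta>. cyclic_decomposition (towX P \<nu>) m l (XT \<nu>)) \<and>
    (\<forall>\<nu>\<le>\<eta>. \<nu> \<noteq> ozero \<longrightarrow> cyclic_decomposition (towY P \<nu>) m l (YT \<nu>)) \<and>
    (\<forall>\<nu><\<eta>. cyclic_decomposition (towZ P (osucc \<nu>)) m l (ZT (osucc \<nu>))) \<and>
    (\<forall>j\<in>{1..l}.
       (\<forall>\<nu>\<le>\<eta>. tow\<pi> P \<nu> ` XT \<nu> j = YT \<nu> j) \<and>
       (\<forall>\<nu><\<eta>. tow\<sigma> P (osucc \<nu>) ` XT \<nu> j = ZT (osucc \<nu>) j \<and>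
                tow\<rho> P (osucc \<nu>) ` ZT (osucc \<nu>) j = YT \<nu> j)) \<and>
    (\<forall>j\<in>{1..l}.
       is_PI_tower \<eta> (power_subsystem X (XD j) m) (power_subsystem Y (\<pi> ` XD j) m) \<pi>
         (restrict_tower m (\<lambda>\<nu>. XT \<nu> j) (\<lambda>\<nu>. YT \<nu> j) (\<lambda>\<nu>. ZT \<nu> j) P))"
proof -
  interpret PI_tower_power X Y \<pi> m l XD \<eta> P
    by unfold_locales (use assms in simp_all)
  show ?thesis
    by (intro exI[of _ XT] exI[of _ YT] exI[of _ ZT] conjI ballI allI impI)
      (simp_all add: YT_def[symmetric] cyclic_XT cyclic_YT cyclic_ZT ZT_osucc[symmetric] \<rho>_image_ZT PI_tower_pieces)
qed

end
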